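(* Let $A$ be a symmetric oscillatory matrix of order $n\ge2$, with $p=\operatorname{bw}A$ and $q=\operatorname{bw}A^{-1}$. For $1\le k<n$, $$e_k(A)\le\min\{\max\{k,n-p\},\max\{n-k,n-q\}\}.\qquad( * )$$ If $p+q\ge n$, let $$w=(n-1,n-2,\ldots,n-q+1,\ 1,2,\ldots,p),$$ where the first segment $n-1,\ldots,n-q+1$ is empty for $q=1$. Then for arbitrary positive parameters and every positive diagonal matrix $\Delta$, the matrix $U(w)^T\Delta U(w)$ (same parameters in both factors $U(w)$) is a symmetric oscillatory matrix of order $n$ with bandwidth pair $(\operatorname{bw},\operatorname{bw}\text{ of the inverse})=(p,q)$, and it attains equality in $( * )$ for every $1\le k<n$. These matrices use the minimum number $p+q-1$ of upper factors, that is, $p+q-1$ (the length of $w$) is the smallest length of a sequence $w'$ for which some oscillatory matrix $A'=U(w')^T\Delta' U(w')$ of order $n$ (with positive parameters and positive diagonal $\Delta'$) satisfies $(\operatorname{bw}A',\operatorname{bw}A'^{-1})=(p,q)$. Taking all parameters and all diagonal entries of $\Delta$ equal to one gives an integer realization of determinant one.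
   Context: All matrices are real. A matrix is totally nonnegative (TN) if all its minors are nonnegative and totally positive (TP) if all its minors are positive. A square TN matrix is oscillatory if some positive integer power of it is TP. For an oscillatory matrix $A$ of order $n$ and $1\le k\le n$, $e_k(A)=\min\{m\ge1:\text{all minors of order }k\text{ of }A^m\text{ are positive}\}$. For a square matrix $M=(m_{ij})$, $\operatorname{bw}M=\max(\{0\}\cup\{|i-j|:m_{ij}\ne0\})$ (half-bandwidth). For $1\le i<n$ and $a>0$, $x_i(a)=I+aE_{i,i+1}$, where $E_{ij}$ is the $n\times n$ matrix with single nonzero entry one in position $(i,j)$. For a finite sequence $w=(i_1,\ldots,i_L)$ of indices in $\{1,\ldots,n-1\}$ and positive parameters $a_1,\ldots,a_L$ (different occurrences may have different parameters), $U(w)=x_{i_1}(a_1)\cdots x_{i_L}(a_L)$. The number of upper factors is $L$. A positive diagonal matrix is a diagonal matrix with positive diagonal entries. *)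

theory Defs
  imports
    "Jordan_Normal_Form.Determinant"
    "Jordan_Normal_Form.DL_Submatrix"
    "Jordan_Normal_Form.Gauss_Jordan_Elimination"
begin

definition minors :: "nat \<Rightarrow> real mat \<Rightarrow> real set" where
  "minors k A = {det (submatrix A I J) | I J.
     I \<subseteq> {..<dim_row A} \<and> J \<subseteq> {..<dim_col A} \<and> card I = k \<and> card J = k}"

definition totally_nonnegative :: "real mat \<Rightarrow> bool" where
  "totally_nonnegative A \<longleftrightarrow> (\<forall>k\<ge>1. \<forall>x\<in>minors k A. 0 \<le> x)"

definition totally_positive :: "real mat \<Rightarrow> bool" where
  "totally_positive A \<longleftrightarrow> (\<forall>k\<ge>1. \<forall>x\<in>minors k A. 0 < x)"

definition oscillatory :: "real mat \<Rightarrow> bool" where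
  "oscillatory A \<longleftrightarrow> square_mat A \<and> totally_nonnegative A \<and>
     (\<exists>m\<ge>1. totally_positive (A ^\<^sub>m m))"

text \<open>
  The minimum exists for oscillatory \<open>A\<close> of order \<open>n\<close> and \<open>1 \<le> k \<le> n\<close>; outside that
  range the value is not meaningful.
\<close>
definition minor_exponent :: "nat \<Rightarrow> real mat \<Rightarrow> nat" where
  "minor_exponent k A = (LEAST m. 1 \<le> m \<and> (\<forall>x\<in>minors k (A ^\<^sub>m m). 0 < x))"

definition half_bandwidth :: "'a::zero mat \<Rightarrow> nat" where
  "half_bandwidth M = Max ({0} \<union>
     {nat \<bar>int i - int j\<bar> | i j. i < dim_row M \<and> j < dim_col M \<and> M $$ (i, j) \<noteq> 0})"

text \<open>
  Only meaningful for invertible matrices; oscillatory matrices are invertible, since some power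
  of them has positive determinant.
\<close>
definition inv_mat :: "real mat \<Rightarrow> real mat" where
  "inv_mat A = the (mat_inverse A)"

text \<open>
  The indices of \<open>E\<^sub>i\<^sub>j\<close> and of the factors \<open>x\<^sub>i(a)\<close> are 1-based as in the mathematical text,
  whereas the entries of the type \<open>mat\<close> are indexed from 0.
\<close>
definition matrix_unit :: "nat \<Rightarrow> nat \<Rightarrow> nat \<Rightarrow> real mat" where
  "matrix_unit n i j = mat n n (\<lambda>(r, c). if r + 1 = i \<and> c + 1 = j then 1 else 0)"

definition upper_factor :: "nat \<Rightarrow> nat \<Rightarrow> real \<Rightarrow> real mat" where
  "upper_factor n i a = 1\<^sub>m n + a \<cdot>\<^sub>m matrix_unit n i (i + 1)"

text \<open>
  \<open>upper_product n [i\<^sub>1, \<dots>, i\<^sub>L] [a\<^sub>1, \<dots>, a\<^sub>L]\<close> is \<open>x\<^bsub>i\<^sub>1\<^esub>(a\<^sub>1) \<cdots> x\<^bsub>i\<^sub>L\<^esub>(a\<^sub>L)\<close>; it is only used for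
  an index list and a parameter list of the same length.
\<close>
definition upper_product :: "nat \<Rightarrow> nat list \<Rightarrow> real list \<Rightarrow> real mat" where
  "upper_product n w as = foldr (\<lambda>(i, a) M. upper_factor n i a * M) (zip w as) (1\<^sub>m n)"

definition pos_params :: "nat list \<Rightarrow> real list \<Rightarrow> bool" where
  "pos_params w as \<longleftrightarrow> length as = length w \<and> (\<forall>a\<in>set as. 0 < a)"

definition pos_diagonal :: "nat \<Rightarrow> real mat \<Rightarrow> bool" where
  "pos_diagonal n D \<longleftrightarrow> D \<in> carrier_mat n n \<and> diagonal_mat D \<and> (\<forall>i<n. 0 < D $$ (i, i))"

definition sym_product :: "nat \<Rightarrow> nat list \<Rightarrow> real list \<Rightarrow> real mat \<Rightarrow> real mat" where
  "sym_product n w as D = (upper_product n w as)\<^sup>T * D * upper_product n w as"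

definition realizing_lengths :: "nat \<Rightarrow> nat \<Rightarrow> nat \<Rightarrow> nat set" where
  "realizing_lengths n p q = {length w | w as D.
     set w \<subseteq> {1..<n} \<and> pos_params w as \<and> pos_diagonal n D \<and>
     oscillatory (sym_product n w as D) \<and>
     half_bandwidth (sym_product n w as D) = p \<and>
     half_bandwidth (inv_mat (sym_product n w as D)) = q}"

text \<open>The sequence \<open>n-1, n-2, \<dots>, n-q+1, 1, 2, \<dots>, p\<close>.\<close>
definition extremal_word :: "nat \<Rightarrow> nat \<Rightarrow> nat \<Rightarrow> nat list" where
  "extremal_word n p q = rev [n - q + 1..<n] @ [1..<p + 1]"

definition exponent_bound :: "nat \<Rightarrow> nat \<Rightarrow> nat \<Rightarrow> nat \<Rightarrow> nat" where
  "exponent_bound n p q k = min (max k (n - p)) (max (n - k) (n - q))"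

end

(*
  A symmetric nonsingular totally nonnegative matrix is reduced to a positive diagonal matrix by
  Neville elimination applied to rows and columns simultaneously, so it has the form
  U(w)^T D U(w). Minors of order k of words in elementary factors count families of k
  particles on the sites 0, ..., n-1: the letter i lets a particle hop from site i-1 to the free site i.
  Hence a minor is positive exactly when one configuration can be transported to the other, and the
  hardest minor is the corner one.

  Choose one position for every letter in w. If the letter e+1 is chosen to the left of e, call e a
  descent. The corner transport takes k + #(descents in [k, n-k)) rounds if k <= n-k, and
  n-k + #(ascents in [n-k, k)) otherwise. An entry at distance p from the diagonal of A means that
  w contains p consecutive letters in increasing order, and one at distance q of the inverse means
  that w contains q consecutive letters in decreasing order, which yields the two halves of the bound.
  An increasing and a decreasing subsequence share at most one position, so w has length at least
  p+q-1. For the extremal word a round moves a particle at most to the former site of the next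
  particle, and this limits the transport enough to make the bound sharp.
*)
theory Submission
  imports Defs "HOL-Library.Sublist"
begin

section \<open>Determinants by rows\<close>

text \<open>No Cauchy-Binet expansion occurs: an elementary factor adds a multiple of one row to its
  neighbour, so a minor changes by a multiple of at most one other minor, and positivity is followed
  letter by letter. The obstacle is the factorization. Subtracting a row could destroy total
  nonnegativity; that it does not is an inequality between two minors, drawn from a three-term
  Pluecker relation. In one application of A the transposed factor lowers the row configuration
  before the upper factor raises it. For positivity the lowering half is left idle, so m rounds read
  w exactly m times. Only the corner minor of a power is scheduled explicitly; the others follow by
  factoring the power itself, with a word of its own, and truncating one trajectory. A letter may
  occur often in w, and the descent count bounds the rounds for any choice of occurrences; the two
  halves of the bound use different choices. It yields upper bounds alone. Sharpness for the
  extremal word comes from separate speed limits for the lowest and the highest particle, which p+q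
  \<ge> n allows to be combined.\<close>

definition rowdet :: "nat \<Rightarrow> (nat \<Rightarrow> nat \<Rightarrow> real) \<Rightarrow> real" where
  "rowdet k R = det (mat k k (\<lambda>(a, b). R a b))"

lemma rowdet_cong:
  "(\<And>a b. a < k \<Longrightarrow> b < k \<Longrightarrow> R a b = S a b) \<Longrightarrow> rowdet k R = rowdet k S"
  unfolding rowdet_def by (rule arg_cong[where f = det]) auto

text \<open>The cofactors skip row \<open>t\<close>, hence do not contain \<open>x\<close>: the
  determinant is displayed as a linear form in the replaced row, the shape needed for additivity and
  for the Pluecker relation.\<close>

lemma rowdet_expand_row:
  assumes "t < k"
  shows "rowdet k (R(t := x)) =
    (\<Sum>b<k. x b * ((-1) ^ (t + b) * rowdet (k - 1) (\<lambda>a c. R (insert_index t a) (insert_index b c))))"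
proof -
  have del: "mat_delete (mat k k (\<lambda>(a, b). (R(t := x)) a b)) t b =
      mat (k - 1) (k - 1) (\<lambda>(a, c). R (insert_index t a) (insert_index b c))" if "b < k" for b
    using assms that by (intro eq_matI) (auto simp: mat_delete_def insert_index_def)
  show ?thesis
    unfolding rowdet_def
    by (subst laplace_expansion_row[OF _ assms]) (auto simp: cofactor_def del assms)
qed

lemma rowdet_expand_col:
  assumes "t < k"
  shows "rowdet k R =
    (\<Sum>a<k. R a t * ((-1) ^ (a + t) * rowdet (k - 1) (\<lambda>b c. R (insert_index a b) (insert_index t c))))"
proof -
  have del: "mat_delete (mat k k (\<lambda>(a, b). R a b)) a t =
      mat (k - 1) (k - 1) (\<lambda>(b, c). R (insert_index a b) (insert_index t c))" if "a < k" for a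
    using assms that by (intro eq_matI) (auto simp: mat_delete_def insert_index_def)
  show ?thesis
    unfolding rowdet_def
    by (subst laplace_expansion_column[OF _ assms]) (auto simp: cofactor_def del assms)
qed

lemma rowdet_add_row:
  assumes "t < k"
  shows "rowdet k (R(t := (\<lambda>b. x b + c * y b))) = rowdet k (R(t := x)) + c * rowdet k (R(t := y))"
  unfolding rowdet_expand_row[OF assms]
  by (simp add: algebra_simps sum.distrib sum_distrib_left)

lemma rowdet_zero_row:
  assumes "t < k" "\<And>b. b < k \<Longrightarrow> R t b = 0"
  shows "rowdet k R = 0"
proof -
  have "rowdet k R = rowdet k (R(t := R t))" by simp
  also have "\<dots> = 0" unfolding rowdet_expand_row[OF assms(1)] using assms(2) by simp
  finally show ?thesis .
qed

lemma rowdet_zero_col: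
  assumes "t < k" "\<And>a. a < k \<Longrightarrow> R a t = 0"
  shows "rowdet k R = 0"
  unfolding rowdet_expand_col[OF assms(1)] using assms(2) by simp

lemma rowdet_equal_rows:
  assumes "s < k" "t < k" "s \<noteq> t" "R s = R t"
  shows "rowdet k R = 0"
  unfolding rowdet_def using assms
  by (intro det_identical_rows[OF _ assms(3,1,2)]) (auto simp: row_def)

lemma rowdet_equal_cols:
  assumes "s < k" "t < k" "s \<noteq> t" "\<And>a. a < k \<Longrightarrow> R a s = R a t"
  shows "rowdet k R = 0"
  unfolding rowdet_def using assms
  by (intro det_identical_columns[OF _ assms(3,1,2)]) (auto simp: col_def)

lemma rowdet_transpose: "rowdet k (\<lambda>a b. R b a) = rowdet k R"
proof -
  have "mat k k (\<lambda>(a, b). R b a) = transpose_mat (mat k k (\<lambda>(a, b). R a b))"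
    by (intro eq_matI) auto
  then show ?thesis unfolding rowdet_def
    by (simp add: det_transpose[of _ k])
qed

lemma rowdet_one: "rowdet k (\<lambda>a b. if a = b then 1 else 0) = 1"
proof -
  have "mat k k (\<lambda>(a, b). if a = b then 1 else 0) = (1\<^sub>m k :: real mat)"
    by (intro eq_matI) auto
  then show ?thesis unfolding rowdet_def by simp
qed

section \<open>Pluecker relations between determinants with common rows\<close>

lemma cramer_relation:
  fixes Y :: "nat \<Rightarrow> nat \<Rightarrow> real"
  assumes "c < k"
  shows "(\<Sum>i<Suc k. (-1) ^ i * rowdet k (\<lambda>a. Y (insert_index i a)) * Y i c) = 0"
proof -
  \<comment> \<open>Repeating column \<open>c\<close> as the extra column \<open>k\<close> makes the
    square array singular; expansion along that column is the claimed relation up to the sign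
    \<open>(-1) ^ k\<close>.\<close>
  define Z where "Z = (\<lambda>i b. if b = k then Y i c else Y i b)"
  have "0 = rowdet (Suc k) Z"
    by (rule rowdet_equal_cols[of c _ k, symmetric]) (use assms in \<open>auto simp: Z_def\<close>)
  also have "\<dots> = (\<Sum>a<Suc k. Z a k * ((-1) ^ (a + k) *
      rowdet k (\<lambda>b c. Z (insert_index a b) (insert_index k c))))"
    by (subst rowdet_expand_col[of k]) auto
  also have "\<dots> = (\<Sum>a<Suc k. Y a c * ((-1) ^ (a + k) * rowdet k (\<lambda>b. Y (insert_index a b))))"
    by (intro sum.cong refl arg_cong2[where f = "(*)"] rowdet_cong)
       (auto simp: Z_def insert_index_def)
  also have "\<dots> = (-1) ^ k * (\<Sum>a<Suc k. (-1) ^ a * rowdet k (\<lambda>b. Y (insert_index a b)) * Y a c)"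
    unfolding sum_distrib_left by (intro sum.cong) (auto simp: power_add algebra_simps)
  finally show ?thesis by (simp del: sum.lessThan_Suc)
qed

text \<open>The vectors \<open>v\<close>, \<open>w\<close>, \<open>z\<close> and the
  \<open>k - 2\<close> rows of \<open>R\<close> other than \<open>t\<close> and \<open>Suc t\<close>
  satisfy a linear relation whose coefficients are determinants. Applying the linear form
  \<open>D u\<close> to it kills every term except those of the three vectors, since a fixed row
  would occur twice.\<close>

lemma pluecker_three_term:
  fixes R :: "nat \<Rightarrow> nat \<Rightarrow> real" and u v w z :: "nat \<Rightarrow> real"
  assumes "Suc t < k"
  defines "D \<equiv> \<lambda>x y. rowdet k (R(t := x, Suc t := y))"
  shows "D u v * D w z - D u w * D v z + D u z * D v w = 0"
proof -
  define Y where "Y = (\<lambda>i. if i < t then R i else if i = t then v else if i = Suc t then w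
    else if i = Suc (Suc t) then z else R (i - 1))"
  define \<delta> where "\<delta> = (\<lambda>i. (-1) ^ i * rowdet k (\<lambda>a. Y (insert_index i a)))"
  define C where "C = (\<lambda>b. (-1) ^ (Suc t + b) *
    rowdet (k - 1) (\<lambda>a c. (R(t := u)) (insert_index (Suc t) a) (insert_index b c)))"
  have D: "D u x = (\<Sum>b<k. x b * C b)" for x
    unfolding D_def C_def by (rule rowdet_expand_row) fact
  have "(\<Sum>i<Suc k. \<delta> i * D u (Y i)) = (\<Sum>b<k. C b * (\<Sum>i<Suc k. \<delta> i * Y i b))"
    unfolding D sum_distrib_left by (subst sum.swap) (simp add: algebra_simps)
  also have "\<dots> = 0"
    by (rule sum.neutral) (use cramer_relation[of _ k Y] in \<open>auto simp: \<delta>_def simp del: sum.lessThan_Suc\<close>)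
  finally have zero: "(\<Sum>i<Suc k. \<delta> i * D u (Y i)) = 0" .
  have "D u (Y i) = 0" if "i < Suc k" "i \<notin> {t, Suc t, Suc (Suc t)}" for i
  proof (cases "i < t")
    case True
    then show ?thesis unfolding D_def
      by (intro rowdet_equal_rows[of i _ "Suc t"]) (use assms in \<open>auto simp: Y_def\<close>)
  next
    case False
    then show ?thesis unfolding D_def
      by (intro rowdet_equal_rows[of "i - 1" _ "Suc t"]) (use assms that in \<open>auto simp: Y_def\<close>)
  qed
  then have "(\<Sum>i<Suc k. \<delta> i * D u (Y i)) = (\<Sum>i\<in>{t, Suc t, Suc (Suc t)}. \<delta> i * D u (Y i))"
    by (intro sum.mono_neutral_right) (use assms in auto)
  with zero have "\<delta> t * D u v + \<delta> (Suc t) * D u w + \<delta> (Suc (Suc t)) * D u z = 0"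
    by (simp add: Y_def)
  moreover have "\<delta> t = (-1) ^ t * D w z" "\<delta> (Suc t) = - ((-1) ^ t * D v z)"
    "\<delta> (Suc (Suc t)) = (-1) ^ t * D v w"
    unfolding \<delta>_def D_def
    by (auto intro!: rowdet_cong simp: Y_def insert_index_def fun_upd_def less_Suc_eq)
  ultimately have "(-1) ^ t * (D u v * D w z - D u w * D v z + D u z * D v w) = 0"
    by (simp add: algebra_simps)
  then show ?thesis by simp
qed

text \<open>The case where one of the four vectors is a unit vector.\<close>
lemma pluecker_deleted_column:
  fixes R :: "nat \<Rightarrow> nat \<Rightarrow> real" and u v w :: "nat \<Rightarrow> real"
  assumes "Suc t < k" "j < k"
  defines "D \<equiv> \<lambda>x y. rowdet k (R(t := x, Suc t := y))"
    and "d \<equiv> \<lambda>x. rowdet (k - 1) (\<lambda>a b. (R(t := x)) (insert_index (Suc t) a) (insert_index j b))"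
  shows "D u w * d v = D u v * d w + d u * D v w"
proof -
  define e :: "nat \<Rightarrow> real" where "e = (\<lambda>b. if b = j then 1 else 0)"
  have De: "D x e = (-1) ^ (Suc t + j) * d x" for x
    unfolding D_def rowdet_expand_row[OF assms(1)] d_def e_def using assms(2)
    by (subst sum.remove[of _ j]) auto
  have "D u v * D w e - D u w * D v e + D u e * D v w = 0"
    unfolding D_def by (rule pluecker_three_term) fact
  then have "(-1) ^ (Suc t + j) * (D u v * d w - D u w * d v + d u * D v w) = 0"
    unfolding De by (simp add: algebra_simps)
  then have "D u v * d w - D u w * d v + d u * D v w = 0"
    by (metis mult_eq_0_iff power_eq_0_iff zero_neq_neg_one)
  then show ?thesis by simp
qed

section \<open>Minors and Neville elimination\<close>

text \<open>A \<open>k\<close>-element index set is encoded by its increasing enumeration, so that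
  exchanging one element is a function update. Values of \<open>f\<close> at arguments from
  \<open>k\<close> on are arbitrary; where configurations are compared as functions this has to be
  repaired.\<close>

definition increasing :: "nat \<Rightarrow> nat \<Rightarrow> (nat \<Rightarrow> nat) \<Rightarrow> bool" where
  "increasing n k f \<longleftrightarrow> (\<forall>a<k. f a < n) \<and> (\<forall>a b. a < b \<and> b < k \<longrightarrow> f a < f b)"

definition minor :: "real mat \<Rightarrow> nat \<Rightarrow> (nat \<Rightarrow> nat) \<Rightarrow> (nat \<Rightarrow> nat) \<Rightarrow> real" where
  "minor M k f g = rowdet k (\<lambda>a b. M $$ (f a, g b))"

definition tn :: "nat \<Rightarrow> real mat \<Rightarrow> bool" where
  "tn n M \<longleftrightarrow> (\<forall>k f g. increasing n k f \<longrightarrow> increasing n k g \<longrightarrow> 0 \<le> minor M k f g)"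

lemma increasing_less: "increasing n k f \<Longrightarrow> a < k \<Longrightarrow> f a < n"
  unfolding increasing_def by blast

lemma increasing_mono: "increasing n k f \<Longrightarrow> a < b \<Longrightarrow> b < k \<Longrightarrow> f a < f b"
  unfolding increasing_def by blast

lemma increasing_inj: "increasing n k f \<Longrightarrow> a < k \<Longrightarrow> b < k \<Longrightarrow> f a = f b \<Longrightarrow> a = b"
  unfolding increasing_def by (metis nat_neq_iff)

lemma increasing_less_iff:
  assumes "increasing n k f" "a < k" "b < k"
  shows "f a < f b \<longleftrightarrow> a < b"
  using increasing_mono[OF assms(1), of a b] increasing_mono[OF assms(1), of b a] assms(2,3)
  by (cases a b rule: linorder_cases) auto

lemma increasing_id: "k \<le> n \<Longrightarrow> increasing n k (\<lambda>s. s)"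
  unfolding increasing_def by auto

lemma increasing_ge: "increasing n k f \<Longrightarrow> s < k \<Longrightarrow> s \<le> f s"
proof (induction s)
  case (Suc s)
  then show ?case using increasing_mono[of n k f s "Suc s"] by force
qed simp

lemma increasing_diff:
  assumes "increasing n k f" "s \<le> t" "t < k"
  shows "f s + (t - s) \<le> f t"
  using assms(2,3)
proof (induction t)
  case (Suc t)
  then show ?case using increasing_mono[OF assms(1), of t "Suc t"]
    by (cases "s = Suc t") auto
qed simp

lemma increasing_le_top:
  assumes "increasing n k f" "s < k"
  shows "f s \<le> n - k + s"
  using increasing_diff[OF assms(1), of s "k - 1"] increasing_less[OF assms(1), of "k - 1"] assms(2)
  by force

lemma increasing_card: "increasing n k f \<Longrightarrow> k \<le> n"
  using increasing_ge[of n k f "k - 1"] increasing_less[of n k f "k - 1"] by (cases k) auto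

lemma increasing_top: "k \<le> n \<Longrightarrow> increasing n k (\<lambda>s. n - k + s)"
  unfolding increasing_def by auto

lemma increasing_cong: "(\<And>s. s < k \<Longrightarrow> f s = g s) \<Longrightarrow> increasing n k f \<longleftrightarrow> increasing n k g"
  unfolding increasing_def by (metis less_trans)

lemma increasing_raise:
  assumes "increasing n k f" "s < k" "f s < i" "i < n" "Suc s < k \<Longrightarrow> i < f (Suc s)"
  shows "increasing n k (f(s := i))"
  unfolding increasing_def
proof (intro conjI allI impI)
  fix a b assume ab: "a < b \<and> b < k"
  consider "a = s" | "b = s" | "a \<noteq> s" "b \<noteq> s" by blast
  then show "(f(s := i)) a < (f(s := i)) b"
  proof cases
    case 1
    then have "i < f b" using assms(5) increasing_diff[OF assms(1), of "Suc s" b] ab by force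
    then show ?thesis using 1 ab by simp
  next
    case 2
    then have "f a < f s" using increasing_mono[OF assms(1), of a s] ab by simp
    then show ?thesis using 2 ab assms(3) by simp
  qed (use ab increasing_mono[OF assms(1)] in simp)
qed (use assms increasing_less[OF assms(1)] in simp)

lemma increasing_lower:
  assumes "increasing n k f" "s < k" "i < f s" "0 < s \<Longrightarrow> f (s - 1) < i"
  shows "increasing n k (f(s := i))"
  unfolding increasing_def
proof (intro conjI allI impI)
  fix a b assume ab: "a < b \<and> b < k"
  consider "a = s" | "b = s" | "a \<noteq> s" "b \<noteq> s" by blast
  then show "(f(s := i)) a < (f(s := i)) b"
  proof cases
    case 1
    then have "f s < f b" using increasing_mono[OF assms(1), of s b] ab by simp
    then show ?thesis using 1 ab assms(3) by simp
  next
    case 2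
    then have "f a < i" using assms(4) increasing_diff[OF assms(1), of a "s - 1"] ab assms(2) by force
    then show ?thesis using 2 ab by simp
  qed (use ab increasing_mono[OF assms(1)] in simp)
qed (use assms increasing_less[OF assms(1)] less_trans in force)

lemma increasing_skip:
  assumes "increasing n (Suc k) f"
  shows "increasing n k (\<lambda>a. f (insert_index t a))"
  using assms unfolding increasing_def insert_index_def by auto

section \<open>Minors along increasing enumerations\<close>

lemma minor_cong:
  "(\<And>a. a < k \<Longrightarrow> f a = f' a) \<Longrightarrow> (\<And>a. a < k \<Longrightarrow> g a = g' a) \<Longrightarrow> minor M k f g = minor M k f' g'"
  unfolding minor_def by (rule rowdet_cong) auto

lemma minor_single: "minor M 1 f g = M $$ (f 0, g 0)"
  unfolding minor_def using rowdet_expand_row[of 0 1 "\<lambda>a b. M $$ (f a, g b)" "\<lambda>b. M $$ (f 0, g b)"]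
  by (simp add: rowdet_def fun_upd_def[symmetric] fun_upd_idem det_dim_zero)

lemma minor_two:
  "minor M 2 f g = M $$ (f 0, g 0) * M $$ (f 1, g 1) - M $$ (f 0, g 1) * M $$ (f 1, g 0)"
proof -
  have m: "rowdet 1 R = R 0 0" for R
    using minor_single[of "mat 1 1 (\<lambda>(a, b). R a b)" id id]
    unfolding minor_def by (subst (asm) rowdet_cong[of 1 _ R]) auto
  show ?thesis unfolding minor_def
    by (subst rowdet_expand_col[of 0]) (auto simp: numeral_2_eq_2 insert_index_def m[unfolded One_nat_def])
qed

lemma minor_transpose:
  assumes "M \<in> carrier_mat n n" "increasing n k f" "increasing n k g"
  shows "minor (transpose_mat M) k f g = minor M k g f"
  unfolding minor_def
  by (subst rowdet_transpose[symmetric], rule rowdet_cong)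
     (use assms in \<open>auto simp: increasing_def\<close>)

lemma tn_transpose: "M \<in> carrier_mat n n \<Longrightarrow> tn n M \<Longrightarrow> tn n (transpose_mat M)"
  unfolding tn_def using minor_transpose by metis

lemma tn_entry: "tn n M \<Longrightarrow> i < n \<Longrightarrow> j < n \<Longrightarrow> 0 \<le> M $$ (i, j)"
proof -
  assume a: "tn n M" "i < n" "j < n"
  have "increasing n 1 (\<lambda>_. i)" "increasing n 1 (\<lambda>_. j)" using a by (auto simp: increasing_def)
  then show ?thesis using a(1) minor_single[of M "\<lambda>_. i" "\<lambda>_. j"] unfolding tn_def by metis
qed

text \<open>A row index outside the column set gives a zero row. Otherwise the two index sets
  coincide by cardinality, and so do their increasing enumerations.\<close>

lemma minor_one:
  assumes "increasing n k f" "increasing n k g"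
  shows "minor (1\<^sub>m n) k f g = (if \<forall>s<k. f s = g s then 1 else 0)"
proof (cases "\<forall>s<k. f s = g s")
  case True
  have "minor (1\<^sub>m n) k f g = rowdet k (\<lambda>a b. if a = b then 1 else 0)"
    unfolding minor_def
    by (rule rowdet_cong)
       (use True increasing_less[OF assms(2)] increasing_inj[OF assms(2)] in \<open>auto simp: one_mat_def\<close>)
  then show ?thesis using True rowdet_one by simp
next
  case False
  show ?thesis
  proof (cases "\<forall>s<k. \<exists>t<k. f s = g t")
    case True
    have "f ` {..<k} \<subseteq> g ` {..<k}" using True by auto
    moreover have "inj_on f {..<k}" "inj_on g {..<k}"
      using increasing_inj assms by (auto simp: inj_on_def)
    ultimately have eq: "f ` {..<k} = g ` {..<k}"
      by (intro card_subset_eq) (auto simp: card_image)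
    have "f s = g s" if "s < k" for s
      using that
    proof (induction s rule: less_induct)
      case (less s)
      obtain t where t: "t < k" "f s = g t" using True less.prems by blast
      obtain u where u: "u < k" "g s = f u" using eq less.prems by (metis imageE imageI lessThan_iff)
      show ?case
      proof (rule ccontr)
        assume "f s \<noteq> g s"
        then have "s < t" "s < u"
          using t u less increasing_inj[OF assms(1)] increasing_inj[OF assms(2)]
          by (metis nat_neq_iff)+
        then have "g s < f s" "f s < g s"
          using t u increasing_mono[OF assms(1), of s u] increasing_mono[OF assms(2), of s t] by auto
        then show False by simp
      qed
    qed
    then show ?thesis using False by blast
  next
    case no: False
    then obtain s where "s < k" "\<forall>t<k. f s \<noteq> g t" by blast
    then have "minor (1\<^sub>m n) k f g = 0"
      unfolding minor_def using assms
      by (intro rowdet_zero_row[of s]) (auto simp: increasing_def)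
    then show ?thesis using False by simp
  qed
qed

lemma tn_one: "tn n (1\<^sub>m n)"
  unfolding tn_def using minor_one by auto

text \<open>A relation between entries rather than a matrix product, so that upper factors, lower
  factors and the elimination steps with their negative coefficient are all instances.\<close>

definition row_added :: "nat \<Rightarrow> nat \<Rightarrow> nat \<Rightarrow> real \<Rightarrow> real mat \<Rightarrow> real mat \<Rightarrow> bool" where
  "row_added n i j a M M' \<longleftrightarrow> i < n \<and> j < n \<and> i \<noteq> j \<and>
     (\<forall>r<n. \<forall>c<n. M' $$ (r, c) = M $$ (r, c) + (if r = i then a * M $$ (j, c) else 0))"

lemma minor_row_added_other:
  assumes "row_added n i j a M M'" "increasing n k f" "increasing n k g" "\<And>s. s < k \<Longrightarrow> f s \<noteq> i"
  shows "minor M' k f g = minor M k f g"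
  unfolding minor_def using assms by (intro rowdet_cong) (auto simp: row_added_def increasing_def)

lemma minor_row_added:
  assumes "row_added n i j a M M'" "increasing n k f" "increasing n k g" "s < k" "f s = i"
  shows "minor M' k f g = minor M k f g + a * minor M k (f(s := j)) g"
proof -
  let ?R = "\<lambda>a b. M $$ (f a, g b)"
  have "minor M' k f g = rowdet k (?R(s := (\<lambda>b. M $$ (i, g b) + a * M $$ (j, g b))))"
    unfolding minor_def
  proof (rule rowdet_cong)
    fix a' b assume ab: "a' < k" "b < k"
    have "f a' = i \<longleftrightarrow> a' = s" using increasing_inj[OF assms(2) ab(1) assms(4)] assms(5) by auto
    then show "M' $$ (f a', g b) = (?R(s := (\<lambda>b. M $$ (i, g b) + a * M $$ (j, g b)))) a' b"
      using assms(1,5) increasing_less[OF assms(2) ab(1)] increasing_less[OF assms(3) ab(2)]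
      unfolding row_added_def by simp
  qed
  also have "\<dots> = rowdet k (?R(s := (\<lambda>b. M $$ (i, g b)))) + a * rowdet k (?R(s := (\<lambda>b. M $$ (j, g b))))"
    by (rule rowdet_add_row) fact
  also have "?R(s := (\<lambda>b. M $$ (i, g b))) = ?R" using assms(5) by auto
  also have "?R(s := (\<lambda>b. M $$ (j, g b))) = (\<lambda>a b. M $$ ((f(s := j)) a, g b))" by auto
  finally show ?thesis unfolding minor_def .
qed

lemma minor_row_added_present:
  assumes "row_added n i j a M M'" "increasing n k f" "increasing n k g" "t < k" "f t = j"
  shows "minor M' k f g = minor M k f g"
proof (cases "\<exists>s<k. f s = i")
  case True
  then obtain s where s: "s < k" "f s = i" by blast
  have "minor M k (f(s := j)) g = 0" unfolding minor_def
    by (rule rowdet_equal_rows[of s _ t]) (use s assms in \<open>auto simp: row_added_def\<close>)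
  then show ?thesis using minor_row_added[OF assms(1-3) s] by simp
qed (use minor_row_added_other assms in blast)

text \<open>Adding an adjacent row changes only the minors that contain the modified row but not the
  added one.\<close>
lemma row_added_adjacent_cases:
  assumes "row_added n i j a M M'" "i = Suc j \<or> j = Suc i" "increasing n k f" "increasing n k g"
  obtains "minor M' k f g = minor M k f g"
  | s where "s < k" "f s = i" "increasing n k (f(s := j))"
      "minor M' k f g = minor M k f g + a * minor M k (f(s := j)) g"
      "i = Suc j \<Longrightarrow> 0 < s \<Longrightarrow> f (s - 1) < j"
proof (cases "(\<exists>s<k. f s = i) \<and> \<not> (\<exists>t<k. f t = j)")
  case False
  then show ?thesis
    using minor_row_added_present[OF assms(1,3,4)] minor_row_added_other[OF assms(1,3,4)] that(1) by blast
next
  case True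
  then obtain s where s: "s < k" "f s = i" and no: "\<And>t. t < k \<Longrightarrow> f t \<noteq> j" by blast
  have prev: "f (s - 1) < j" if "i = Suc j" "0 < s"
    using increasing_mono[OF assms(3), of "s - 1" s] no[of "s - 1"] s that by force
  have "increasing n k (f(s := j))"
    using assms(2)
  proof
    assume "i = Suc j"
    then show ?thesis using increasing_lower[OF assms(3) s(1)] s prev by simp
  next
    assume j: "j = Suc i"
    have "j < f (Suc s)" if "Suc s < k"
      using increasing_mono[OF assms(3), of s "Suc s"] no[of "Suc s"] s that j by force
    moreover have "j < n" using assms(1) by (simp add: row_added_def)
    ultimately show ?thesis using increasing_raise[OF assms(3) s(1)] s j by simp
  qed
  then show ?thesis using that(2)[OF s] minor_row_added[OF assms(1,3,4) s] prev by blast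
qed

lemma tn_row_added:
  assumes "tn n M" "row_added n i j a M M'" "i = Suc j \<or> j = Suc i" "0 \<le> a"
  shows "tn n M'"
  unfolding tn_def
proof (intro allI impI)
  fix k f g assume fg: "increasing n k f" "increasing n k g"
  show "0 \<le> minor M' k f g"
    by (rule row_added_adjacent_cases[OF assms(2,3) fg])
       (use assms(1,4) fg in \<open>auto simp: tn_def\<close>)
qed

text \<open>Induction on the number of rows above the eliminated one: the last of them is removed together
  with a suitable column by means of the three-term Pluecker relation.\<close>
lemma elimination_minor_ineq:
  fixes M :: "real mat"
  assumes tn: "tn n M" and M: "M \<in> carrier_mat n n" and c: "c \<le> q" "Suc q < n"
    and left: "\<And>i j. j < c \<Longrightarrow> c \<le> i \<Longrightarrow> i < n \<Longrightarrow> M $$ (i, j) = 0"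
    and below: "\<And>i. Suc q < i \<Longrightarrow> i < n \<Longrightarrow> M $$ (i, c) = 0"
  shows "increasing n k f \<Longrightarrow> increasing n k g \<Longrightarrow> s < k \<Longrightarrow> f s = Suc q \<Longrightarrow> (0 < s \<Longrightarrow> f (s - 1) < q) \<Longrightarrow>
    M $$ (Suc q, c) * minor M k (f(s := q)) g \<le> M $$ (q, c) * minor M k f g"
proof (induction s arbitrary: k f g)
  case 0
  have f_ge: "q < f a" if "a < k" for a
    using increasing_diff[OF \<open>increasing n k f\<close>, of 0 a] that 0 by simp
  obtain k' where k: "k = Suc k'" using \<open>0 < k\<close> by (cases k) auto
  have inc: "increasing n k (f(0 := q))"
    using increasing_lower[OF \<open>increasing n k f\<close>, of 0 q] 0 by simp
  consider "g 0 < c" | "g 0 = c" | "c < g 0" by linarith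
  then show ?case
  proof cases
    case 1
    then have z: "M $$ (i, g 0) = 0" if "q \<le> i" "i < n" for i
      using left that c by simp
    have m1: "minor M k f g = 0" unfolding minor_def
      by (rule rowdet_zero_col[of 0]) (use 0 f_ge increasing_less[OF 0(1)] z in \<open>auto intro!: z simp: less_imp_le\<close>)
    have m2: "minor M k (f(0 := q)) g = 0" unfolding minor_def
      by (rule rowdet_zero_col[of 0])
         (use 0 f_ge increasing_less[OF 0(1)] increasing_less[OF inc] z c in \<open>auto intro!: z simp: less_imp_le\<close>)
    show ?thesis unfolding m1 m2 by simp
  next
    case 2
    \<comment> \<open>Column \<open>c\<close> vanishes below row \<open>Suc q\<close>, so both
      minors are their corner entry times the same complementary minor, and the inequality is an
      equality.\<close>
    have "minor M k h g = M $$ (h 0, c) * rowdet k' (\<lambda>b c. M $$ (f (Suc b), g (Suc c)))"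
      if h: "\<And>a. 0 < a \<Longrightarrow> h a = f a" for h
    proof -
      have z: "M $$ (f a, g 0) = 0" if a: "a < Suc k'" "a \<noteq> 0" for a
      proof -
        have "Suc q < f a" "f a < n"
          using increasing_mono[OF 0(1), of 0 a] increasing_less[OF 0(1), of a] a 0(4) k by auto
        then show ?thesis using below[of "f a"] 2 by simp
      qed
      show ?thesis unfolding minor_def
        by (subst rowdet_expand_col[OF 0(3)], subst sum.remove[of _ 0])
           (use 0(3) 2 k z in \<open>auto simp: insert_index_def h intro!: sum.neutral\<close>)
    qed
    note this[of f] this[of "f(0 := q)", simplified]
    then show ?thesis using 0(4) by (simp del: fun_upd_apply)
  next
    case 3
    \<comment> \<open>Border the minor by row \<open>q\<close> and column \<open>c\<close>. In that
      column only the rows \<open>q\<close> and \<open>Suc q\<close> survive, so the nonnegative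
      minor of order \<open>k + 1\<close> expands into the difference of the two sides.\<close>
    define F where "F = (\<lambda>a. if a = 0 then q else f (a - 1))"
    define G where "G = (\<lambda>a. if a = 0 then c else g (a - 1))"
    define X where "X = (\<lambda>a. M $$ (F a, G 0) * ((-1) ^ (a + 0) *
        rowdet k (\<lambda>b d. M $$ (F (insert_index a b), G (insert_index 0 d)))))"
    have "increasing n (Suc k) F"
      unfolding increasing_def F_def
    proof (intro conjI allI impI)
      fix a b assume ab: "a < b \<and> b < Suc k"
      then have "f (a - 1) < f (b - 1)" if "a \<noteq> 0"
        using increasing_mono[OF 0(1), of "a - 1" "b - 1"] that by force
      moreover have "q < f (b - 1)" using f_ge[of "b - 1"] ab by force
      ultimately show "(if a = 0 then q else f (a - 1)) < (if b = 0 then q else f (b - 1))"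
        using ab by auto
    qed (use increasing_less[OF 0(1)] c in auto)
    moreover have "increasing n (Suc k) G"
      unfolding increasing_def G_def
    proof (intro conjI allI impI)
      fix a b assume ab: "a < b \<and> b < Suc k"
      then have "g (a - 1) < g (b - 1)" if "a \<noteq> 0"
        using increasing_mono[OF 0(2), of "a - 1" "b - 1"] that by force
      moreover have "c < g (b - 1)" using increasing_diff[OF 0(2), of 0 "b - 1"] ab 3 by force
      ultimately show "(if a = 0 then c else g (a - 1)) < (if b = 0 then c else g (b - 1))"
        using ab by auto
    qed (use increasing_less[OF 0(2)] c in auto)
    ultimately have "0 \<le> minor M (Suc k) F G" using tn by (auto simp: tn_def)
    also have "minor M (Suc k) F G = (\<Sum>a<Suc k. X a)"
      unfolding minor_def X_def by (subst rowdet_expand_col[of 0]) auto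
    also have "\<dots> = sum X {0, 1}"
    proof (intro sum.mono_neutral_right ballI)
      fix a assume "a \<in> {..<Suc k} - {0, 1}"
      then have a: "1 < a" "a < Suc k" by auto
      have "Suc q < f (a - 1)" using increasing_mono[OF 0(1), of 0 "a - 1"] a 0(4) by simp
      then have "M $$ (F a, G 0) = 0"
        using below[of "f (a - 1)"] increasing_less[OF 0(1), of "a - 1"] a by (simp add: F_def G_def)
      then show "X a = 0" by (simp add: X_def)
    qed (use k in auto)
    also have "\<dots> = X 0 + X 1" by simp
    also have "X 0 = M $$ (q, c) * minor M k f g"
      unfolding minor_def X_def by (auto intro!: rowdet_cong simp: F_def G_def insert_index_def)
    also have "X 1 = - (M $$ (Suc q, c) * minor M k (f(0 := q)) g)"
      unfolding minor_def X_def using 0(4)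
      by (auto intro!: rowdet_cong simp: F_def G_def insert_index_def)
    finally show ?thesis by (simp del: fun_upd_apply)
  qed
next
  case (Suc s)
  then obtain k' where k: "k = Suc k'" by (cases k) auto
  let ?f' = "f(Suc s := q)"
  have inc: "increasing n k ?f'"
    using increasing_lower[OF Suc.prems(1,3), of q] Suc.prems by simp
  have nonneg: "0 \<le> minor M l h h'" if "increasing n l h" "increasing n l h'" for l h h'
    using tn that by (auto simp: tn_def)
  have x0: "0 \<le> M $$ (q, c)" using tn_entry[OF tn, of q c] c by simp
  show ?case
  proof (cases "minor M k ?f' g = 0")
    case True
    then show ?thesis using nonneg[OF Suc.prems(1,2)] x0 by (simp del: fun_upd_apply)
  next
    case False
    define R where "R = (\<lambda>a b. M $$ (f a, g b))"
    define row where "row = (\<lambda>i b. M $$ (i, g b))"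
    define p where "p = f s"
    define D where "D = (\<lambda>x y. rowdet k (R(s := x, Suc s := y)))"
    \<comment> \<open>Expansion along row \<open>p\<close> yields a column \<open>j\<close> such
      that the minor without row \<open>p\<close> and column \<open>j\<close> is nonzero. It becomes
      \<open>d (row q)\<close>, by which the final inequality is divided.\<close>
    have "minor M k ?f' g = rowdet k ((\<lambda>a b. M $$ (?f' a, g b))(s := row p))"
      unfolding minor_def row_def p_def by (rule rowdet_cong) auto
    also have "\<dots> = (\<Sum>b<k. row p b * ((-1) ^ (s + b) *
        rowdet k' (\<lambda>a d. M $$ (?f' (insert_index s a), g (insert_index b d)))))"
      by (subst rowdet_expand_row) (use Suc.prems k in auto)
    finally have "\<exists>b<k. rowdet k' (\<lambda>a d. M $$ (?f' (insert_index s a), g (insert_index b d))) \<noteq> 0"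
      using False by (metis (no_types, lifting) lessThan_iff mult_zero_right sum.neutral)
    then obtain j where j: "j < k"
      and j0: "minor M k' (\<lambda>a. ?f' (insert_index s a)) (\<lambda>b. g (insert_index j b)) \<noteq> 0"
      unfolding minor_def by blast
    define d where "d = (\<lambda>x. rowdet k' (\<lambda>a b. (R(s := x)) (insert_index (Suc s) a) (insert_index j b)))"
    have incg: "increasing n k' (\<lambda>b. g (insert_index j b))"
      using increasing_skip Suc.prems(2) k by simp
    have dr: "d (row r) = minor M k' (\<lambda>a. if a = s then r else f (insert_index (Suc s) a)) (\<lambda>b. g (insert_index j b))" for r
      unfolding d_def minor_def row_def R_def by (rule rowdet_cong) (auto simp: insert_index_def)
    have dq: "d (row q) = minor M k' (\<lambda>a. ?f' (insert_index s a)) (\<lambda>b. g (insert_index j b))"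
      unfolding dr by (rule minor_cong) (auto simp: insert_index_def)
    have dSq: "d (row (Suc q)) = minor M k' (\<lambda>a. f (insert_index s a)) (\<lambda>b. g (insert_index j b))"
      unfolding dr by (rule minor_cong) (use Suc.prems in \<open>auto simp: insert_index_def\<close>)
    have dp: "d (row p) = minor M k' (\<lambda>a. f (insert_index (Suc s) a)) (\<lambda>b. g (insert_index j b))"
      unfolding dr by (rule minor_cong) (auto simp: insert_index_def p_def)
    have dq_pos: "0 < d (row q)"
      using j0 dq nonneg[OF increasing_skip[OF inc[unfolded k], of s] incg] by simp
    have IH: "M $$ (Suc q, c) * minor M k' ((\<lambda>a. f (insert_index s a))(s := q)) (\<lambda>b. g (insert_index j b))
        \<le> M $$ (q, c) * d (row (Suc q))"
      unfolding dSq
    proof (rule Suc.IH)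
      show "increasing n k' (\<lambda>a. f (insert_index s a))" using increasing_skip Suc.prems(1) k by simp
      assume "0 < s"
      then have "f (s - 1) < f s" using increasing_mono[OF Suc.prems(1), of "s - 1" s] Suc.prems(3) by simp
      then show "f (insert_index s (s - 1)) < q" using Suc.prems(5) \<open>0 < s\<close> by (simp add: insert_index_def)
    qed (use Suc.prems k incg in \<open>auto simp: insert_index_def\<close>)
    also have "minor M k' ((\<lambda>a. f (insert_index s a))(s := q)) (\<lambda>b. g (insert_index j b)) = d (row q)"
      unfolding dq by (rule minor_cong) (auto simp: insert_index_def)
    finally have IH: "M $$ (Suc q, c) * d (row q) \<le> M $$ (q, c) * d (row (Suc q))" .
    have k1: "k - 1 = k'" using k by simp
    \<comment> \<open>Dropping the nonnegative last product turns this identity into an inequality,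
      which is then chained with the induction hypothesis for minors of order
      \<open>k'\<close>.\<close>
    have "D (row p) (row (Suc q)) * d (row q) =
        D (row p) (row q) * d (row (Suc q)) + d (row p) * D (row q) (row (Suc q))"
      unfolding D_def d_def k1[symmetric]
      by (rule pluecker_deleted_column) (use Suc.prems j in auto)
    moreover have "D (row p) (row (Suc q)) = minor M k f g"
      unfolding D_def minor_def R_def row_def p_def
      by (rule rowdet_cong) (use Suc.prems in auto)
    moreover have Dpq: "D (row p) (row q) = minor M k ?f' g"
      unfolding D_def minor_def R_def row_def p_def by (rule rowdet_cong) auto
    moreover have "0 \<le> D (row q) (row (Suc q))"
    proof -
      have "D (row q) (row (Suc q)) = minor M k (f(s := q)) g"
        unfolding D_def minor_def R_def row_def by (rule rowdet_cong) (use Suc.prems in auto)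
      moreover have "increasing n k (f(s := q))"
        by (rule increasing_raise) (use Suc.prems c in auto)
      ultimately show ?thesis using nonneg Suc.prems(2) by simp
    qed
    moreover have "0 \<le> d (row p)"
      unfolding dp by (rule nonneg[OF increasing_skip[OF Suc.prems(1)[unfolded k]] incg])
    ultimately have "minor M k ?f' g * d (row (Suc q)) \<le> minor M k f g * d (row q)" by simp
    then have "M $$ (q, c) * (minor M k ?f' g * d (row (Suc q))) \<le> M $$ (q, c) * (minor M k f g * d (row q))"
      using x0 by (rule mult_left_mono)
    moreover have "minor M k ?f' g * (M $$ (Suc q, c) * d (row q)) \<le> minor M k ?f' g * (M $$ (q, c) * d (row (Suc q)))"
      using IH nonneg[OF inc Suc.prems(2)] by (rule mult_left_mono)
    ultimately have "(M $$ (Suc q, c) * minor M k ?f' g) * d (row q) \<le> (M $$ (q, c) * minor M k f g) * d (row q)"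
      by (simp add: algebra_simps)
    then show ?thesis using dq_pos by (simp del: fun_upd_apply)
  qed
qed

text \<open>A minor changes only if it contains row \<open>Suc q\<close> but not row
  \<open>q\<close>; it then becomes the difference of the two sides of
  \<open>elimination_minor_ineq\<close>, divided by the pivot.\<close>

lemma tn_eliminate:
  assumes tn: "tn n M" and M: "M \<in> carrier_mat n n" and c: "c \<le> q" "Suc q < n"
    and left: "\<And>i j. j < c \<Longrightarrow> c \<le> i \<Longrightarrow> i < n \<Longrightarrow> M $$ (i, j) = 0"
    and below: "\<And>i. Suc q < i \<Longrightarrow> i < n \<Longrightarrow> M $$ (i, c) = 0"
    and pos: "0 < M $$ (q, c)"
    and op: "row_added n (Suc q) q (- (M $$ (Suc q, c) / M $$ (q, c))) M M'"
  shows "tn n M'"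
  unfolding tn_def
proof (intro allI impI)
  fix k f g assume fg: "increasing n k f" "increasing n k g"
  show "0 \<le> minor M' k f g"
  proof (rule row_added_adjacent_cases[OF op _ fg])
    fix s assume s: "s < k" "f s = Suc q" and prev: "Suc q = Suc q \<Longrightarrow> 0 < s \<Longrightarrow> f (s - 1) < q"
      and eq: "minor M' k f g = minor M k f g + - (M $$ (Suc q, c) / M $$ (q, c)) * minor M k (f(s := q)) g"
    have "M $$ (Suc q, c) * minor M k (f(s := q)) g \<le> M $$ (q, c) * minor M k f g"
      by (rule elimination_minor_ineq[OF tn M c left below fg s]) (use prev in auto)
    then show ?thesis unfolding eq using pos by (simp add: field_simps)
  qed (use tn fg in \<open>auto simp: tn_def\<close>)
qed

section \<open>Factorization of symmetric totally nonnegative matrices\<close>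

lemma upper_factor_carrier [simp]: "upper_factor n i a \<in> carrier_mat n n"
  unfolding upper_factor_def matrix_unit_def by simp

lemma upper_factor_dim [simp]: "dim_row (upper_factor n i a) = n" "dim_col (upper_factor n i a) = n"
  using upper_factor_carrier[of n i a] by (simp_all only: carrier_mat_def mem_Collect_eq)

lemma upper_factor_index:
  "r < n \<Longrightarrow> c < n \<Longrightarrow> upper_factor n i a $$ (r, c) =
    (if r = c then 1 else 0) + (if r + 1 = i \<and> c = i then a else 0)"
  unfolding upper_factor_def matrix_unit_def by simp

lemma upper_factor_mult_index:
  assumes "M \<in> carrier_mat n n" "r < n" "c < n" "i < n"
  shows "(upper_factor n i a * M) $$ (r, c) = M $$ (r, c) + (if r + 1 = i then a * M $$ (i, c) else 0)"
proof -
  have "(upper_factor n i a * M) $$ (r, c) = (\<Sum>j = 0..<n. upper_factor n i a $$ (r, j) * M $$ (j, c))"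
    using assms by (simp add: scalar_prod_def)
  also have "\<dots> = (\<Sum>j = 0..<n. (if j = r then M $$ (j, c) else 0) +
      (if j = i then (if r + 1 = i then a * M $$ (j, c) else 0) else 0))"
    using assms by (intro sum.cong) (auto simp: upper_factor_index)
  also have "\<dots> = M $$ (r, c) + (if r + 1 = i then a * M $$ (i, c) else 0)"
    using assms by (simp add: sum.distrib)
  finally show ?thesis .
qed

lemma lower_factor_mult_index:
  assumes "M \<in> carrier_mat n n" "r < n" "c < n" "1 \<le> i" "i < n"
  shows "(transpose_mat (upper_factor n i a) * M) $$ (r, c) =
    M $$ (r, c) + (if r = i then a * M $$ (i - 1, c) else 0)"
proof -
  have "(transpose_mat (upper_factor n i a) * M) $$ (r, c) =
      (\<Sum>j = 0..<n. upper_factor n i a $$ (j, r) * M $$ (j, c))"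
    using assms by (simp add: scalar_prod_def)
  also have "\<dots> = (\<Sum>j = 0..<n. (if j = r then M $$ (j, c) else 0) +
      (if j = i - 1 then (if r = i then a * M $$ (j, c) else 0) else 0))"
    using assms by (intro sum.cong) (auto simp: upper_factor_index)
  also have "\<dots> = M $$ (r, c) + (if r = i then a * M $$ (i - 1, c) else 0)"
    using assms by (auto simp: sum.distrib)
  finally show ?thesis .
qed

lemma row_added_upper_factor:
  assumes "M \<in> carrier_mat n n" "1 \<le> i" "i < n"
  shows "row_added n (i - 1) i a M (upper_factor n i a * M)"
  unfolding row_added_def using assms by (auto simp: upper_factor_mult_index simp del: index_mult_mat(1))

lemma row_added_lower_factor:
  assumes "M \<in> carrier_mat n n" "1 \<le> i" "i < n"
  shows "row_added n i (i - 1) a M (transpose_mat (upper_factor n i a) * M)"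
  unfolding row_added_def using assms by (auto simp: lower_factor_mult_index simp del: index_mult_mat(1))

lemma upper_factor_mult_upper_factor:
  assumes "1 \<le> i" "i < n"
  shows "upper_factor n i a * upper_factor n i b = upper_factor n i (a + b)"
  by (rule eq_matI)
     (use assms in \<open>auto simp: upper_factor_mult_index upper_factor_index simp del: index_mult_mat(1)\<close>)

lemma upper_factor_zero: "upper_factor n i 0 = 1\<^sub>m n"
  by (rule eq_matI) (auto simp: upper_factor_index)

lemma upper_product_Nil [simp]: "upper_product n [] as = 1\<^sub>m n"
  unfolding upper_product_def by simp

lemma upper_product_Cons [simp]:
  "upper_product n (i # w) (a # as) = upper_factor n i a * upper_product n w as"
  unfolding upper_product_def by simp

lemma upper_product_carrier [simp]:
  "length as = length w \<Longrightarrow> upper_product n w as \<in> carrier_mat n n"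
  by (induction as w rule: list_induct2) auto

lemma upper_product_append:
  assumes "length as = length w" "length bs = length v"
  shows "upper_product n (w @ v) (as @ bs) = upper_product n w as * upper_product n v bs"
  using assms(1)
proof (induction as w rule: list_induct2)
  case Nil
  then show ?case using assms(2) by (simp add: left_mult_one_mat[of _ n n])
next
  case (Cons a as i w)
  then show ?case using assms(2) by (simp add: assoc_mult_mat[of _ n n _ n _ n])
qed

lemma sym_product_carrier:
  "length as = length w \<Longrightarrow> D \<in> carrier_mat n n \<Longrightarrow> sym_product n w as D \<in> carrier_mat n n"
  unfolding sym_product_def
  by (intro mult_carrier_mat[of _ n n _ n] transpose_carrier_mat[THEN iffD2] upper_product_carrier)

text \<open>A letter appended on the right is a congruence of the whole matrix. Hence the first
  elimination step supplies the last letter of the word.\<close>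

lemma sym_product_snoc:
  assumes "length as = length w" "D \<in> carrier_mat n n"
  shows "sym_product n (w @ [i]) (as @ [a]) D =
    transpose_mat (upper_factor n i a) * sym_product n w as D * upper_factor n i a"
proof -
  let ?U = "upper_product n w as" and ?E = "upper_factor n i a"
  have U: "?U \<in> carrier_mat n n" using assms by simp
  have "upper_product n (w @ [i]) (as @ [a]) = ?U * ?E"
    using upper_product_append[OF assms(1), of "[a]" "[i]"] by simp
  then show ?thesis
    unfolding sym_product_def using U assms(2)
    by (simp add: transpose_mult[of _ n n _ n] assoc_mult_mat[of _ n n _ n _ n])
qed

lemma sym_product_transpose:
  assumes "length as = length w" "pos_diagonal n D"
  shows "transpose_mat (sym_product n w as D) = sym_product n w as D"
proof -
  let ?U = "upper_product n w as"
  have U: "?U \<in> carrier_mat n n" using assms by simp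
  have D: "D \<in> carrier_mat n n" using assms(2) by (simp add: pos_diagonal_def)
  have DT: "transpose_mat D = D"
    by (rule eq_matI) (use assms(2) in \<open>auto simp: pos_diagonal_def diagonal_mat_def, metis\<close>)
  show ?thesis
    unfolding sym_product_def using U D
    by (simp add: transpose_mult[of _ n n _ n] assoc_mult_mat[of _ n n _ n _ n] DT)
qed

definition factorizable :: "nat \<Rightarrow> real mat \<Rightarrow> bool" where
  "factorizable n M \<longleftrightarrow> (\<exists>w as D. set w \<subseteq> {1..<n} \<and> pos_params w as \<and> pos_diagonal n D \<and>
     M = sym_product n w as D)"

definition sym_tn :: "nat \<Rightarrow> real mat \<Rightarrow> bool" where
  "sym_tn n M \<longleftrightarrow> M \<in> carrier_mat n n \<and> transpose_mat M = M \<and> tn n M \<and> det M \<noteq> 0"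

lemma factorizable_snoc:
  assumes "factorizable n M" "1 \<le> i" "i < n" "0 < a"
  shows "factorizable n (transpose_mat (upper_factor n i a) * M * upper_factor n i a)"
proof -
  from assms(1) obtain w as D where w: "set w \<subseteq> {1..<n}" "pos_params w as" "pos_diagonal n D"
    and M: "M = sym_product n w as D" unfolding factorizable_def by blast
  have "transpose_mat (upper_factor n i a) * M * upper_factor n i a = sym_product n (w @ [i]) (as @ [a]) D"
    unfolding M by (rule sym_product_snoc[symmetric]) (use w in \<open>auto simp: pos_params_def pos_diagonal_def\<close>)
  moreover have "set (w @ [i]) \<subseteq> {1..<n}" "pos_params (w @ [i]) (as @ [a])"
    using w assms by (auto simp: pos_params_def)
  ultimately show ?thesis unfolding factorizable_def using w(3) by blast
qed

section \<open>Simultaneous elimination of rows and columns\<close>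

lemma det_zero_row:
  assumes "M \<in> carrier_mat n n" "i < n" "\<And>j. j < n \<Longrightarrow> M $$ (i, j) = 0"
  shows "det M = (0 :: real)"
proof -
  have "M = mat n n (\<lambda>(a, b). M $$ (a, b))" using assms(1) by auto
  then have "det M = rowdet n (\<lambda>a b. M $$ (a, b))" unfolding rowdet_def by metis
  then show ?thesis using rowdet_zero_row[of i n "\<lambda>a b. M $$ (a, b)"] assms by simp
qed

text \<open>A vanishing pivot above a positive entry would force, through the minors of order two in
  rows \<open>q\<close> and \<open>Suc q\<close> and columns \<open>c\<close> and \<open>j\<close>,
  the whole row \<open>q\<close> to vanish, against nonsingularity.\<close>

lemma sym_tn_pivot_pos:
  assumes M: "sym_tn n M" and c: "c \<le> q" "Suc q < n"
    and left: "\<And>i j. j < c \<Longrightarrow> j < i \<Longrightarrow> i < n \<Longrightarrow> M $$ (i, j) = 0"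
    and y: "0 < M $$ (Suc q, c)"
  shows "0 < M $$ (q, c)"
proof (rule ccontr)
  have tn: "tn n M" using M by (simp add: sym_tn_def)
  assume "\<not> 0 < M $$ (q, c)"
  then have x: "M $$ (q, c) = 0" using tn_entry[OF tn, of q c] c by simp
  have "M $$ (q, j) = 0" if "j < n" for j
  proof (cases "j > c")
    case False
    then show ?thesis using x left[of j q] c by (cases "j = c") auto
  next
    case True
    let ?f = "\<lambda>a. if a = 0 then q else Suc q" and ?g = "\<lambda>a::nat. if a = 0 then c else j"
    have "increasing n 2 ?f" "increasing n 2 ?g"
      using c True that by (auto simp: increasing_def less_2_cases_iff)
    then have "0 \<le> minor M 2 ?f ?g" using tn by (auto simp: tn_def)
    then have "M $$ (q, j) * M $$ (Suc q, c) \<le> 0" unfolding minor_two using x by simp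
    moreover have "0 \<le> M $$ (q, j)" using tn_entry[OF tn] c that by simp
    ultimately show ?thesis using y by (simp add: mult_le_0_iff)
  qed
  then have "det M = 0" using M c by (intro det_zero_row[of _ n q]) (auto simp: sym_tn_def)
  then show False using M by (simp add: sym_tn_def)
qed

lemma sym_tn_eliminate_entry:
  assumes M: "sym_tn n M" and c: "c \<le> q" "Suc q < n"
    and left: "\<And>i j. j < c \<Longrightarrow> j < i \<Longrightarrow> i < n \<Longrightarrow> M $$ (i, j) = 0"
    and below: "\<And>i. Suc q < i \<Longrightarrow> i < n \<Longrightarrow> M $$ (i, c) = 0"
  obtains M' where "sym_tn n M'" "\<And>i j. j < c \<Longrightarrow> j < i \<Longrightarrow> i < n \<Longrightarrow> M' $$ (i, j) = 0"
    "\<And>i. q < i \<Longrightarrow> i < n \<Longrightarrow> M' $$ (i, c) = 0" "factorizable n M' \<Longrightarrow> factorizable n M"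
proof (cases "M $$ (Suc q, c) = 0")
  case True
  have "M $$ (i, c) = 0" if "q < i" "i < n" for i
    using True below[of i] that by (cases "i = Suc q") auto
  with that[of M] M left show ?thesis by blast
next
  case False
  have Mc: "M \<in> carrier_mat n n" and MT: "transpose_mat M = M" and tn: "tn n M" and det: "det M \<noteq> 0"
    using M by (auto simp: sym_tn_def)
  have y: "0 < M $$ (Suc q, c)" using False tn_entry[OF tn, of "Suc q" c] c by simp
  have x: "0 < M $$ (q, c)" by (rule sym_tn_pivot_pos[OF M c left y])
  define a where "a = M $$ (Suc q, c) / M $$ (q, c)"
  have a: "0 < a" using x y by (simp add: a_def)
  have sym: "M $$ (i, j) = M $$ (j, i)" if "i < n" "j < n" for i j
    using index_transpose_mat(1)[of i M j] MT Mc that by auto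
  define E where "E = upper_factor n (Suc q) (- a)"
  define F where "F = upper_factor n (Suc q) a"
  have E: "E \<in> carrier_mat n n" and F: "F \<in> carrier_mat n n" by (simp_all add: E_def F_def)
  \<comment> \<open>The column operation is carried out as a row operation on the transpose; since
    \<open>M\<close> is symmetric, the result \<open>M'\<close> is the congruent matrix
    \<open>transpose_mat E * M * E\<close>.\<close>
  define N where "N = transpose_mat (transpose_mat E * M)"
  define M' where "M' = transpose_mat E * N"
  have N: "N \<in> carrier_mat n n" unfolding N_def using E Mc by simp
  have M': "M' \<in> carrier_mat n n" unfolding M'_def using E N by simp
  have N_eq: "N = M * E" unfolding N_def using E Mc MT by (simp add: transpose_mult[of _ n n _ n])
  have N_index: "N $$ (r, s) = M $$ (s, r) - (if s = Suc q then a * M $$ (q, r) else 0)"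
    if "r < n" "s < n" for r s
    unfolding N_def E_def using Mc that c by (simp add: lower_factor_mult_index del: index_mult_mat(1))
  have M'_index: "M' $$ (r, s) = N $$ (r, s) - (if r = Suc q then a * N $$ (q, s) else 0)"
    if "r < n" "s < n" for r s
    unfolding M'_def E_def using N that c by (simp add: lower_factor_mult_index del: index_mult_mat(1))
  have tnN: "tn n N"
    unfolding N_def
  proof (rule tn_transpose)
    show "tn n (transpose_mat E * M)"
      by (rule tn_eliminate[OF tn Mc c _ below x])
         (use left row_added_lower_factor[OF Mc, of "Suc q" "- a"] c in \<open>auto simp: E_def a_def\<close>)
  qed (use E Mc in simp)
  have tnM': "tn n M'"
    unfolding M'_def
  proof (rule tn_eliminate[OF tnN N c])
    \<comment> \<open>Compared with the transpose of \<open>M\<close>, only column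
      \<open>Suc q\<close> of \<open>N\<close> has changed. As \<open>c \<le> q\<close>, the second
      elimination has the same coefficient as the first.\<close>
    show "row_added n (Suc q) q (- (N $$ (Suc q, c) / N $$ (q, c))) N (transpose_mat E * N)"
      using row_added_lower_factor[OF N, of "Suc q" "- a"] c
      by (simp add: E_def a_def N_index sym[of c])
    show "N $$ (i, j) = 0" if "j < c" "c \<le> i" "i < n" for i j
      using that c left[of j i] sym[of i j] by (simp add: N_index)
    show "N $$ (i, c) = 0" if "Suc q < i" "i < n" for i
      using that c below[of i] sym[of i c] by (simp add: N_index)
    show "0 < N $$ (q, c)" using x c sym[of q c] by (simp add: N_index)
  qed
  have EF: "E * F = 1\<^sub>m n" "F * E = 1\<^sub>m n"
    unfolding E_def F_def using c by (simp_all add: upper_factor_mult_upper_factor upper_factor_zero)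
  have M'_eq: "M' = transpose_mat E * M * E"
    unfolding M'_def N_eq using E Mc by (simp add: assoc_mult_mat[of _ n n _ n _ n])
  have FE: "transpose_mat F * transpose_mat E = 1\<^sub>m n"
    using transpose_mult[OF E F] EF by simp
  have M_eq: "M = transpose_mat F * M' * F"
  proof -
    have "transpose_mat F * M' * F = (transpose_mat F * transpose_mat E) * M * (E * F)"
      unfolding M'_eq using E F Mc by (simp add: assoc_mult_mat[of _ n n _ n _ n])
    then show ?thesis using EF FE Mc by simp
  qed
  have "det M = det (transpose_mat F) * det M' * det F"
    using M_eq F M' by (metis det_mult mult_carrier_mat transpose_carrier_mat)
  then have "det M' \<noteq> 0" using det by auto
  moreover have "transpose_mat M' = M'"
    unfolding M'_eq using E Mc MT by (simp add: transpose_mult[of _ n n _ n] assoc_mult_mat[of _ n n _ n _ n])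
  ultimately have "sym_tn n M'" using M' tnM' by (simp add: sym_tn_def)
  moreover have "M' $$ (i, j) = 0" if "j < c" "j < i" "i < n" for i j
    using that left[of j i] left[of j q] c sym[of i j] sym[of j q] by (simp add: M'_index N_index)
  moreover have "M' $$ (i, c) = 0" if "q < i" "i < n" for i
    using that below[of i] c sym[of i c] sym[of c q] x
    by (cases "i = Suc q") (auto simp: M'_index N_index a_def)
  moreover have "factorizable n M' \<Longrightarrow> factorizable n M"
    unfolding M_eq F_def using c a by (intro factorizable_snoc) auto
  ultimately show ?thesis by (rule that)
qed

text \<open>Column \<open>c\<close> is cleared from the bottom upwards; \<open>d\<close> bounds how
  far below the diagonal entries may still be present.\<close>

lemma sym_tn_eliminate_column:
  assumes "sym_tn n M" "\<And>i j. j < c \<Longrightarrow> j < i \<Longrightarrow> i < n \<Longrightarrow> M $$ (i, j) = 0"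
    "\<And>i. c + d < i \<Longrightarrow> i < n \<Longrightarrow> M $$ (i, c) = 0"
  shows "\<exists>M'. sym_tn n M' \<and> (\<forall>i j. j < Suc c \<longrightarrow> j < i \<longrightarrow> i < n \<longrightarrow> M' $$ (i, j) = 0) \<and>
    (factorizable n M' \<longrightarrow> factorizable n M)"
  using assms
proof (induction d arbitrary: M)
  case 0
  then show ?case by (metis add_0_right less_antisym)
next
  case (Suc d)
  show ?case
  proof (cases "c + Suc d < n")
    case True
    obtain M' where "sym_tn n M'" "\<And>i j. j < c \<Longrightarrow> j < i \<Longrightarrow> i < n \<Longrightarrow> M' $$ (i, j) = 0"
      "\<And>i. c + d < i \<Longrightarrow> i < n \<Longrightarrow> M' $$ (i, c) = 0" "factorizable n M' \<Longrightarrow> factorizable n M"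
      by (rule sym_tn_eliminate_entry[OF Suc.prems(1), of c "c + d"]) (use Suc.prems True in auto)
    with Suc.IH[of M'] show ?thesis by blast
  next
    case False
    then show ?thesis using Suc.prems by (intro Suc.IH) auto
  qed
qed

text \<open>\<open>e\<close> is the number of columns not yet cleared. By symmetry a matrix without
  entries below the diagonal is diagonal, and nonsingularity makes its diagonal positive.\<close>

lemma sym_tn_factorizable_aux:
  assumes "e \<le> n" "sym_tn n M" "\<And>i j. j < n - e \<Longrightarrow> j < i \<Longrightarrow> i < n \<Longrightarrow> M $$ (i, j) = 0"
  shows "factorizable n M"
  using assms
proof (induction e arbitrary: M)
  case 0
  have M: "M \<in> carrier_mat n n" "transpose_mat M = M" "tn n M" "det M \<noteq> 0"
    using 0 by (auto simp: sym_tn_def)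
  have sym: "M $$ (i, j) = M $$ (j, i)" if "i < n" "j < n" for i j
    using index_transpose_mat(1)[of i M j] M that by auto
  have off: "M $$ (i, j) = 0" if "i < n" "j < n" "i \<noteq> j" for i j
    using that 0(3)[of j i] 0(3)[of i j] sym[of i j] by (cases "j < i") auto
  have "0 < M $$ (i, i)" if "i < n" for i
  proof -
    have "M $$ (i, i) \<noteq> 0"
      using det_zero_row[OF M(1) that] off M(4) that by metis
    then show ?thesis using tn_entry[OF M(3) that that] by simp
  qed
  then have "pos_diagonal n M"
    using M(1) off by (auto simp: pos_diagonal_def diagonal_mat_def)
  moreover have "M = sym_product n [] [] M" unfolding sym_product_def using M(1) by simp
  moreover have "set [] \<subseteq> {1..<n}" "pos_params [] []" by (auto simp: pos_params_def)
  ultimately show ?case unfolding factorizable_def by blast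
next
  case (Suc e)
  have "\<exists>M'. sym_tn n M' \<and> (\<forall>i j. j < Suc (n - Suc e) \<longrightarrow> j < i \<longrightarrow> i < n \<longrightarrow> M' $$ (i, j) = 0) \<and>
      (factorizable n M' \<longrightarrow> factorizable n M)"
    by (rule sym_tn_eliminate_column[of _ _ _ n]) (use Suc.prems in auto)
  then obtain M' where "sym_tn n M'" "\<And>i j. j < Suc (n - Suc e) \<Longrightarrow> j < i \<Longrightarrow> i < n \<Longrightarrow> M' $$ (i, j) = 0"
    "factorizable n M' \<Longrightarrow> factorizable n M" by blast
  moreover have "Suc (n - Suc e) = n - e" using Suc.prems(1) by simp
  ultimately show ?case using Suc.IH[of M'] Suc.prems(1) by simp
qed

lemma sym_tn_factorizable: "sym_tn n M \<Longrightarrow> factorizable n M"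
  by (rule sym_tn_factorizable_aux[of n]) auto

section \<open>Minors as particle systems\<close>

lemma minors_eq:
  assumes "A \<in> carrier_mat n n"
  shows "minors k A = {minor A k f g | f g. increasing n k f \<and> increasing n k g}"
proof (intro equalityI subsetI)
  have sub: "det (submatrix A I J) = minor A k (pick I) (pick J)"
    if "I \<subseteq> {..<n}" "J \<subseteq> {..<n}" "card I = k" "card J = k" for I J
  proof -
    have "{i. i < dim_row A \<and> i \<in> I} = I" "{j. j < dim_col A \<and> j \<in> J} = J"
      using assms that by auto
    then show ?thesis unfolding submatrix_def minor_def rowdet_def using that by simp
  qed
  have pick_inc: "increasing n k (pick I)" if "I \<subseteq> {..<n}" "card I = k" for I
    unfolding increasing_def using that pick_in_set_le[of _ I] pick_mono_le[of _ I] by auto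
  {
    fix x assume "x \<in> minors k A"
    then obtain I J where IJ: "I \<subseteq> {..<n}" "J \<subseteq> {..<n}" "card I = k" "card J = k"
      and x: "x = det (submatrix A I J)"
      unfolding minors_def using assms by auto
    show "x \<in> {minor A k f g | f g. increasing n k f \<and> increasing n k g}"
      unfolding x sub[OF IJ] using pick_inc IJ by blast
  }
  fix x assume "x \<in> {minor A k f g | f g. increasing n k f \<and> increasing n k g}"
  then obtain f g where fg: "increasing n k f" "increasing n k g" and x: "x = minor A k f g" by blast
  have pick_image: "pick (h ` {..<k}) a = h a" if h: "increasing n k h" and a: "a < k" for h a
  proof -
    have "{y \<in> h ` {..<k}. y < h a} = h ` {..<a}"
      using a increasing_less_iff[OF h _ a] by auto
    moreover have "inj_on h {..<a}" using a increasing_inj[OF h] by (auto simp: inj_on_def)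
    ultimately have "card {y \<in> h ` {..<k}. y < h a} = a" by (simp add: card_image)
    then show ?thesis using pick_card_in_set[of "h a" "h ` {..<k}"] a by simp
  qed
  have card: "card (h ` {..<k}) = k" "h ` {..<k} \<subseteq> {..<n}" if "increasing n k h" for h
    using that increasing_inj[OF that] increasing_less[OF that] by (auto intro!: card_image simp: inj_on_def card_image)
  have "x = det (submatrix A (f ` {..<k}) (g ` {..<k}))"
    unfolding x sub[OF card(2)[OF fg(1)] card(2)[OF fg(2)] card(1)[OF fg(1)] card(1)[OF fg(2)]]
    by (rule minor_cong) (use pick_image fg in auto)
  then show "x \<in> minors k A"
    unfolding minors_def using assms card fg by auto blast
qed

lemma totally_nonnegative_iff_tn:
  assumes "A \<in> carrier_mat n n"
  shows "totally_nonnegative A \<longleftrightarrow> tn n A"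
proof -
  have "minor A 0 f g = 1" for f g unfolding minor_def rowdet_def by simp
  then show ?thesis
    unfolding totally_nonnegative_def tn_def minors_eq[OF assms]
    by (auto simp: Suc_le_eq) (metis less_numeral_extra(3) neq0_conv zero_le_one)
qed

lemma minors_pos_iff:
  assumes "A \<in> carrier_mat n n"
  shows "(\<forall>x\<in>minors k A. 0 < x) \<longleftrightarrow>
    (\<forall>f g. increasing n k f \<longrightarrow> increasing n k g \<longrightarrow> 0 < minor A k f g)"
  unfolding minors_eq[OF assms] by auto

text \<open>A configuration \<open>f\<close> places \<open>k\<close> particles on the distinct sites \<open>f 0 < \<dots> < f (k - 1)\<close>; reading the
  letter \<open>i\<close> may move one particle from site \<open>i - 1\<close> to the free site \<open>i\<close>.\<close>
primrec upreach :: "nat \<Rightarrow> nat \<Rightarrow> nat list \<Rightarrow> (nat \<Rightarrow> nat) \<Rightarrow> (nat \<Rightarrow> nat) \<Rightarrow> bool" where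
  "upreach n k [] f h \<longleftrightarrow> f = h"
| "upreach n k (i # w) f h \<longleftrightarrow> upreach n k w f h \<or>
    (\<exists>s<k. Suc (f s) = i \<and> increasing n k (f(s := i)) \<and> upreach n k w (f(s := i)) h)"

lemma upreach_increasing: "increasing n k f \<Longrightarrow> upreach n k w f h \<Longrightarrow> increasing n k h"
  by (induction w arbitrary: f) auto

lemma upreach_append_iff: "upreach n k (v @ w) f h \<longleftrightarrow> (\<exists>g. upreach n k v f g \<and> upreach n k w g h)"
  by (induction v arbitrary: f) auto

lemma upreach_refl: "upreach n k w f f"
  by (induction w) auto

lemma increasing_min:
  assumes "increasing n k f" "increasing n k g"
  shows "increasing n k (\<lambda>s. min (f s) (g s))"
  unfolding increasing_def
proof (intro conjI allI impI)
  fix a b assume "a < b \<and> b < k"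
  then have "f a < f b" "g a < g b" using assms increasing_mono by blast+
  then show "min (f a) (g a) < min (f b) (g b)" by linarith
qed (use increasing_less[OF assms(1)] in \<open>auto simp: min_less_iff_disj\<close>)

text \<open>The trajectory is capped at \<open>g\<close>: a hop onto \<open>i\<close> is kept if
  \<open>i \<le> g s\<close> and becomes a pause otherwise. Sites stay distinct because the
  pointwise minimum of two configurations is a configuration.\<close>

lemma upreach_min:
  assumes "increasing n k g"
  shows "increasing n k f \<Longrightarrow> upreach n k w f h \<Longrightarrow>
    upreach n k w (\<lambda>s. min (g s) (f s)) (\<lambda>s. min (g s) (h s))"
proof (induction w arbitrary: f)
  case (Cons i w)
  from Cons.prems(2) consider "upreach n k w f h"
    | s where "s < k" "Suc (f s) = i" "increasing n k (f(s := i))" "upreach n k w (f(s := i)) h"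
    by auto
  then show ?case
  proof cases
    case 1
    then show ?thesis using Cons by simp
  next
    case 2
    let ?F = "\<lambda>s. min (g s) (f s)"
    have IH: "upreach n k w (\<lambda>t. min (g t) ((f(s := i)) t)) (\<lambda>s. min (g s) (h s))"
      using Cons.IH 2 by blast
    have inc: "increasing n k (\<lambda>t. min (g t) ((f(s := i)) t))"
      by (rule increasing_min) fact+
    show ?thesis
    proof (cases "i \<le> g s")
      case True
      then have "(\<lambda>t. min (g t) ((f(s := i)) t)) = ?F(s := i)" by auto
      then show ?thesis using IH inc 2(1,2) True by (auto intro!: exI[of _ s])
    next
      case False
      then have "(\<lambda>t. min (g t) ((f(s := i)) t)) = ?F" using 2(2) by auto
      then show ?thesis using IH by simp
    qed
  qed
qed simp

section \<open>Minors of products with elementary factors\<close>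

lemma minor_row_added_mono:
  assumes "tn n N" "row_added n i j a N N'" "i = Suc j \<or> j = Suc i" "0 \<le> a"
    "increasing n k f" "increasing n k g"
  shows "minor N k f g \<le> minor N' k f g"
  by (rule row_added_adjacent_cases[OF assms(2,3,5,6)])
     (use assms(1,4,6) in \<open>auto simp: tn_def\<close>)

lemma minor_row_added_pos:
  assumes "tn n N" "row_added n i j a N N'" "0 < a" "increasing n k f" "increasing n k g"
    "s < k" "f s = i" "0 < minor N k (f(s := j)) g"
  shows "0 < minor N' k f g"
  using minor_row_added[OF assms(2,4-7)] assms by (simp add: tn_def add_nonneg_pos)

context
  fixes n :: nat and w :: "nat list" and as :: "real list"
  assumes w: "set w \<subseteq> {1..<n}" and as: "pos_params w as"
begin

lemma length_params: "length as = length w"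
  using as by (simp add: pos_params_def)

text \<open>The leftmost factor acts last on \<open>N\<close>, and peeling it off makes its letter
  the first hop of the row configuration. All contributions are nonnegative, so a single trajectory
  ending in a positive minor suffices.\<close>

lemma tn_upper_product_mult_and_pos:
  fixes N :: "real mat"
  assumes "N \<in> carrier_mat n n" "tn n N"
  shows "tn n (upper_product n w as * N) \<and> (\<forall>k f h g. increasing n k f \<longrightarrow> increasing n k g \<longrightarrow>
    upreach n k w f h \<longrightarrow> 0 < minor N k h g \<longrightarrow> 0 < minor (upper_product n w as * N) k f g)"
  using length_params w as
proof (induction as w rule: list_induct2)
  case Nil
  then show ?case using assms by (simp add: left_mult_one_mat[of _ n n])
next
  case (Cons a as i w)
  let ?U = "upper_product n w as" and ?E = "upper_factor n i a"
  have U: "?U \<in> carrier_mat n n" using Cons by simp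
  have IH: "tn n (?U * N)" "\<And>k f h g. increasing n k f \<Longrightarrow> increasing n k g \<Longrightarrow>
      upreach n k w f h \<Longrightarrow> 0 < minor N k h g \<Longrightarrow> 0 < minor (?U * N) k f g"
    using Cons by (auto simp: pos_params_def)
  have eq: "upper_product n (i # w) (a # as) * N = ?E * (?U * N)"
    using assms U by (simp add: assoc_mult_mat[of _ n n _ n _ n])
  have a: "0 < a" and i: "1 \<le> i" "i < n" using Cons.prems by (auto simp: pos_params_def)
  have op: "row_added n (i - 1) i a (?U * N) (?E * (?U * N))"
    by (rule row_added_upper_factor) (use U assms i in auto)
  have adj: "i - 1 = Suc i \<or> i = Suc (i - 1)" using i by simp
  show ?case
    unfolding eq
  proof (intro conjI allI impI)
    show "tn n (?E * (?U * N))" using tn_row_added[OF IH(1) op adj] a by simp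
  next
    fix k f h g
    assume *: "increasing n k f" "increasing n k g" "upreach n k (i # w) f h" "0 < minor N k h g"
    then consider "upreach n k w f h"
      | s where "s < k" "Suc (f s) = i" "increasing n k (f(s := i))" "upreach n k w (f(s := i)) h"
      by auto
    then show "0 < minor (?E * (?U * N)) k f g"
    proof cases
      case 1
      then show ?thesis
        using IH(2)[OF *(1,2) _ *(4)] minor_row_added_mono[OF IH(1) op adj _ *(1,2)] a by force
    next
      case 2
      show ?thesis
        by (rule minor_row_added_pos[OF IH(1) op a *(1,2) 2(1) _ IH(2)[OF 2(3) *(2) 2(4) *(4)]])
           (use 2 in auto)
    qed
  qed
qed

text \<open>A nonzero sum has a nonzero summand, so at each letter one of the two choices, pause or
  hop, can be followed.\<close>

lemma minor_upper_product_nonzero: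
  fixes N :: "real mat"
  assumes "N \<in> carrier_mat n n" "increasing n k f" "increasing n k g"
    "minor (upper_product n w as * N) k f g \<noteq> 0"
  shows "\<exists>h. upreach n k w f h \<and> minor N k h g \<noteq> 0"
  using length_params w as assms(2-)
proof (induction as w arbitrary: f rule: list_induct2)
  case Nil
  then show ?case using assms by (simp add: left_mult_one_mat[of _ n n])
next
  case (Cons a as i w)
  let ?U = "upper_product n w as" and ?E = "upper_factor n i a"
  have U: "?U \<in> carrier_mat n n" using Cons by simp
  have eq: "upper_product n (i # w) (a # as) * N = ?E * (?U * N)"
    using assms U by (simp add: assoc_mult_mat[of _ n n _ n _ n])
  have i: "1 \<le> i" "i < n" using Cons.prems by auto
  have op: "row_added n (i - 1) i a (?U * N) (?E * (?U * N))"
    by (rule row_added_upper_factor) (use U assms i in auto)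
  have adj: "i - 1 = Suc i \<or> i = Suc (i - 1)" using i by simp
  have IH: "\<exists>h. upreach n k w f h \<and> minor N k h g \<noteq> 0"
    if "increasing n k f" "minor (?U * N) k f g \<noteq> 0" for f
    using that Cons by (auto simp: pos_params_def)
  show ?case
  proof (rule row_added_adjacent_cases[OF op adj Cons.prems(3,4)])
    assume "minor (?E * (?U * N)) k f g = minor (?U * N) k f g"
    then show ?thesis using IH[of f] Cons.prems eq by auto
  next
    fix s assume s: "s < k" "f s = i - 1" "increasing n k (f(s := i))"
      "minor (?E * (?U * N)) k f g = minor (?U * N) k f g + a * minor (?U * N) k (f(s := i)) g"
    then consider "minor (?U * N) k f g \<noteq> 0" | "minor (?U * N) k (f(s := i)) g \<noteq> 0"
      using Cons.prems(5) eq by fastforce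
    then show ?thesis
    proof cases
      case 1
      then show ?thesis using IH[of f] Cons.prems by auto
    next
      case 2
      then obtain h where "upreach n k w (f(s := i)) h" "minor N k h g \<noteq> 0" using IH[OF s(3)] by blast
      moreover have "Suc (f s) = i" using s(2) i by simp
      ultimately show ?thesis using s(1,3) by (auto simp del: fun_upd_apply)
    qed
  qed
qed

text \<open>Transposition reverses the product: now the first letter acts first on \<open>N\<close>.
  Hence the induction varies \<open>N\<close>, and the trajectory is traversed from its end
  \<open>f\<close> back to its start \<open>h\<close>.\<close>

lemma tn_lower_product_mult_and_pos:
  fixes N :: "real mat"
  assumes "N \<in> carrier_mat n n" "tn n N"
  shows "tn n (transpose_mat (upper_product n w as) * N) \<and>
    (\<forall>k f h g. increasing n k f \<longrightarrow> increasing n k h \<longrightarrow> increasing n k g \<longrightarrow>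
    upreach n k w h f \<longrightarrow> 0 < minor N k h g \<longrightarrow> 0 < minor (transpose_mat (upper_product n w as) * N) k f g)"
  using length_params w as assms
proof (induction as w arbitrary: N rule: list_induct2)
  case Nil
  then show ?case by (simp add: left_mult_one_mat[of _ n n])
next
  case (Cons a as i w)
  let ?U = "upper_product n w as" and ?E = "upper_factor n i a"
  let ?N = "transpose_mat ?E * N"
  have U: "?U \<in> carrier_mat n n" using Cons by simp
  have eq: "transpose_mat (upper_product n (i # w) (a # as)) * N = transpose_mat ?U * ?N"
    using Cons.prems U by (simp add: transpose_mult[of _ n n _ n] assoc_mult_mat[of _ n n _ n _ n])
  have a: "0 < a" and i: "1 \<le> i" "i < n" using Cons.prems by (auto simp: pos_params_def)
  have op: "row_added n i (i - 1) a N ?N"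
    by (rule row_added_lower_factor) (use Cons.prems i in auto)
  have adj: "i = Suc (i - 1) \<or> i - 1 = Suc i" using i by simp
  have tnN: "tn n ?N" using tn_row_added[OF Cons.prems(4) op adj] a by simp
  have "?N \<in> carrier_mat n n"
    by (intro mult_carrier_mat[of _ n n] transpose_carrier_mat[THEN iffD2] upper_factor_carrier Cons.prems)
  note IH = Cons.IH[OF _ _ this tnN]
  have IH1: "tn n (transpose_mat ?U * ?N)" and IH2: "\<And>k f h g. increasing n k f \<Longrightarrow> increasing n k h \<Longrightarrow> increasing n k g \<Longrightarrow>
      upreach n k w h f \<Longrightarrow> 0 < minor ?N k h g \<Longrightarrow> 0 < minor (transpose_mat ?U * ?N) k f g"
    using IH Cons.prems by (auto simp: pos_params_def)
  show ?case
    unfolding eq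
  proof (intro conjI allI impI)
    fix k f h g
    assume *: "increasing n k f" "increasing n k h" "increasing n k g" "upreach n k (i # w) h f" "0 < minor N k h g"
    then consider "upreach n k w h f"
      | s where "s < k" "Suc (h s) = i" "increasing n k (h(s := i))" "upreach n k w (h(s := i)) f"
      by auto
    then show "0 < minor (transpose_mat ?U * ?N) k f g"
    proof cases
      case 1
      have "0 < minor ?N k h g"
        using *(5) minor_row_added_mono[OF Cons.prems(4) op adj _ *(2,3)] a by force
      then show ?thesis using IH2[OF *(1-3) 1] by simp
    next
      case 2
      have "(h(s := i))(s := i - 1) = h" using 2 by auto
      then have "0 < minor ?N k (h(s := i)) g"
        by (intro minor_row_added_pos[OF Cons.prems(4) op a 2(3) *(3) 2(1)]) (use * in \<open>auto simp del: fun_upd_upd\<close>)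
      then show ?thesis using IH2[OF *(1) 2(3) *(3) 2(4)] by simp
    qed
  qed (rule IH1)
qed

text \<open>Of the descending half of a round only the fact that no particle rises is retained; this
  is what the lower bounds on exponents use.\<close>

lemma minor_lower_product_nonzero:
  fixes N :: "real mat"
  assumes "N \<in> carrier_mat n n" "increasing n k f" "increasing n k g"
    "minor (transpose_mat (upper_product n w as) * N) k f g \<noteq> 0"
  shows "\<exists>h. increasing n k h \<and> (\<forall>s. h s \<le> f s) \<and> minor N k h g \<noteq> 0"
  using length_params w as assms
proof (induction as w arbitrary: N rule: list_induct2)
  case Nil
  then show ?case by (auto simp: left_mult_one_mat[of _ n n])
next
  case (Cons a as i w)
  let ?U = "upper_product n w as" and ?E = "upper_factor n i a"
  let ?N = "transpose_mat ?E * N"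
  have U: "?U \<in> carrier_mat n n" using Cons by simp
  have eq: "transpose_mat (upper_product n (i # w) (a # as)) * N = transpose_mat ?U * ?N"
    using Cons.prems U by (simp add: transpose_mult[of _ n n _ n] assoc_mult_mat[of _ n n _ n _ n])
  have i: "1 \<le> i" "i < n" using Cons.prems by (auto simp: pos_params_def)
  have op: "row_added n i (i - 1) a N ?N"
    by (rule row_added_lower_factor) (use Cons.prems i in auto)
  have adj: "i = Suc (i - 1) \<or> i - 1 = Suc i" using i by simp
  have "?N \<in> carrier_mat n n"
    by (intro mult_carrier_mat[of _ n n] transpose_carrier_mat[THEN iffD2] upper_factor_carrier Cons.prems)
  then obtain h where h: "increasing n k h" "\<forall>s. h s \<le> f s" "minor ?N k h g \<noteq> 0"
    using Cons.IH[of ?N] Cons.prems eq by (auto simp: pos_params_def)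
  show ?case
  proof (rule row_added_adjacent_cases[OF op adj h(1) Cons.prems(5)])
    assume "minor ?N k h g = minor N k h g"
    then show ?thesis using h by auto
  next
    fix s assume s: "s < k" "h s = i" "increasing n k (h(s := i - 1))"
      "minor ?N k h g = minor N k h g + a * minor N k (h(s := i - 1)) g"
    then consider "minor N k h g \<noteq> 0" | "minor N k (h(s := i - 1)) g \<noteq> 0" using h(3) by fastforce
    then show ?thesis
    proof cases
      case 1
      then show ?thesis using h by auto
    next
      case 2
      have "\<forall>t. (h(s := i - 1)) t \<le> f t" using h(2) s(2) by (auto intro: order_trans[of _ i] simp: le_diff_conv) (metis le_SucI)
      then show ?thesis using 2 s(3) by blast
    qed
  qed
qed

end

section \<open>Diagonal factors and powers\<close>

lemma rowdet_scale_rows: "rowdet k (\<lambda>a b. d a * R a b) = (\<Prod>a<k. d a) * rowdet k R"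
proof -
  have "rowdet k (\<lambda>a b. (if a < t then d a else 1) * R a b) = (\<Prod>a<t. d a) * rowdet k R" if "t \<le> k" for t
    using that
  proof (induction t)
    case (Suc t)
    let ?S = "\<lambda>t a b. (if a < t then d a else 1) * R a b"
    have "rowdet k (?S (Suc t)) = rowdet k ((?S t)(t := (\<lambda>b. 0 + d t * R t b)))"
      by (rule rowdet_cong) auto
    also have "\<dots> = rowdet k ((?S t)(t := (\<lambda>b. 0))) + d t * rowdet k ((?S t)(t := R t))"
      by (rule rowdet_add_row) (use Suc in simp)
    also have "rowdet k ((?S t)(t := (\<lambda>b. 0))) = 0"
      by (rule rowdet_zero_row[of t]) (use Suc in auto)
    also have "(?S t)(t := R t) = ?S t" by auto
    finally show ?case using Suc by (simp add: algebra_simps)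
  qed simp
  from this[of k] show ?thesis by (simp cong: rowdet_cong)
qed

lemma diagonal_mult_index:
  assumes "pos_diagonal n D" "N \<in> carrier_mat n n" "r < n" "c < n"
  shows "(D * N) $$ (r, c) = D $$ (r, r) * N $$ (r, c)"
proof -
  have "(D * N) $$ (r, c) = (\<Sum>j = 0..<n. D $$ (r, j) * N $$ (j, c))"
    using assms by (auto simp: scalar_prod_def pos_diagonal_def)
  also have "\<dots> = (\<Sum>j = 0..<n. if j = r then D $$ (r, r) * N $$ (r, c) else 0)"
    using assms by (intro sum.cong) (auto simp: pos_diagonal_def diagonal_mat_def)
  finally show ?thesis using assms by simp
qed

lemma minor_diagonal_mult:
  assumes "pos_diagonal n D" "N \<in> carrier_mat n n" "increasing n k f" "increasing n k g"
  shows "minor (D * N) k f g = (\<Prod>a<k. D $$ (f a, f a)) * minor N k f g"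
    and "0 < (\<Prod>a<k. D $$ (f a, f a))"
proof -
  show "minor (D * N) k f g = (\<Prod>a<k. D $$ (f a, f a)) * minor N k f g"
    unfolding minor_def rowdet_scale_rows[symmetric]
    by (rule rowdet_cong)
       (use assms increasing_less in \<open>auto simp: diagonal_mult_index simp del: index_mult_mat(1)\<close>)
  show "0 < (\<Prod>a<k. D $$ (f a, f a))"
    by (rule prod_pos) (use assms increasing_less in \<open>auto simp: pos_diagonal_def\<close>)
qed

lemma minor_full: "M \<in> carrier_mat n n \<Longrightarrow> minor M n (\<lambda>s. s) (\<lambda>s. s) = det M"
  unfolding minor_def rowdet_def by (intro arg_cong[where f = det] eq_matI) auto

lemma pow_mat_Suc_left:
  assumes "A \<in> carrier_mat n n"
  shows "A ^\<^sub>m Suc m = A * A ^\<^sub>m m"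
proof (induction m)
  case (Suc m)
  have "A ^\<^sub>m Suc (Suc m) = A * A ^\<^sub>m m * A" using Suc by simp
  also have "\<dots> = A * (A ^\<^sub>m m * A)" using assms pow_carrier_mat by (intro assoc_mult_mat[of _ n n _ n _ n]) auto
  finally show ?case by simp
qed (use assms in \<open>auto simp: left_mult_one_mat[of _ n n] right_mult_one_mat[of _ n n]\<close>)

text \<open>\<open>upreach\<close> compares configurations as functions on all natural numbers.
  Overwriting the values from \<open>k\<close> on makes configurations that agree below
  \<open>k\<close> interchangeable.\<close>

lemma upreach_override:
  "upreach n k w f h \<Longrightarrow> upreach n k w (\<lambda>s. if s < k then f s else c s) (\<lambda>s. if s < k then h s else c s)"
proof (induction w arbitrary: f)
  case (Cons i w)
  let ?o = "\<lambda>f s. if s < k then f s else c s"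
  from Cons.prems consider "upreach n k w f h"
    | s where "s < k" "Suc (f s) = i" "increasing n k (f(s := i))" "upreach n k w (f(s := i)) h"
    by auto
  then show ?case
  proof cases
    case 2
    have "?o (f(s := i)) = (?o f)(s := i)" using 2 by auto
    moreover have "increasing n k (?o (f(s := i)))"
      using 2(3) by (subst increasing_cong[of _ _ "f(s := i)"]) auto
    ultimately show ?thesis using Cons.IH[OF 2(4)] 2 by (auto intro!: exI[of _ s])
  qed (use Cons.IH in simp)
qed simp

locale sym_factorization =
  fixes n :: nat and w :: "nat list" and as :: "real list" and D :: "real mat"
  assumes w: "set w \<subseteq> {1..<n}" and as: "pos_params w as" and D: "pos_diagonal n D"
begin

abbreviation "U \<equiv> upper_product n w as"
abbreviation "A \<equiv> sym_product n w as D"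

lemma D_carrier: "D \<in> carrier_mat n n"
  using D by (simp add: pos_diagonal_def)

lemma U_carrier: "U \<in> carrier_mat n n"
  using as by (simp add: pos_params_def)

lemma A_carrier: "A \<in> carrier_mat n n"
  using as D_carrier by (simp add: pos_params_def sym_product_carrier)

lemma A_mult: "N \<in> carrier_mat n n \<Longrightarrow> A * N = transpose_mat U * (D * (U * N))"
  unfolding sym_product_def using U_carrier D_carrier by (simp add: assoc_mult_mat[of _ n n _ n _ n])

lemma tn_diagonal_mult:
  assumes "N \<in> carrier_mat n n" "tn n N"
  shows "tn n (D * N)"
  using assms minor_diagonal_mult[OF D assms(1)] unfolding tn_def by (simp add: less_imp_le)

lemma A_mult_tn:
  assumes "N \<in> carrier_mat n n" "tn n N"
  shows "tn n (A * N)"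
  unfolding A_mult[OF assms(1)]
  using tn_lower_product_mult_and_pos[OF w as, of "D * (U * N)"] tn_diagonal_mult[of "U * N"]
    tn_upper_product_mult_and_pos[OF w as assms] U_carrier D_carrier assms by (meson mult_carrier_mat)

text \<open>One round seen from the row configuration \<open>f\<close>: the transposed factor goes
  down to \<open>e\<close>, the diagonal multiplies by a positive number, and the upper factor goes
  up to \<open>h\<close>.\<close>

lemma A_mult_pos:
  assumes "N \<in> carrier_mat n n" "tn n N" "increasing n k e" "increasing n k f" "increasing n k g"
    "upreach n k w e f" "upreach n k w e h" "0 < minor N k h g"
  shows "0 < minor (A * N) k f g"
proof -
  have UN: "U * N \<in> carrier_mat n n" and DUN: "D * (U * N) \<in> carrier_mat n n"
    using U_carrier D_carrier assms(1) by (meson mult_carrier_mat)+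
  note U = tn_upper_product_mult_and_pos[OF w as assms(1,2)]
  have "0 < minor (U * N) k e g" using U assms by blast
  then have "0 < minor (D * (U * N)) k e g"
    using minor_diagonal_mult[OF D UN assms(3,5)] by simp
  then show ?thesis
    unfolding A_mult[OF assms(1)]
    using tn_lower_product_mult_and_pos[OF w as DUN] tn_diagonal_mult[OF UN] U assms by blast
qed

lemma A_mult_nonzero:
  assumes "N \<in> carrier_mat n n" "increasing n k f" "increasing n k g" "minor (A * N) k f g \<noteq> 0"
  obtains e h where "increasing n k e" "\<And>s. e s \<le> f s" "upreach n k w e h" "minor N k h g \<noteq> 0"
proof -
  have UN: "U * N \<in> carrier_mat n n" and DUN: "D * (U * N) \<in> carrier_mat n n"
    using U_carrier D_carrier assms(1) by (meson mult_carrier_mat)+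
  obtain e where e: "increasing n k e" "\<forall>s. e s \<le> f s" "minor (D * (U * N)) k e g \<noteq> 0"
    using minor_lower_product_nonzero[OF w as DUN assms(2,3)] assms(4) A_mult[OF assms(1)] by auto
  then have "minor (U * N) k e g \<noteq> 0" using minor_diagonal_mult[OF D UN e(1) assms(3)] by simp
  then obtain h where "upreach n k w e h" "minor N k h g \<noteq> 0"
    using minor_upper_product_nonzero[OF w as assms(1) e(1) assms(3)] by blast
  then show ?thesis using that e by blast
qed

lemma A_pow_carrier: "A ^\<^sub>m m \<in> carrier_mat n n"
  using A_carrier by simp

lemma A_pow_Suc: "A ^\<^sub>m Suc m = A * A ^\<^sub>m m"
  by (rule pow_mat_Suc_left[OF A_carrier])

lemma A_pow_0: "A ^\<^sub>m 0 = 1\<^sub>m n"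
  using A_carrier by simp

lemma A_pow_tn: "tn n (A ^\<^sub>m m)"
  by (induction m) (simp_all add: A_pow_0 A_pow_Suc tn_one A_mult_tn A_pow_carrier del: pow_mat.simps)

text \<open>The descending half of each round stays idle (\<open>e = f\<close>), so \<open>m\<close>
  rounds amount to reading \<open>w\<close> exactly \<open>m\<close> times.\<close>

lemma A_pow_pos:
  "increasing n k f \<Longrightarrow> upreach n k (concat (replicate m w)) f h \<Longrightarrow> 0 < minor (A ^\<^sub>m m) k f h"
proof (induction m arbitrary: f)
  case 0
  then show ?case using minor_one[of n k f f] by (simp add: A_pow_0 del: pow_mat.simps)
next
  case (Suc m)
  then obtain g where g: "upreach n k w f g" "upreach n k (concat (replicate m w)) g h"
    by (auto simp: upreach_append_iff)
  have inc: "increasing n k g" "increasing n k h" using Suc.prems g upreach_increasing by blast+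
  show ?case
    unfolding A_pow_Suc
    by (rule A_mult_pos[OF A_pow_carrier A_pow_tn Suc.prems(1) Suc.prems(1) inc(2) upreach_refl g(1) Suc.IH[OF inc(1) g(2)]])
qed

lemma A_pow_transpose: "transpose_mat (A ^\<^sub>m m) = A ^\<^sub>m m"
proof (induction m)
  case (Suc m)
  have "transpose_mat (A ^\<^sub>m Suc m) = transpose_mat A * transpose_mat (A ^\<^sub>m m)"
    using A_pow_carrier A_carrier by (simp add: transpose_mult[of _ n n _ n])
  also have "\<dots> = A ^\<^sub>m Suc m"
    unfolding Suc A_pow_Suc using as D by (simp add: sym_product_transpose pos_params_def)
  finally show ?case .
qed (simp add: A_pow_0 del: pow_mat.simps)

lemma A_pow_det_pos: "0 < det (A ^\<^sub>m m)"
  using A_pow_pos[of n "\<lambda>s. s" m "\<lambda>s. s"] minor_full[OF A_pow_carrier, of m] upreach_refl increasing_id[of n n]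
  by simp

lemma A_pow_sym_tn: "sym_tn n (A ^\<^sub>m m)"
  unfolding sym_tn_def using A_pow_carrier A_pow_transpose A_pow_tn A_pow_det_pos by (metis less_irrefl)

lemma A_pow_1: "A ^\<^sub>m 1 = A"
  using A_carrier by (simp add: left_mult_one_mat[of _ n n])

end

text \<open>Truncating the trajectories from the lowest to the highest configuration at \<open>f\<close> and at \<open>g\<close> gives
  trajectories from the lowest configuration to \<open>f\<close> and to \<open>g\<close>.\<close>
lemma sym_tn_corner_imp_pos:
  assumes "sym_tn n M" "minor M k (\<lambda>s. s) (\<lambda>s. n - k + s) \<noteq> 0"
    "increasing n k f" "increasing n k g"
  shows "0 < minor M k f g"
proof -
  from sym_tn_factorizable[OF assms(1)] obtain w as D
    where wD: "set w \<subseteq> {1..<n}" "pos_params w as" "pos_diagonal n D" and M: "M = sym_product n w as D"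
    unfolding factorizable_def by blast
  interpret sym_factorization n w as D by standard fact+
  have k: "k \<le> n" using increasing_card assms(3) .
  have M1: "M = A * 1\<^sub>m n" using M A_carrier by simp
  \<comment> \<open>The word belongs to \<open>M\<close> itself, which may be a power of another
    matrix, so a single round is analysed. No configuration lies below the lowest one, which
    determines \<open>e\<close>; a nonzero minor of the identity matrix determines
    \<open>h\<close>.\<close>
  obtain e h where e: "increasing n k e" "\<And>s. e s \<le> s" and up: "upreach n k w e h"
    and h0: "minor (1\<^sub>m n) k h (\<lambda>s. n - k + s) \<noteq> 0"
    using A_mult_nonzero[OF one_carrier_mat increasing_id[OF k] increasing_top[OF k]] assms(2) M1 by metis
  have e_id: "e s = s" if "s < k" for s using increasing_ge[OF e(1) that] e(2)[of s] by simp
  have h_top: "h s = n - k + s" if "s < k" for s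
    using h0 minor_one[OF upreach_increasing[OF e(1) up] increasing_top[OF k]] that by (auto split: if_splits)
  have reach: "upreach n k w (\<lambda>s. if s < k then s else 0) (\<lambda>s. if s < k then f s else 0)"
    if "increasing n k f" for f
  proof -
    have "(\<lambda>s. if s < k then min (f s) (e s) else 0) = (\<lambda>s. if s < k then s else 0)"
      using e_id increasing_ge[OF that] by (intro ext) (simp add: min.absorb2)
    moreover have "(\<lambda>s. if s < k then min (f s) (h s) else 0) = (\<lambda>s. if s < k then f s else 0)"
      using h_top increasing_le_top[OF that] by (intro ext) (simp add: min.absorb1)
    ultimately show ?thesis
      using upreach_override[OF upreach_min[OF that e(1) up], of "\<lambda>_. 0"] by simp
  qed
  have inc: "increasing n k (\<lambda>s. if s < k then f s else 0)" if "increasing n k f" for f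
    using that by (subst increasing_cong[of _ _ f]) auto
  have "0 < minor (A * 1\<^sub>m n) k (\<lambda>s. if s < k then f s else 0) (\<lambda>s. if s < k then g s else 0)"
    by (rule A_mult_pos[OF one_carrier_mat tn_one inc[OF increasing_id[OF k]] inc[OF assms(3)] inc[OF assms(4)]
          reach[OF assms(3)] reach[OF assms(4)]])
       (simp add: minor_one inc assms)
  also have "minor (A * 1\<^sub>m n) k (\<lambda>s. if s < k then f s else 0) (\<lambda>s. if s < k then g s else 0) = minor M k f g"
    unfolding M1[symmetric] by (rule minor_cong) auto
  finally show ?thesis .
qed

section \<open>Periodic schedules for a transport\<close>

lemma upreach_trajectory:
  assumes "\<And>t. t \<le> length W \<Longrightarrow> increasing n k (X t)"
    "\<And>t. t < length W \<Longrightarrow> X (Suc t) = X t \<or> (\<exists>s<k. Suc (X t s) = W ! t \<and> X (Suc t) = (X t)(s := W ! t))"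
  shows "upreach n k W (X 0) (X (length W))"
  using assms
proof (induction W arbitrary: X)
  case (Cons i W)
  have "upreach n k W (X (Suc 0)) (X (Suc (length W)))"
    by (rule Cons.IH[of "\<lambda>t. X (Suc t)"]) (use Cons.prems(1)[of "Suc _"] Cons.prems(2)[of "Suc _"] in auto)
  moreover have "increasing n k (X (Suc 0))" using Cons.prems(1)[of "Suc 0"] by simp
  ultimately show ?case using Cons.prems(2)[of 0] by (auto simp del: fun_upd_apply)
qed simp

lemma nth_concat_replicate:
  "t < m * length w \<Longrightarrow> concat (replicate m w) ! t = w ! (t mod length w)"
proof (induction m arbitrary: t)
  case (Suc m)
  then show ?case
    by (cases "t < length w") (auto simp: nth_append le_mod_geq)
qed simp

lemma increasing_SucI:
  assumes "\<And>a. a < k \<Longrightarrow> f a < n" "\<And>a. Suc a < k \<Longrightarrow> f a < f (Suc a)"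
  shows "increasing n k f"
proof -
  have "f a < f (Suc (a + d))" if "Suc (a + d) < k" for a d
    using that
  proof (induction d)
    case (Suc d)
    then show ?case using assms(2)[of "Suc (a + d)"] by simp
  qed (use assms(2) in simp)
  then show ?thesis unfolding increasing_def using assms(1) by (metis less_iff_Suc_add)
qed

text \<open>\<open>\<theta> j\<close> is the time at which the top particle, started early enough, reads the letter \<open>j\<close> in the
  periodic word \<open>w w w \<dots>\<close>; every further particle follows exactly one period later.\<close>
lemma upreach_periodic:
  fixes \<theta> :: "nat \<Rightarrow> int" and w :: "nat list"
  defines "L \<equiv> int (length w)"
  assumes k: "1 \<le> k" "k < n"
    and step: "\<And>j. 1 \<le> j \<Longrightarrow> Suc j < n \<Longrightarrow> \<theta> j < \<theta> (Suc j) \<and> \<theta> (Suc j) < \<theta> j + L"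
    and letter: "\<And>j. 1 \<le> j \<Longrightarrow> j < n \<Longrightarrow> w ! nat (\<theta> j mod L) = j"
    and start: "\<And>s. s < k \<Longrightarrow> 0 \<le> \<theta> (Suc s) + int (k - 1 - s) * L"
    and finish: "\<And>s. s < k \<Longrightarrow> \<theta> (n - k + s) + int (k - 1 - s) * L < int m * L"
    and L: "0 < L"
  obtains f h where "upreach n k (concat (replicate m w)) f h"
    "\<And>s. s < k \<Longrightarrow> f s = s" "\<And>s. s < k \<Longrightarrow> h s = n - k + s"
proof -
  \<comment> \<open>The site, at local time \<sigma>, of an unhindered particle that starts at site
    0 and reads the letter \<open>j\<close> at time \<open>\<theta> j\<close>.\<close>
  define F where "F = (\<lambda>\<sigma>. card {j \<in> {1..<n}. \<theta> j < \<sigma>})"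
  have F_le: "F \<sigma> \<le> n - 1" for \<sigma>
    unfolding F_def by (rule order_trans[OF card_mono[of "{1..<n}"]]) auto
  have mono: "\<theta> i \<le> \<theta> j" if "1 \<le> i" "i \<le> j" "j < n" for i j
    using that(2,3)
  proof (induction j rule: dec_induct)
    case (step m)
    then show ?case using \<open>1 \<le> i\<close> assms(4)[of m] by simp
  qed simp
  have F_iff: "j \<le> F \<sigma> \<longleftrightarrow> \<theta> j < \<sigma>" if "1 \<le> j" "j < n" for j \<sigma>
  proof
    assume "\<theta> j < \<sigma>"
    then have "{1..j} \<subseteq> {j \<in> {1..<n}. \<theta> j < \<sigma>}" using mono[of _ j] that by force
    then show "j \<le> F \<sigma>" unfolding F_def using card_mono[of "{j \<in> {1..<n}. \<theta> j < \<sigma>}" "{1..j}"] by simp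
  next
    assume le: "j \<le> F \<sigma>"
    show "\<theta> j < \<sigma>"
    proof (rule ccontr)
      assume "\<not> \<theta> j < \<sigma>"
      then have "i < j" if "i < n" "\<theta> i < \<sigma>" for i
        using mono[of j i] \<open>1 \<le> j\<close> that by (cases "i < j") auto
      then have "{i \<in> {1..<n}. \<theta> i < \<sigma>} \<subseteq> {1..<j}" by auto
      then have "F \<sigma> \<le> j - 1" unfolding F_def using card_mono[of "{1..<j}"] by fastforce
      then show False using le that by simp
    qed
  qed
  \<comment> \<open>Particle \<open>s\<close> lags \<open>k - 1 - s\<close> periods behind the top
    one. In \<open>X\<close> its site is clamped between the start \<open>s\<close> and the target
    \<open>n - k + s\<close>, so that it waits at both ends; the value 0 from \<open>k\<close> on
    makes the configurations comparable as functions.\<close>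
  define \<sigma> where "\<sigma> = (\<lambda>t s. int t - int (k - 1 - s) * L)"
  define X where "X = (\<lambda>t s. if s < k then max s (min (F (\<sigma> t s)) (n - k + s)) else 0)"
  have inc: "increasing n k (X t)" for t
  proof (rule increasing_SucI)
    fix s assume "s < k"
    then show "X t s < n" using k by (auto simp: X_def)
  next
    fix s assume s: "Suc s < k"
    have shift: "\<sigma> t (Suc s) = \<sigma> t s + L"
    proof -
      have "int (k - 1 - s) = int (k - 1 - Suc s) + 1" using s by simp
      then show ?thesis unfolding \<sigma>_def by (simp only: algebra_simps)
    qed
    let ?a = "F (\<sigma> t s)" and ?b = "F (\<sigma> t (Suc s))"
    \<comment> \<open>Consecutive letters are less than one period apart, so the particle in front,
      being one period ahead, is at least one site further. Before the first and after the last
      letter the clamps separate the two particles.\<close>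
    have "?a = 0 \<or> Suc ?a \<le> ?b \<or> (?a = n - 1 \<and> ?b = n - 1)"
    proof -
      consider "?a = 0" | "1 \<le> ?a" "Suc ?a < n" | "1 \<le> ?a" "?a = n - 1" using F_le[of "\<sigma> t s"] by linarith
      then show ?thesis
      proof cases
        case 2
        then have "\<theta> ?a < \<sigma> t s" using F_iff[of ?a "\<sigma> t s"] by simp
        then have "\<theta> (Suc ?a) < \<sigma> t (Suc s)" using step[of ?a] 2 shift by simp
        then show ?thesis using F_iff[of "Suc ?a" "\<sigma> t (Suc s)"] 2 by simp
      next
        case 3
        then have "\<theta> (n - 1) < \<sigma> t s" using F_iff[of ?a "\<sigma> t s"] k by simp
        then have "n - 1 \<le> ?b" using F_iff[of "n - 1" "\<sigma> t (Suc s)"] shift L k 3 by simp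
        then show ?thesis using F_le[of "\<sigma> t (Suc s)"] 3 by simp
      qed simp
    qed
    then show "X t s < X t (Suc s)" using s k unfolding X_def by auto
  qed
  have change: "1 \<le> i \<and> i < n \<and> F (x + 1) = i \<and> Suc (F x) = i \<and> \<theta> i = x"
    if "F (x + 1) \<noteq> F x" and i: "i = F (x + 1)" for x i
  proof -
    have le: "F x \<le> F (x + 1)" unfolding F_def by (rule card_mono) auto
    then have 1: "1 \<le> i" "i < n" using that F_le[of "x + 1"] k by auto
    then have "\<theta> i < x + 1" using F_iff[of i "x + 1"] i by simp
    moreover have "\<not> \<theta> i < x" using F_iff[of i x] 1 le that by simp
    ultimately have x: "\<theta> i = x" by simp
    have "i - 1 \<le> F x"
    proof (cases "i = 1")
      case False
      then have "\<theta> (i - 1) < \<theta> i" using step[of "i - 1"] 1 by simp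
      then show ?thesis using F_iff[of "i - 1" x] 1 x False by simp
    qed simp
    then show ?thesis using 1 x le that by simp
  qed
  have lenW: "length (concat (replicate m w)) = m * length w" by (induction m) auto
  have traj: "upreach n k (concat (replicate m w)) (X 0) (X (m * length w))"
    unfolding lenW[symmetric]
  proof (rule upreach_trajectory)
    fix t assume "t < length (concat (replicate m w))"
    then have W: "concat (replicate m w) ! t = w ! (t mod length w)" (is "?W = _")
      using nth_concat_replicate lenW by simp
    \<comment> \<open>A site can change only when the letter of the new site is read. That letter
      fixes the local time of the moving particle, so no two particles move at once.\<close>
    have moved: "Suc (X t s) = ?W \<and> X (Suc t) s = ?W \<and> \<theta> ?W = \<sigma> t s" if "X (Suc t) s \<noteq> X t s" for s
    proof -
      have s: "s < k" using that by (auto simp: X_def split: if_splits)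
      have sig: "\<sigma> (Suc t) s = \<sigma> t s + 1" by (simp add: \<sigma>_def)
      then have ne: "F (\<sigma> t s + 1) \<noteq> F (\<sigma> t s)" using that unfolding X_def sig by (auto split: if_splits)
      define i where "i = F (\<sigma> t s + 1)"
      note ch = change[OF ne i_def]
      then have "\<theta> i mod L = (int t - int (k - 1 - s) * L) mod L" by (simp add: \<sigma>_def)
      also have "\<dots> = int t mod L" by (metis mod_mult_self4 mult.commute diff_conv_add_uminus mult_minus_left mod_mult_self1)
      finally have "nat (\<theta> i mod L) = t mod length w" unfolding L_def by (simp add: zmod_int[symmetric])
      then have "i = ?W" using letter[of i] ch W by simp
      moreover have "Suc (X t s) = i \<and> X (Suc t) s = i"
        using that ch s unfolding X_def sig by (auto simp: max_def min_def split: if_splits)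
      ultimately show ?thesis using ch by simp
    qed
    show "X (Suc t) = X t \<or> (\<exists>s<k. Suc (X t s) = ?W \<and> X (Suc t) = (X t)(s := ?W))"
    proof (cases "X (Suc t) = X t")
      case False
      then obtain s where s: "X (Suc t) s \<noteq> X t s" by auto
      have sk: "s < k" using s by (auto simp: X_def split: if_splits)
      have "X (Suc t) s' = X t s'" if "s' \<noteq> s" for s'
      proof (rule ccontr)
        assume "X (Suc t) s' \<noteq> X t s'"
        moreover from this have "s' < k" by (auto simp: X_def split: if_splits)
        ultimately have "int (k - 1 - s') * L = int (k - 1 - s) * L"
          using moved[of s] moved[of s'] s by (simp add: \<sigma>_def)
        then show False using L that sk \<open>s' < k\<close> by simp
      qed
      then have "X (Suc t) = (X t)(s := ?W)" using moved[OF s] by auto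
      then show ?thesis using moved[OF s] sk by blast
    qed simp
  qed (rule inc)
  have "X 0 s = s" if "s < k" for s
  proof -
    have "\<not> Suc s \<le> F (\<sigma> 0 s)"
      using F_iff[of "Suc s" "\<sigma> 0 s"] start[OF that] that k by (simp add: \<sigma>_def)
    then show ?thesis using that by (simp add: X_def)
  qed
  moreover have "X (m * length w) s = n - k + s" if "s < k" for s
  proof -
    have "n - k + s \<le> F (\<sigma> (m * length w) s)"
      using F_iff[of "n - k + s" "\<sigma> (m * length w) s"] finish[OF that] that k by (simp add: \<sigma>_def L_def)
    then show ?thesis using that k by (simp add: X_def)
  qed
  ultimately show ?thesis using that traj by blast
qed

section \<open>The upper bound for the exponents\<close>

lemma subseq_index:
  assumes "subseq xs ys"
  obtains f where "\<And>a. a < length xs \<Longrightarrow> f a < length ys \<and> ys ! f a = xs ! a"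
    "\<And>a b. a < b \<Longrightarrow> b < length xs \<Longrightarrow> f a < f b"
proof -
  have "\<exists>f. (\<forall>a<length xs. f a < length ys \<and> ys ! f a = xs ! a) \<and> (\<forall>a b. a < b \<and> b < length xs \<longrightarrow> f a < f b)"
    using assms
  proof (induction rule: list_emb.induct)
    case (list_emb_Cons xs ys y)
    then obtain f where "(\<forall>a<length xs. f a < length ys \<and> ys ! f a = xs ! a) \<and> (\<forall>a b. a < b \<and> b < length xs \<longrightarrow> f a < f b)"
      by blast
    then show ?case by (intro exI[of _ "\<lambda>a. Suc (f a)"]) auto
  next
    case (list_emb_Cons2 x y xs ys)
    then obtain f where "(\<forall>a<length xs. f a < length ys \<and> ys ! f a = xs ! a) \<and> (\<forall>a b. a < b \<and> b < length xs \<longrightarrow> f a < f b)"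
      by blast
    then show ?case using list_emb_Cons2(1)
      by (intro exI[of _ "\<lambda>a. case a of 0 \<Rightarrow> 0 | Suc a \<Rightarrow> Suc (f a)"]) (auto split: nat.splits)
  qed simp
  then show ?thesis using that by blast
qed

lemma subseq_rev: "subseq xs ys \<Longrightarrow> subseq (rev xs) (rev ys)"
  by (induction rule: list_emb.induct) (auto intro: list_emb_append_mono subseq_rev_drop_many)

lemma subseq_set: "subseq xs ys \<Longrightarrow> set xs \<subseteq> set ys"
  using list_emb_set[of "(=)" xs ys] by auto

text \<open>From \<open>k\<close> to \<open>n - k\<close> the counter grows by at most one per step
  and is constant on the \<open>p\<close> sites from \<open>i\<close> on. It is kept abstract so
  that the estimate serves descents and ascents alike.\<close>

lemma descent_count_bound:
  fixes S :: "nat \<Rightarrow> nat"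
  assumes mono: "\<And>i j. 1 \<le> i \<Longrightarrow> i \<le> j \<Longrightarrow> S i \<le> S j \<and> S j \<le> S i + (j - i)"
    and run: "\<And>a b. i \<le> a \<Longrightarrow> a \<le> b \<Longrightarrow> b < i + p \<Longrightarrow> S a = S b"
    and "1 \<le> i" "1 \<le> p" "i + p \<le> n" "1 \<le> k" "k < n"
  shows "k + S (n - k) \<le> max k (n - p) + S k"
proof (cases "n - k \<le> k")
  case True
  then have "S (n - k) \<le> S k" using mono[of "n - k" k] assms by simp
  then show ?thesis by simp
next
  case False
  \<comment> \<open>\<open>a\<close> and \<open>b\<close> delimit the part of the run inside the
    interval from \<open>k\<close> to \<open>n - k\<close>. The four combinations of maximum and
    minimum give the bound \<open>k\<close> or \<open>n - p\<close>, by \<open>i \<ge> 1\<close>,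
    \<open>k \<ge> 1\<close> and \<open>i + p \<le> n\<close>.\<close>
  define a where "a = max k i"
  define b where "b = min (n - k) (i + p - 1)"
  show ?thesis
  proof (cases "a \<le> b")
    case True
    have b: "1 \<le> b" "b \<le> n - k" using assms by (auto simp: b_def)
    have "S a = S b" using run[of a b] True assms by (simp add: a_def b_def)
    moreover have "S (n - k) \<le> S b + (n - k - b)" using mono[of b "n - k"] b by blast
    moreover have "S a \<le> S k + (a - k)" using mono[of k a] assms by (auto simp: a_def)
    moreover have "k + (n - k - b) + (a - k) \<le> max k (n - p)"
    proof -
      have "a = k \<or> a = i \<and> k \<le> i" "b = n - k \<or> b = i + p - 1"
        unfolding a_def b_def by linarith+
      then have "k + (n - k - b) + (a - k) \<le> k \<or> k + (n - k - b) + (a - k) \<le> n - p"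
        using b(2) True assms(3-7) by (elim disjE conjE) (simp_all, linarith+)
      then show ?thesis by (simp only: le_max_iff_disj)
    qed
    ultimately show ?thesis by simp
  next
    \<comment> \<open>If the run misses the interval then \<open>p \<le> k\<close>, and growth by
      one per step leads to \<open>n - k\<close>, which is at most \<open>n - p\<close>.\<close>
    case no: False
    have "a = k \<or> a = i \<and> k \<le> i" "b = n - k \<or> b = i + p - 1"
      unfolding a_def b_def by linarith+
    then have "n - k \<le> n - p"
      using no False assms(3-7) by (elim disjE conjE) linarith+
    moreover have "S (n - k) \<le> S k + (n - k - k)" using mono[of k "n - k"] False assms by simp
    ultimately show ?thesis using False by simp
  qed
qed

locale positioned_word = sym_factorization +
  fixes pos :: "nat \<Rightarrow> nat"
  assumes pos: "\<And>j. 1 \<le> j \<Longrightarrow> j < n \<Longrightarrow> pos j < length w \<and> w ! pos j = j"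
begin

text \<open>Counts how often a particle waiting in turn for the chosen occurrences of 1, ...,
  \<open>j\<close> has to pass into the next copy of the word.\<close>

definition descents :: "nat \<Rightarrow> nat" where
  "descents j = card {e \<in> {1..<j}. pos (Suc e) < pos e}"

lemma descents_Suc:
  assumes "1 \<le> j"
  shows "descents (Suc j) = descents j + (if pos (Suc j) < pos j then 1 else 0)"
proof -
  have "{e \<in> {1..<Suc j}. pos (Suc e) < pos e} =
      {e \<in> {1..<j}. pos (Suc e) < pos e} \<union> (if pos (Suc j) < pos j then {j} else {})"
    using assms by (auto simp: less_Suc_eq)
  then show ?thesis unfolding descents_def by auto
qed

lemma descents_mono:
  assumes "1 \<le> i" "i \<le> j"
  shows "descents i \<le> descents j \<and> descents j \<le> descents i + (j - i)"
  using assms(2)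
proof (induction rule: dec_induct)
  case (step m)
  then show ?case using descents_Suc[of m] assms(1) by auto
qed simp

lemma descents_le: "1 \<le> j \<Longrightarrow> descents j \<le> j - 1"
  using descents_mono[of 1 j] by (simp add: descents_def)

lemma A_pow_pos_of_descents:
  assumes k: "1 \<le> k" "k < n" and m: "k + descents (n - k) \<le> m + descents k"
    and fg: "increasing n k f" "increasing n k g"
  shows "0 < minor (A ^\<^sub>m m) k f g"
proof -
  let ?L = "int (length w)"
  \<comment> \<open>The time at which the chosen occurrence of \<open>j\<close> is read in copy
    number \<open>descents j\<close> of the word. Subtracting \<open>descents k\<close> shifts time
    so that the top particle, starting at site \<open>k - 1\<close>, makes its first hop in copy
    0.\<close>
  define \<theta> where "\<theta> = (\<lambda>j. (int (descents j) - int (descents k)) * ?L + int (pos j))"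
  have L: "0 < ?L" using pos[of 1] k by auto
  obtain e h where reach: "upreach n k (concat (replicate m w)) e h"
    and e: "\<And>s. s < k \<Longrightarrow> e s = s" and h: "\<And>s. s < k \<Longrightarrow> h s = n - k + s"
  proof (rule upreach_periodic[OF k])
    fix j assume j: "1 \<le> j" "Suc j < n"
    have "pos j \<noteq> pos (Suc j)" "pos j < length w" "pos (Suc j) < length w"
      using pos[of j] pos[of "Suc j"] j by auto
    then show "\<theta> j < \<theta> (Suc j) \<and> \<theta> (Suc j) < \<theta> j + int (length w)"
      unfolding \<theta>_def descents_Suc[OF j(1)] by (auto simp: algebra_simps)
  next
    fix j assume j: "1 \<le> j" "j < n"
    then have "\<theta> j mod ?L = int (pos j)" unfolding \<theta>_def using pos[of j] by simp
    then show "w ! nat (\<theta> j mod int (length w)) = j" using pos[of j] j by simp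
  next
    fix s assume s: "s < k"
    have "0 \<le> int (descents (Suc s)) - int (descents k) + int (k - 1 - s)"
      using descents_mono[of "Suc s" k] s by linarith
    then have "0 \<le> (int (descents (Suc s)) - int (descents k) + int (k - 1 - s)) * ?L" by simp
    then show "0 \<le> \<theta> (Suc s) + int (k - 1 - s) * int (length w)" unfolding \<theta>_def by (simp add: algebra_simps)
  next
    fix s assume s: "s < k"
    have "descents (n - k + s) \<le> descents (n - k) + s" using descents_mono[of "n - k" "n - k + s"] k by simp
    then have "int (descents (n - k + s)) - int (descents k) + int (k - 1 - s) \<le> int m - 1"
      using m s by simp
    then have "(int (descents (n - k + s)) - int (descents k) + int (k - 1 - s)) * ?L \<le> (int m - 1) * ?L"
      by (rule mult_right_mono) simp
    moreover have "int (pos (n - k + s)) < ?L" using pos[of "n - k + s"] k s by simp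
    ultimately show "\<theta> (n - k + s) + int (k - 1 - s) * int (length w) < int m * int (length w)"
      unfolding \<theta>_def by (simp add: algebra_simps)
  qed (use L in auto)
  have "increasing n k e" using increasing_cong[of k e "\<lambda>s. s"] e increasing_id[of k n] k by simp
  then have "0 < minor (A ^\<^sub>m m) k e h" using A_pow_pos reach by blast
  also have "minor (A ^\<^sub>m m) k e h = minor (A ^\<^sub>m m) k (\<lambda>s. s) (\<lambda>s. n - k + s)"
    by (rule minor_cong) (use e h in auto)
  finally show ?thesis using sym_tn_corner_imp_pos[OF A_pow_sym_tn _ fg] by simp
qed

lemma minor_exponent_le_of_descents:
  assumes "1 \<le> k" "k < n" "1 \<le> m" "k + descents (n - k) \<le> m + descents k"
  shows "minor_exponent k A \<le> m"
  unfolding minor_exponent_def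
  by (rule Least_le)
     (use A_pow_pos_of_descents[OF assms(1,2,4)] minors_pos_iff[OF A_pow_carrier] assms in auto)

lemma minor_exponent_le_ascending:
  assumes "1 \<le> k" "k < n" "1 \<le> i" "1 \<le> p" "i + p \<le> n"
    "\<And>e. i \<le> e \<Longrightarrow> Suc e < i + p \<Longrightarrow> pos e < pos (Suc e)"
  shows "minor_exponent k A \<le> max k (n - p)"
proof (rule minor_exponent_le_of_descents)
  show "k + descents (n - k) \<le> max k (n - p) + descents k"
  proof (rule descent_count_bound)
    show "descents a = descents b" if "i \<le> a" "a \<le> b" "b < i + p" for a b
      using that(2,3)
    proof (induction b rule: dec_induct)
      case (step b)
      then show ?case using assms(6)[of b] that assms(3) by (simp add: descents_Suc)
    qed simp
  qed (use assms descents_mono in auto)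
qed (use assms in auto)

text \<open>Counting ascents instead of descents exchanges \<open>k\<close> with \<open>n - k\<close>.\<close>
lemma minor_exponent_le_descending:
  assumes "1 \<le> k" "k < n" "1 \<le> i" "1 \<le> q" "i + q \<le> n"
    "\<And>e. i \<le> e \<Longrightarrow> Suc e < i + q \<Longrightarrow> pos (Suc e) < pos e"
  shows "minor_exponent k A \<le> max (n - k) (n - q)"
proof (rule minor_exponent_le_of_descents)
  \<comment> \<open>\<open>S j\<close> counts the ascents below \<open>j\<close>: ascents and
    descents together fill the \<open>j - 1\<close> steps.\<close>
  define S where "S = (\<lambda>j. j - 1 - descents j)"
  have "(n - k) + S (n - (n - k)) \<le> max (n - k) (n - q) + S (n - k)"
  proof (rule descent_count_bound)
    show "S a \<le> S b \<and> S b \<le> S a + (b - a)" if "1 \<le> a" "a \<le> b" for a b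
      using descents_mono[OF that] descents_le[of a] descents_le[of b] that unfolding S_def by linarith
    show "S a = S b" if "i \<le> a" "a \<le> b" "b < i + q" for a b
    proof -
      have "descents b = descents a + (b - a)"
        using that(2,3)
      proof (induction b rule: dec_induct)
        case (step b)
        then show ?case using assms(6)[of b] that assms(3) by (simp add: descents_Suc)
      qed simp
      then show ?thesis using that assms(3) unfolding S_def by simp
    qed
  qed (use assms in auto)
  moreover have "n - (n - k) = k" using assms(2) by simp
  ultimately have "(n - k) + S k \<le> max (n - k) (n - q) + S (n - k)" by simp
  moreover have "S (n - k) + descents (n - k) + 1 = n - k" "S k + descents k + 1 = k"
    using descents_le[of k] descents_le[of "n - k"] assms(1,2) unfolding S_def by linarith+
  ultimately show "k + descents (n - k) \<le> max (n - k) (n - q) + descents k" by linarith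
qed (use assms in auto)

lemma A_oscillatory:
  assumes "2 \<le> n"
  shows "oscillatory A"
proof -
  \<comment> \<open>The exponent \<open>n\<close> serves all orders \<open>k < n\<close> because the
    descent count of \<open>n - k\<close> is at most \<open>n - k\<close>; the minor of order
    \<open>n\<close> is the determinant.\<close>
  have "totally_positive (A ^\<^sub>m n)"
    unfolding totally_positive_def minors_pos_iff[OF A_pow_carrier]
  proof (intro allI impI)
    fix k f g assume k: "1 \<le> k" and fg: "increasing n k f" "increasing n k g"
    show "0 < minor (A ^\<^sub>m n) k f g"
    proof (cases "k < n")
      case True
      have "descents (n - k) \<le> n - k" using descents_le[of "n - k"] True by linarith
      then show ?thesis by (intro A_pow_pos_of_descents[OF k True _ fg]) (use True in linarith)
    next
      case False
      then have kn: "k = n" using increasing_card[OF fg(1)] by simp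
      have "f s = s \<and> g s = s" if "s < n" for s
        using increasing_ge[OF fg(1), of s] increasing_ge[OF fg(2), of s]
          increasing_le_top[OF fg(1), of s] increasing_le_top[OF fg(2), of s] that kn by simp
      then have "minor (A ^\<^sub>m n) k f g = det (A ^\<^sub>m n)"
        unfolding kn minor_full[OF A_pow_carrier, symmetric] by (intro minor_cong) auto
      then show ?thesis using A_pow_det_pos by simp
    qed
  qed
  moreover have "totally_nonnegative A"
    using totally_nonnegative_iff_tn[OF A_carrier] A_pow_tn[of 1] A_pow_1 by simp
  moreover have "square_mat A" using A_carrier by simp
  ultimately show ?thesis unfolding oscillatory_def using assms by (intro conjI exI[of _ n]) auto
qed

end

section \<open>Choosing occurrences along a run\<close>

context sym_factorization
begin

text \<open>\<open>\<tau> a\<close> is the place of the letter \<open>i + a\<close> in the given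
  subsequence: the identity for an increasing run, the reversal for a decreasing one. Letters
  outside the run take any occurrence, and \<open>p = 0\<close> imposes no run at all.\<close>

lemma obtain_positions:
  assumes "{1..<n} \<subseteq> set w" "1 \<le> i" "i + p \<le> n" "subseq xs w" "length xs = p"
    "\<And>a. a < p \<Longrightarrow> xs ! \<tau> a = i + a" "\<And>a. a < p \<Longrightarrow> \<tau> a < p"
  obtains pos f where "positioned_word n w as D pos" "\<And>a. a < p \<Longrightarrow> pos (i + a) = f (\<tau> a)"
    "\<And>a b. a < b \<Longrightarrow> b < p \<Longrightarrow> (f a :: nat) < f b"
proof -
  obtain f where f: "\<And>a. a < length xs \<Longrightarrow> f a < length w \<and> w ! f a = xs ! a"
    "\<And>a b. a < b \<Longrightarrow> b < length xs \<Longrightarrow> f a < f b"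
    using subseq_index[OF assms(4)] by blast
  define pos where "pos = (\<lambda>j. if i \<le> j \<and> j < i + p then f (\<tau> (j - i)) else SOME t. t < length w \<and> w ! t = j)"
  have "pos j < length w \<and> w ! pos j = j" if "1 \<le> j" "j < n" for j
  proof (cases "i \<le> j \<and> j < i + p")
    case True
    then have "j - i < p" by auto
    then show ?thesis using f(1)[of "\<tau> (j - i)"] assms(5-7) True by (simp add: pos_def)
  next
    case False
    have "\<exists>t. t < length w \<and> w ! t = j" using that assms(1) by (auto simp: in_set_conv_nth)
    then show ?thesis using someI_ex[of "\<lambda>t. t < length w \<and> w ! t = j"] False unfolding pos_def
      by (simp only: if_False)
  qed
  then have "positioned_word n w as D pos" by unfold_locales
  then show ?thesis by (rule that[of pos f]) (use f(2) assms(5) in \<open>auto simp: pos_def\<close>)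
qed

lemma minor_exponent_le_ascending_run:
  assumes "{1..<n} \<subseteq> set w" "1 \<le> i" "1 \<le> p" "i + p \<le> n" "subseq [i..<i + p] w" "1 \<le> k" "k < n"
  shows "minor_exponent k A \<le> max k (n - p)"
proof -
  obtain pos f where "positioned_word n w as D pos" and f: "\<And>a. a < p \<Longrightarrow> pos (i + a) = f a"
    "\<And>a b. a < b \<Longrightarrow> b < p \<Longrightarrow> (f a :: nat) < f b"
    using obtain_positions[OF assms(1,2,4,5), of "\<lambda>a. a"] by auto
  then interpret positioned_word n w as D pos by simp
  show ?thesis
  proof (rule minor_exponent_le_ascending[OF assms(6,7,2,3,4)])
    fix e assume "i \<le> e" "Suc e < i + p"
    then show "pos e < pos (Suc e)" using f(1)[of "e - i"] f(1)[of "Suc e - i"] f(2)[of "e - i" "Suc e - i"] by simp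
  qed
qed

lemma minor_exponent_le_descending_run:
  assumes "{1..<n} \<subseteq> set w" "1 \<le> i" "1 \<le> q" "i + q \<le> n" "subseq (rev [i..<i + q]) w" "1 \<le> k" "k < n"
  shows "minor_exponent k A \<le> max (n - k) (n - q)"
proof -
  obtain pos f where "positioned_word n w as D pos" and f: "\<And>a. a < q \<Longrightarrow> pos (i + a) = f (q - 1 - a)"
    "\<And>a b. a < b \<Longrightarrow> b < q \<Longrightarrow> (f a :: nat) < f b"
    using obtain_positions[OF assms(1,2,4,5), of "\<lambda>a. q - 1 - a"] by (auto simp: rev_nth)
  then interpret positioned_word n w as D pos by simp
  show ?thesis
  proof (rule minor_exponent_le_descending[OF assms(6,7,2,3,4)])
    fix e assume "i \<le> e" "Suc e < i + q"
    then show "pos (Suc e) < pos e"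
      using f(1)[of "e - i"] f(1)[of "Suc e - i"] f(2)[of "q - 1 - (Suc e - i)" "q - 1 - (e - i)"] by simp
  qed
qed

lemma A_oscillatory_of_letters:
  assumes "{1..<n} \<subseteq> set w" "2 \<le> n"
  shows "oscillatory A"
proof -
  obtain pos where "positioned_word n w as D pos"
    using obtain_positions[OF assms(1), of 1 0 "[]"] assms(2) by auto
  then show ?thesis using positioned_word.A_oscillatory assms(2) by blast
qed

end

section \<open>Bandwidths and runs of consecutive letters\<close>

text \<open>An entry sums over the paths of a single particle from \<open>r\<close> to
  \<open>c\<close>, that is, over the occurrences of \<open>r + 1\<close>, ..., \<open>c\<close> as
  a subsequence; with positive parameters nothing cancels.\<close>

lemma upper_product_entry:
  assumes "length as = length w" "set w \<subseteq> {1..<n}" "\<forall>a\<in>set as. 0 < a" "r < n" "c < n"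
  shows "0 \<le> upper_product n w as $$ (r, c) \<and>
    (0 < upper_product n w as $$ (r, c) \<longleftrightarrow> r \<le> c \<and> subseq [Suc r..<Suc c] w)"
  using assms
proof (induction as w arbitrary: r rule: list_induct2)
  case Nil
  then show ?case by (auto simp: upt_rec)
next
  case (Cons a as i w)
  let ?U = "upper_product n w as"
  have i: "1 \<le> i" "i < n" "0 < a" using Cons.prems by auto
  have eq: "upper_product n (i # w) (a # as) $$ (r, c) = ?U $$ (r, c) + (if r + 1 = i then a * ?U $$ (i, c) else 0)"
    using Cons.hyps Cons.prems i by (simp add: upper_factor_mult_index del: index_mult_mat(1))
  have IH: "0 \<le> ?U $$ (r, c) \<and> (0 < ?U $$ (r, c) \<longleftrightarrow> r \<le> c \<and> subseq [Suc r..<Suc c] w)" if "r < n" for r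
    using Cons that by simp
  have upt: "[Suc r..<Suc c] = (if r < c then Suc r # [Suc (Suc r)..<Suc c] else [])"
    by (simp add: upt_rec)
  show ?case
  proof (cases "Suc r = i")
    case False
    then have "subseq [Suc r..<Suc c] (i # w) \<longleftrightarrow> subseq [Suc r..<Suc c] w"
      unfolding upt by auto
    then show ?thesis unfolding eq using IH[OF Cons.prems(3)] False by simp
  next
    case True
    have "0 < ?U $$ (r, c) + a * ?U $$ (i, c) \<longleftrightarrow> 0 < ?U $$ (r, c) \<or> 0 < ?U $$ (i, c)"
      using IH[OF Cons.prems(3)] IH[OF i(2)] i(3)
      by (smt (verit) mult_nonneg_nonneg mult_pos_pos mult_eq_0_iff)
    also have "\<dots> \<longleftrightarrow> r \<le> c \<and> subseq [Suc r..<Suc c] (i # w)"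
      using IH[OF Cons.prems(3)] IH[OF i(2)] True unfolding upt
      by (auto dest: subseq_Cons' simp: le_less Suc_le_eq)
    finally show ?thesis unfolding eq using IH[OF Cons.prems(3)] IH[OF i(2)] i(3) True by simp
  qed
qed

declare upt_Suc [simp del]

lemma sum_nonneg_pos_iff:
  fixes f :: "'a \<Rightarrow> real"
  assumes "finite S" "\<And>x. x \<in> S \<Longrightarrow> 0 \<le> f x"
  shows "sum f S \<noteq> 0 \<longleftrightarrow> (\<exists>x\<in>S. 0 < f x)"
proof -
  have "sum f S = 0 \<longleftrightarrow> (\<forall>x\<in>S. f x = 0)" by (rule sum_nonneg_eq_0_iff[OF assms])
  then show ?thesis using assms(2) by (force simp: less_le)
qed

lemma mult_pos_iff_nonneg:
  fixes x y d :: real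
  shows "0 \<le> x \<Longrightarrow> 0 < d \<Longrightarrow> 0 \<le> y \<Longrightarrow> 0 < x * (d * y) \<longleftrightarrow> 0 < x \<and> 0 < y"
  by (auto simp: zero_less_mult_iff)

lemma mult_mat_entry:
  fixes A B :: "real mat"
  assumes "A \<in> carrier_mat n n" "B \<in> carrier_mat n n" "i < n" "j < n"
  shows "(A * B) $$ (i, j) = (\<Sum>l<n. A $$ (i, l) * B $$ (l, j))"
  using assms by (auto simp: scalar_prod_def atLeast0LessThan)

text \<open>The half-bandwidth in combinatorial form. The empty runs \<open>i = j\<close> keep the
  set nonempty for \<open>n > 0\<close> and correspond to the element 0 in the definition of the
  half-bandwidth.\<close>

definition run_max :: "nat \<Rightarrow> nat list \<Rightarrow> nat" where
  "run_max n w = Max {j - i | i j. i \<le> j \<and> j < n \<and> subseq [Suc i..<Suc j] w}"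

lemma finite_runs: "finite {j - i | i j. i \<le> j \<and> j < n \<and> subseq [Suc i..<Suc j] w}"
  by (rule finite_subset[of _ "{..<n}"]) auto

lemma run_max_ge: "i \<le> j \<Longrightarrow> j < n \<Longrightarrow> subseq [Suc i..<Suc j] w \<Longrightarrow> j - i \<le> run_max n w"
  unfolding run_max_def by (rule Max_ge[OF finite_runs]) auto

lemma run_max_attained:
  assumes "0 < n"
  obtains i where "i + run_max n w < n" "subseq [Suc i..<Suc (i + run_max n w)] w"
proof -
  let ?R = "{j - i | i j. i \<le> j \<and> j < n \<and> subseq [Suc i..<Suc j] w}"
  have "0 - 0 \<in> ?R" using assms by force
  then have "run_max n w \<in> ?R" unfolding run_max_def using Max_in[OF finite_runs] by blast
  then obtain i j where "run_max n w = j - i" "i \<le> j" "j < n" "subseq [Suc i..<Suc j] w" by blast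
  then show ?thesis using that[of i] by simp
qed

lemma run_max_eqI:
  assumes "i + p < n" "subseq [Suc i..<Suc (i + p)] w"
    "\<And>i j. i < j \<Longrightarrow> j < n \<Longrightarrow> subseq [Suc i..<Suc j] w \<Longrightarrow> j - i \<le> p"
  shows "run_max n w = p"
proof (rule antisym)
  obtain i where i: "i + run_max n w < n" "subseq [Suc i..<Suc (i + run_max n w)] w"
    using run_max_attained[of n w] assms(1) by auto
  then show "run_max n w \<le> p" using assms(3)[of i "i + run_max n w"] by (cases "run_max n w = 0") auto
  show "p \<le> run_max n w" using run_max_ge[OF _ assms(1,2)] by simp
qed

lemma half_bandwidth_eq_run_max:
  assumes "M \<in> carrier_mat n n" "0 < n"
    "\<And>i j. i \<le> j \<Longrightarrow> j < n \<Longrightarrow> (M $$ (i, j) \<noteq> 0 \<longleftrightarrow> subseq [Suc i..<Suc j] w) \<and>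
      (M $$ (j, i) \<noteq> 0 \<longleftrightarrow> subseq [Suc i..<Suc j] w)"
  shows "half_bandwidth M = run_max n w"
proof -
  let ?R = "{j - i | i j. i \<le> j \<and> j < n \<and> subseq [Suc i..<Suc j] w}"
  have "{0} \<union> {nat \<bar>int i - int j\<bar> | i j. i < dim_row M \<and> j < dim_col M \<and> M $$ (i, j) \<noteq> 0} = ?R"
  proof (intro equalityI subsetI)
    fix x assume "x \<in> {0} \<union> {nat \<bar>int i - int j\<bar> | i j. i < dim_row M \<and> j < dim_col M \<and> M $$ (i, j) \<noteq> 0}"
    then consider "x = 0" | i j where "x = nat \<bar>int i - int j\<bar>" "i < n" "j < n" "M $$ (i, j) \<noteq> 0"
      using assms(1) by auto
    then show "x \<in> ?R"
    proof cases
      case 1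
      then show ?thesis using assms(2) by force
    next
      case 2
      show ?thesis
      proof (cases "i \<le> j")
        case True
        then have "x = j - i" "subseq [Suc i..<Suc j] w" using 2 assms(3)[of i j] by auto
        then show ?thesis using True 2 by blast
      next
        case False
        then have "x = i - j" "subseq [Suc j..<Suc i] w" using 2 assms(3)[of j i] by auto
        then show ?thesis using False 2 by (metis (mono_tags, lifting) mem_Collect_eq nat_le_linear)
      qed
    qed
  next
    fix x assume "x \<in> ?R"
    then obtain i j where ij: "x = j - i" "i \<le> j" "j < n" "subseq [Suc i..<Suc j] w" by blast
    then have "x = nat \<bar>int i - int j\<bar>" "M $$ (i, j) \<noteq> 0" using assms(3)[of i j] by auto
    moreover have "i < dim_row M" "j < dim_col M" using ij assms(1) by auto
    ultimately show "x \<in> {0} \<union> {nat \<bar>int i - int j\<bar> | i j. i < dim_row M \<and> j < dim_col M \<and> M $$ (i, j) \<noteq> 0}"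
      by blast
  qed
  then show ?thesis unfolding half_bandwidth_def run_max_def by simp
qed

text \<open>Negating all parameters is conjugation by the diagonal matrix of alternating
  signs.\<close>

lemma upper_product_uminus_entry:
  assumes "length as = length w" "set w \<subseteq> {1..<n}" "r < n" "c < n"
  shows "upper_product n w (map uminus as) $$ (r, c) = (-1) ^ (r + c) * upper_product n w as $$ (r, c)"
  using assms
proof (induction as w arbitrary: r rule: list_induct2)
  case (Cons a as i w)
  have i: "1 \<le> i" "i < n" using Cons.prems by auto
  have eq: "upper_product n (i # w) (b # bs) $$ (r, c) =
      upper_product n w bs $$ (r, c) + (if r + 1 = i then b * upper_product n w bs $$ (i, c) else 0)"
    if "length bs = length w" for b bs
    using that Cons.prems i by (simp add: upper_factor_mult_index del: index_mult_mat(1))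
  have "upper_product n w (map uminus as) $$ (r, c) = (-1) ^ (r + c) * upper_product n w as $$ (r, c)"
    "upper_product n w (map uminus as) $$ (i, c) = (-1) ^ (i + c) * upper_product n w as $$ (i, c)"
    using Cons i by auto
  then show ?case using eq[of as a] eq[of "map uminus as" "- a"] Cons.hyps by (auto simp: algebra_simps)
qed auto

lemma upper_product_inverse:
  assumes "length as = length w" "set w \<subseteq> {1..<n}"
  shows "upper_product n w as * upper_product n (rev w) (map uminus (rev as)) = 1\<^sub>m n"
  using assms
proof (induction as w rule: list_induct2)
  case (Cons a as i w)
  let ?U = "upper_product n w as" and ?W = "upper_product n (rev w) (map uminus (rev as))"
  let ?E = "upper_factor n i a" and ?F = "upper_factor n i (- a)"
  have i: "1 \<le> i" "i < n" using Cons.prems by auto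
  have U: "?U \<in> carrier_mat n n" and W: "?W \<in> carrier_mat n n" using Cons.hyps by auto
  have "upper_product n (rev (i # w)) (map uminus (rev (a # as))) = ?W * ?F"
    using Cons.hyps by (simp add: upper_product_append)
  then have "upper_product n (i # w) (a # as) * upper_product n (rev (i # w)) (map uminus (rev (a # as))) =
      ?E * ?U * (?W * ?F)" by simp
  also have "\<dots> = ?E * ((?U * ?W) * ?F)" using U W by (simp add: assoc_mult_mat[of _ n n _ n _ n])
  also have "\<dots> = ?E * ?F" using Cons by (simp add: left_mult_one_mat[of _ n n])
  also have "\<dots> = 1\<^sub>m n" using i by (simp add: upper_factor_mult_upper_factor upper_factor_zero)
  finally show ?case .
qed simp

lemma inv_mat_eq:
  assumes "A \<in> carrier_mat n n" "B \<in> carrier_mat n n" "A * B = 1\<^sub>m n"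
  shows "inv_mat A = B"
proof (cases "mat_inverse A")
  case None
  have "det A * det B = 1" using assms det_mult[of A n B] by simp
  then have "det A \<noteq> 0" by auto
  then have "A \<in> Units (ring_mat TYPE(real) n ())" by (rule det_non_zero_imp_unit[OF assms(1)])
  then show ?thesis using mat_inverse(1)[OF assms(1) None, where b = "()"] by simp
next
  case (Some X)
  have X: "A * X = 1\<^sub>m n" "X * A = 1\<^sub>m n" "X \<in> carrier_mat n n"
    using mat_inverse(2)[OF assms(1) Some] by auto
  have "X = X * (A * B)" using assms X by simp
  also have "\<dots> = X * A * B" by (rule assoc_mult_mat[OF X(3) assms(1,2), symmetric])
  also have "\<dots> = B" using X assms by simp
  finally show ?thesis unfolding inv_mat_def using Some by simp
qed

section \<open>Nonzero entries of the matrix and of its inverse\<close>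

context sym_factorization
begin

lemma U_entry:
  "r < n \<Longrightarrow> c < n \<Longrightarrow> 0 \<le> U $$ (r, c) \<and> (0 < U $$ (r, c) \<longleftrightarrow> r \<le> c \<and> subseq [Suc r..<Suc c] w)"
  using upper_product_entry w as by (simp add: pos_params_def)

lemma A_entry:
  assumes "i < n" "j < n"
  shows "A $$ (i, j) = (\<Sum>l<n. U $$ (l, i) * (D $$ (l, l) * U $$ (l, j)))"
proof -
  have DU: "D * U \<in> carrier_mat n n" using D_carrier U_carrier by (meson mult_carrier_mat)
  have "A = transpose_mat U * (D * U)"
    unfolding sym_product_def using U_carrier D_carrier by (simp add: assoc_mult_mat[of _ n n _ n _ n])
  then have "A $$ (i, j) = (\<Sum>l<n. transpose_mat U $$ (i, l) * (D * U) $$ (l, j))"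
    using assms U_carrier DU by (simp only: mult_mat_entry[OF _ DU] transpose_carrier_mat)
  also have "\<dots> = (\<Sum>l<n. U $$ (l, i) * (D $$ (l, l) * U $$ (l, j)))"
    using assms U_carrier
    by (intro sum.cong) (auto simp: diagonal_mult_index[OF D U_carrier] simp del: index_mult_mat(1))
  finally show ?thesis .
qed

text \<open>All summands are nonnegative, so nothing cancels. The summand \<open>l = i\<close>
  already detects the run from \<open>i + 1\<close> to \<open>j\<close>, and a run that begins at a
  smaller \<open>l\<close> contains it.\<close>

lemma A_entry_nonzero:
  assumes "i \<le> j" "j < n"
  shows "A $$ (i, j) \<noteq> 0 \<longleftrightarrow> subseq [Suc i..<Suc j] w"
proof -
  have d: "0 < D $$ (l, l)" if "l < n" for l using D that by (simp add: pos_diagonal_def)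
  have nn: "0 \<le> U $$ (l, i) * (D $$ (l, l) * U $$ (l, j))" if "l < n" for l
    using d[OF that] U_entry[OF that, of i] U_entry[OF that, of j] assms by simp
  have "A $$ (i, j) \<noteq> 0 \<longleftrightarrow> (\<exists>l\<in>{..<n}. 0 < U $$ (l, i) * (D $$ (l, l) * U $$ (l, j)))"
    using A_entry[of i j] assms nn by (subst sum_nonneg_pos_iff[symmetric]) auto
  also have "\<dots> \<longleftrightarrow> (\<exists>l<n. 0 < U $$ (l, i) \<and> 0 < U $$ (l, j))"
    using d U_entry[of _ i] U_entry[of _ j] assms by (auto simp: mult_pos_iff_nonneg)
  also have "\<dots> \<longleftrightarrow> subseq [Suc i..<Suc j] w"
  proof
    assume "\<exists>l<n. 0 < U $$ (l, i) \<and> 0 < U $$ (l, j)"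
    then obtain l where l: "l \<le> i" "subseq [Suc l..<Suc j] w" using U_entry[of _ i] U_entry[of _ j] assms by auto
    have "[Suc l..<Suc j] = [Suc l..<Suc i] @ [Suc i..<Suc j]"
      using l(1) assms(1) upt_add_eq_append[of "Suc l" "Suc i" "j - i"] by simp
    then have "subseq [Suc i..<Suc j] [Suc l..<Suc j]" by (simp add: subseq_drop_many)
    then show "subseq [Suc i..<Suc j] w" using l(2) subseq_order.order_trans by blast
  next
    assume "subseq [Suc i..<Suc j] w"
    then show "\<exists>l<n. 0 < U $$ (l, i) \<and> 0 < U $$ (l, j)"
      using U_entry[of i i] U_entry[of i j] assms by (intro exI[of _ i]) auto
  qed
  finally show ?thesis .
qed

lemma A_symmetric: "i < n \<Longrightarrow> j < n \<Longrightarrow> A $$ (i, j) = A $$ (j, i)"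
  by (simp add: A_entry algebra_simps)

lemma half_bandwidth_A: "0 < n \<Longrightarrow> half_bandwidth A = run_max n w"
  by (rule half_bandwidth_eq_run_max[OF A_carrier])
     (use A_entry_nonzero A_symmetric in \<open>auto simp: order_le_less_trans\<close>)

abbreviation "V \<equiv> upper_product n (rev w) (rev as)"
abbreviation "W \<equiv> upper_product n (rev w) (map uminus (rev as))"

lemma W_entry: "r < n \<Longrightarrow> c < n \<Longrightarrow> W $$ (r, c) = (-1) ^ (r + c) * V $$ (r, c)"
  using upper_product_uminus_entry[of "rev as" "rev w"] w as by (simp add: pos_params_def)

lemma V_entry:
  "r < n \<Longrightarrow> c < n \<Longrightarrow> 0 \<le> V $$ (r, c) \<and> (0 < V $$ (r, c) \<longleftrightarrow> r \<le> c \<and> subseq [Suc r..<Suc c] (rev w))"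
  using upper_product_entry[of "rev as" "rev w"] w as by (simp add: pos_params_def)

lemma W_carrier: "W \<in> carrier_mat n n"
  using as by (simp add: pos_params_def)

definition "Dinv = mat n n (\<lambda>(i, j). if i = j then 1 / D $$ (i, i) else 0)"

lemma Dinv: "pos_diagonal n Dinv"
  using D unfolding pos_diagonal_def Dinv_def diagonal_mat_def by auto

lemma inv_mat_A: "inv_mat A = W * (Dinv * transpose_mat W)"
proof (rule inv_mat_eq[OF A_carrier])
  have C: "Dinv \<in> carrier_mat n n" "transpose_mat W \<in> carrier_mat n n" "transpose_mat U \<in> carrier_mat n n"
    using W_carrier U_carrier by (auto simp: Dinv_def)
  then show "W * (Dinv * transpose_mat W) \<in> carrier_mat n n" using W_carrier by (meson mult_carrier_mat)
  have UW: "U * W = 1\<^sub>m n" using upper_product_inverse w as by (simp add: pos_params_def)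
  then have "W * U = 1\<^sub>m n" using mat_mult_left_right_inverse[OF U_carrier W_carrier] by simp
  then have UTWT: "transpose_mat U * transpose_mat W = 1\<^sub>m n"
    using transpose_mult[OF W_carrier U_carrier] by simp
  have DD: "D * Dinv = 1\<^sub>m n"
  proof (rule eq_matI)
    fix i j assume "i < dim_row (1\<^sub>m n :: real mat)" "j < dim_col (1\<^sub>m n :: real mat)"
    then have ij: "i < n" "j < n" by auto
    moreover have "D $$ (i, i) \<noteq> 0" using D ij by (auto simp: pos_diagonal_def)
    ultimately show "(D * Dinv) $$ (i, j) = 1\<^sub>m n $$ (i, j)"
      unfolding diagonal_mult_index[OF D C(1) ij] by (auto simp: Dinv_def)
  qed (use D_carrier C in auto)
  have "A * (W * (Dinv * transpose_mat W)) = transpose_mat U * (D * ((U * W) * (Dinv * transpose_mat W)))"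
    unfolding sym_product_def using U_carrier W_carrier D_carrier C
    by (simp add: assoc_mult_mat[of _ n n _ n _ n])
  also have "(U * W) * (Dinv * transpose_mat W) = Dinv * transpose_mat W"
    unfolding UW using C by (intro left_mult_one_mat[of _ n n]) (meson mult_carrier_mat)
  also have "D * (Dinv * transpose_mat W) = (D * Dinv) * transpose_mat W"
    using D_carrier C by (simp add: assoc_mult_mat[of _ n n _ n _ n])
  also have "\<dots> = transpose_mat W" unfolding DD using C by (intro left_mult_one_mat[of _ n n])
  finally show "A * (W * (Dinv * transpose_mat W)) = 1\<^sub>m n" using UTWT by simp
qed

text \<open>The signs of the two factors of a summand multiply to \<open>(-1) ^ (i + j)\<close>
  whatever \<open>l\<close> is; therefore the inverse shows no cancellation either.\<close>

lemma inv_mat_A_entry: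
  assumes "i < n" "j < n"
  shows "inv_mat A $$ (i, j) = (-1) ^ (i + j) * (\<Sum>l<n. V $$ (i, l) * (Dinv $$ (l, l) * V $$ (j, l)))"
proof -
  have C: "Dinv \<in> carrier_mat n n" "transpose_mat W \<in> carrier_mat n n"
    using W_carrier by (auto simp: Dinv_def)
  then have DW: "Dinv * transpose_mat W \<in> carrier_mat n n" by (meson mult_carrier_mat)
  have "inv_mat A $$ (i, j) = (\<Sum>l<n. W $$ (i, l) * (Dinv * transpose_mat W) $$ (l, j))"
    unfolding inv_mat_A by (rule mult_mat_entry[OF W_carrier DW assms])
  also have "\<dots> = (\<Sum>l<n. (-1) ^ (i + j) * (V $$ (i, l) * (Dinv $$ (l, l) * V $$ (j, l))))"
  proof (intro sum.cong refl)
    fix l assume "l \<in> {..<n}"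
    then have l: "l < n" by simp
    have "(Dinv * transpose_mat W) $$ (l, j) = Dinv $$ (l, l) * W $$ (j, l)"
      using diagonal_mult_index[OF Dinv C(2) l assms(2)] l assms(2) W_carrier by simp
    moreover have "W $$ (i, l) * (Dinv $$ (l, l) * W $$ (j, l)) =
        ((-1) ^ (i + l) * (-1) ^ (j + l)) * (V $$ (i, l) * (Dinv $$ (l, l) * V $$ (j, l)))"
      using W_entry[OF assms(1) l] W_entry[OF assms(2) l] by simp
    moreover have "(-1) ^ (i + l) * (-1) ^ (j + l) = (-1 :: real) ^ (i + j)"
      by (simp add: power_add)
    ultimately show "W $$ (i, l) * (Dinv * transpose_mat W) $$ (l, j) =
        (-1) ^ (i + j) * (V $$ (i, l) * (Dinv $$ (l, l) * V $$ (j, l)))"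
      by simp
  qed
  finally show ?thesis by (simp add: sum_distrib_left)
qed

text \<open>As for the matrix itself, with paths prolonged beyond \<open>j\<close> instead of begun
  before \<open>i\<close>.\<close>

lemma inv_mat_A_entry_nonzero:
  assumes "i \<le> j" "j < n"
  shows "(\<Sum>l<n. V $$ (i, l) * (Dinv $$ (l, l) * V $$ (j, l))) \<noteq> 0 \<longleftrightarrow> subseq [Suc i..<Suc j] (rev w)"
proof -
  have d: "0 < Dinv $$ (l, l)" if "l < n" for l using Dinv that by (simp add: pos_diagonal_def)
  have nn: "0 \<le> V $$ (i, l) * (Dinv $$ (l, l) * V $$ (j, l))" if "l < n" for l
    using d[OF that] V_entry[OF _ that, of i] V_entry[OF _ that, of j] assms by simp
  have "(\<Sum>l<n. V $$ (i, l) * (Dinv $$ (l, l) * V $$ (j, l))) \<noteq> 0 \<longleftrightarrow>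
      (\<exists>l\<in>{..<n}. 0 < V $$ (i, l) * (Dinv $$ (l, l) * V $$ (j, l)))"
    using nn by (intro sum_nonneg_pos_iff) auto
  also have "\<dots> \<longleftrightarrow> (\<exists>l<n. 0 < V $$ (i, l) \<and> 0 < V $$ (j, l))"
    using d V_entry[of i] V_entry[of j] assms by (auto simp: mult_pos_iff_nonneg)
  also have "\<dots> \<longleftrightarrow> subseq [Suc i..<Suc j] (rev w)"
  proof
    assume "\<exists>l<n. 0 < V $$ (i, l) \<and> 0 < V $$ (j, l)"
    then obtain l where l: "j \<le> l" "subseq [Suc i..<Suc l] (rev w)" using V_entry[of i] V_entry[of j] assms by auto
    have "[Suc i..<Suc l] = [Suc i..<Suc j] @ [Suc j..<Suc l]"
      using l(1) assms(1) upt_add_eq_append[of "Suc i" "Suc j" "l - j"] by simp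
    then have "subseq [Suc i..<Suc j] [Suc i..<Suc l]" by (simp add: subseq_rev_drop_many)
    then show "subseq [Suc i..<Suc j] (rev w)" using l(2) subseq_order.order_trans by blast
  next
    assume "subseq [Suc i..<Suc j] (rev w)"
    then show "\<exists>l<n. 0 < V $$ (i, l) \<and> 0 < V $$ (j, l)"
      using V_entry[of j j] V_entry[of i j] assms by (intro exI[of _ j]) auto
  qed
  finally show ?thesis .
qed

lemma half_bandwidth_inv_A: "0 < n \<Longrightarrow> half_bandwidth (inv_mat A) = run_max n (rev w)"
proof (rule half_bandwidth_eq_run_max)
  show "inv_mat A \<in> carrier_mat n n"
    unfolding inv_mat_A using W_carrier by (auto simp: Dinv_def intro!: mult_carrier_mat[of _ n n])
  fix i j assume ij: "i \<le> j" "j < n"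
  have sym: "(\<Sum>l<n. V $$ (j, l) * (Dinv $$ (l, l) * V $$ (i, l))) = (\<Sum>l<n. V $$ (i, l) * (Dinv $$ (l, l) * V $$ (j, l)))"
    by (simp add: algebra_simps)
  show "(inv_mat A $$ (i, j) \<noteq> 0 \<longleftrightarrow> subseq [Suc i..<Suc j] (rev w)) \<and>
      (inv_mat A $$ (j, i) \<noteq> 0 \<longleftrightarrow> subseq [Suc i..<Suc j] (rev w))"
    using inv_mat_A_entry[of i j] inv_mat_A_entry[of j i] inv_mat_A_entry_nonzero[OF ij] ij unfolding sym by simp
qed

text \<open>If the letter \<open>i\<close> is missing, the block with row indices less than
  \<open>i\<close> and column indices at least \<open>i\<close> is zero, and powers inherit this.
  Then the entry \<open>(i - 1, i)\<close>, a minor of order one, is never positive.\<close>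

lemma letters_of_oscillatory:
  assumes "oscillatory A"
  shows "{1..<n} \<subseteq> set w"
proof
  fix i assume "i \<in> {1..<n}"
  then have i: "1 \<le> i" "i < n" by auto
  show "i \<in> set w"
  proof (rule ccontr)
    assume no: "i \<notin> set w"
    have zero: "A $$ (r, c) = 0" if "r < i" "i \<le> c" "c < n" for r c
    proof (rule ccontr)
      assume "A $$ (r, c) \<noteq> 0"
      then have "subseq [Suc r..<Suc c] w" using A_entry_nonzero[of r c] that by simp
      then have "set [Suc r..<Suc c] \<subseteq> set w" by (rule subseq_set)
      moreover have "i \<in> set [Suc r..<Suc c]" using that by simp
      ultimately show False using no by blast
    qed
    have "(A ^\<^sub>m m) $$ (r, c) = 0" if "r < i" "i \<le> c" "c < n" for r c m
      using that
    proof (induction m arbitrary: r)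
      case 0
      then show ?case by (simp add: A_pow_0 del: pow_mat.simps)
    next
      case (Suc m)
      have "(A ^\<^sub>m Suc m) $$ (r, c) = (\<Sum>l<n. A $$ (r, l) * (A ^\<^sub>m m) $$ (l, c))"
        unfolding A_pow_Suc using Suc.prems i A_carrier A_pow_carrier[of m]
        by (auto simp: scalar_prod_def atLeast0LessThan intro!: sum.cong)
      also have "\<dots> = 0"
      proof (intro sum.neutral ballI)
        fix l assume "l \<in> {..<n}"
        then show "A $$ (r, l) * (A ^\<^sub>m m) $$ (l, c) = 0"
          using zero[of r l] Suc by (cases "l < i") auto
      qed
      finally show ?case .
    qed
    then have z: "(A ^\<^sub>m m) $$ (i - 1, i) = 0" for m using i by simp
    obtain m where "totally_positive (A ^\<^sub>m m)" using assms by (auto simp: oscillatory_def)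
    then have "0 < minor (A ^\<^sub>m m) 1 (\<lambda>_. i - 1) (\<lambda>_. i)"
      unfolding totally_positive_def minors_pos_iff[OF A_pow_carrier] using i by (auto simp: increasing_def)
    then show False using z minor_single[of "A ^\<^sub>m m"] by simp
  qed
qed

end

text \<open>An increasing and a decreasing subsequence share at most one position.\<close>
lemma length_disjoint_subseqs:
  "subseq xs w \<Longrightarrow> subseq ys w \<Longrightarrow> set xs \<inter> set ys = {} \<Longrightarrow> length xs + length ys \<le> length w"
proof (induction w arbitrary: xs ys)
  case (Cons a w)
  have drop: "subseq zs w \<or> (\<exists>zs'. zs = a # zs' \<and> subseq zs' w)" if "subseq zs (a # w)" for zs
    using that by (cases rule: list_emb.cases) auto
  from drop[OF Cons.prems(1)] drop[OF Cons.prems(2)] show ?case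
  proof (elim disjE exE conjE)
    fix xs' assume "xs = a # xs'" "subseq xs' w" "subseq ys w"
    then show ?thesis using Cons.IH[of xs' ys] Cons.prems(3) by auto
  next
    fix ys' assume "ys = a # ys'" "subseq ys' w" "subseq xs w"
    then show ?thesis using Cons.IH[of xs ys'] Cons.prems(3) by auto
  next
    assume "subseq xs w" "subseq ys w"
    then show ?thesis using Cons.IH[of xs ys] Cons.prems(3) by auto
  next
    fix xs' ys' assume "xs = a # xs'" "ys = a # ys'"
    then show ?thesis using Cons.prems(3) by auto
  qed
qed simp

text \<open>Once both subsequences use the same letter \<open>a\<close>, the rest of one lies above
  \<open>a\<close> and the rest of the other below it, so from there on they are disjoint.\<close>

lemma length_monotone_subseqs:
  fixes w :: "nat list"
  shows "subseq xs w \<Longrightarrow> subseq ys w \<Longrightarrow> sorted_wrt (<) xs \<Longrightarrow> sorted_wrt (>) ys \<Longrightarrow>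
    length xs + length ys \<le> length w + 1"
proof (induction w arbitrary: xs ys)
  case (Cons a w)
  have drop: "subseq zs w \<or> (\<exists>zs'. zs = a # zs' \<and> subseq zs' w)" if "subseq zs (a # w)" for zs
    using that by (cases rule: list_emb.cases) auto
  from drop[OF Cons.prems(1)] drop[OF Cons.prems(2)] show ?case
  proof (elim disjE exE conjE)
    fix xs' assume "xs = a # xs'" "subseq xs' w" "subseq ys w"
    then show ?thesis using Cons.IH[of xs' ys] Cons.prems(3,4) by auto
  next
    fix ys' assume "ys = a # ys'" "subseq ys' w" "subseq xs w"
    then show ?thesis using Cons.IH[of xs ys'] Cons.prems(3,4) by auto
  next
    assume "subseq xs w" "subseq ys w"
    then show ?thesis using Cons.IH[of xs ys] Cons.prems(3,4) by auto
  next
    fix xs' ys' assume *: "xs = a # xs'" "ys = a # ys'" "subseq xs' w" "subseq ys' w"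
    then have "set xs' \<inter> set ys' = {}" using Cons.prems(3,4) by fastforce
    then show ?thesis using length_disjoint_subseqs[of xs' w ys'] * by simp
  qed
qed (auto dest!: list_emb_length)

text \<open>The positive determinant of a totally positive power makes \<open>A\<close> nonsingular,
  as the elimination requires.\<close>

lemma oscillatory_sym_tn:
  assumes "A \<in> carrier_mat n n" "transpose_mat A = A" "oscillatory A"
  shows "sym_tn n A"
proof -
  have "tn n A" using assms totally_nonnegative_iff_tn by (simp add: oscillatory_def)
  obtain m where m: "1 \<le> m" "totally_positive (A ^\<^sub>m m)" using assms(3) by (auto simp: oscillatory_def)
  have "det (A ^\<^sub>m m) \<noteq> 0"
  proof (cases "n = 0")
    case True
    then show ?thesis using assms(1) by (simp add: det_dim_zero[of "A ^\<^sub>m m"])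
  next
    case False
    then have "0 < minor (A ^\<^sub>m m) n (\<lambda>s. s) (\<lambda>s. s)"
      using m(2) minors_pos_iff[of "A ^\<^sub>m m" n n] assms(1) increasing_id[of n n]
      unfolding totally_positive_def by (simp add: Suc_le_eq)
    then show ?thesis using minor_full[of "A ^\<^sub>m m" n] assms(1) by simp
  qed
  moreover have "A ^\<^sub>m m = A * A ^\<^sub>m (m - 1)"
    using pow_mat_Suc_left[OF assms(1), of "m - 1"] m(1) by simp
  ultimately have "det A \<noteq> 0" using det_mult[OF assms(1), of "A ^\<^sub>m (m - 1)"] assms(1) by auto
  then show ?thesis using assms \<open>tn n A\<close> by (simp add: sym_tn_def)
qed

lemma run_max_less: "0 < n \<Longrightarrow> run_max n w < n"
  using run_max_attained[of n w] by (metis add_lessD1 add.commute)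

lemma run_max_pos: "2 \<le> n \<Longrightarrow> 1 \<in> set w \<Longrightarrow> 1 \<le> run_max n w"
  using run_max_ge[of 0 1 n w] by (simp add: upt_rec subseq_singleton_left)

context sym_factorization
begin

lemma minor_exponent_le_bound:
  assumes letters: "{1..<n} \<subseteq> set w" and n: "2 \<le> n" and k: "1 \<le> k" "k < n"
  shows "minor_exponent k A \<le> exponent_bound n (run_max n w) (run_max n (rev w)) k"
proof -
  have 1: "1 \<in> set w" using letters n by auto
  obtain i where i: "i + run_max n w < n" "subseq [Suc i..<Suc (i + run_max n w)] w"
    using run_max_attained n by (metis neq0_conv not_less0 less_le_trans zero_less_numeral)
  have "minor_exponent k A \<le> max k (n - run_max n w)"
    by (rule minor_exponent_le_ascending_run[OF letters, of "Suc i"])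
       (use i k run_max_pos[OF n 1] in auto)
  moreover
  obtain j where j: "j + run_max n (rev w) < n" "subseq [Suc j..<Suc (j + run_max n (rev w))] (rev w)"
    using run_max_attained n by (metis neq0_conv not_less0 less_le_trans zero_less_numeral)
  have "minor_exponent k A \<le> max (n - k) (n - run_max n (rev w))"
    by (rule minor_exponent_le_descending_run[OF letters, of "Suc j"])
       (use j k run_max_pos[OF n, of "rev w"] 1 subseq_rev[OF j(2)] in auto)
  ultimately show ?thesis by (simp add: exponent_bound_def)
qed

end

lemma run_max_length:
  assumes "0 < n"
  shows "run_max n w + run_max n (rev w) \<le> length w + 1"
proof -
  obtain i where i: "i + run_max n w < n" "subseq [Suc i..<Suc (i + run_max n w)] w"
    using run_max_attained assms by blast
  obtain j where j: "j + run_max n (rev w) < n" "subseq [Suc j..<Suc (j + run_max n (rev w))] (rev w)"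
    using run_max_attained assms by blast
  have "sorted_wrt (>) (rev [a..<b])" for a b :: nat
    by (simp add: sorted_wrt_rev)
  then show ?thesis
    using length_monotone_subseqs[OF i(2), of "rev [Suc j..<Suc (j + run_max n (rev w))]"] subseq_rev[OF j(2)]
    by simp
qed

section \<open>The extremal word\<close>

lemma length_increasing_in_decreasing:
  fixes w :: "nat list"
  assumes "subseq xs w" "sorted_wrt (>) w" "sorted_wrt (<) xs"
  shows "length xs \<le> 1"
proof -
  obtain f where f: "\<And>a. a < length xs \<Longrightarrow> f a < length w \<and> w ! f a = xs ! a"
    "\<And>a b. a < b \<Longrightarrow> b < length xs \<Longrightarrow> f a < f b"
    using subseq_index[OF assms(1)] by blast
  show ?thesis
  proof (rule ccontr)
    assume "\<not> length xs \<le> 1"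
    then have l: "0 < length xs" "1 < length xs" by auto
    have "w ! f 1 < w ! f 0"
      using sorted_wrt_nth_less[OF assms(2), of "f 0" "f 1"] f(1)[OF l(2)] f(2)[of 0 1] l by simp
    moreover have "xs ! 0 < xs ! 1" using sorted_wrt_nth_less[OF assms(3), of 0 1] l by simp
    ultimately show False using f(1)[OF l(1)] f(1)[OF l(2)] by simp
  qed
qed

text \<open>A decreasing word offers at most one letter to an increasing sequence, and as
  \<open>u\<close> comes first this is the first letter of the interval.\<close>

lemma subseq_interval_appendD:
  fixes u v :: "nat list"
  assumes "subseq [Suc i..<Suc j] (u @ v)" "sorted_wrt (>) u" "i < j"
  shows "set [Suc i..<Suc j] \<subseteq> set v \<or> (Suc i \<in> set u \<and> set [Suc (Suc i)..<Suc j] \<subseteq> set v)"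
proof -
  obtain xs ys where s: "[Suc i..<Suc j] = xs @ ys" "subseq xs u" "subseq ys v"
    using assms(1) by (auto simp: subseq_append_iff)
  have "sorted_wrt (<) (xs @ ys)" unfolding s(1)[symmetric] by simp
  then have "length xs \<le> 1" using length_increasing_in_decreasing[OF s(2) assms(2)] by (simp add: sorted_wrt_append)
  moreover have "[Suc i..<Suc j] = Suc i # [Suc (Suc i)..<Suc j]" using assms(3) by (simp add: upt_rec)
  ultimately consider "xs = []" | "xs = [Suc i]" "ys = [Suc (Suc i)..<Suc j]"
    using s(1) by (cases xs) auto
  then show ?thesis
  proof cases
    case 1
    then show ?thesis using s subseq_set[OF s(3)] by simp
  next
    case 2
    then show ?thesis using subseq_set[OF s(2)] subseq_set[OF s(3)] by simp
  qed
qed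

context
  fixes n p q :: nat
  assumes p: "1 \<le> p" "p < n" and q: "1 \<le> q" "q < n" and pq: "n \<le> p + q"
begin

lemma extremal_word_letters: "set (extremal_word n p q) = {1..<n}"
  unfolding extremal_word_def using p q pq by auto

lemma extremal_word_length: "length (extremal_word n p q) = p + q - 1"
  unfolding extremal_word_def using p q by simp

lemma sorted_rev_upt: "sorted_wrt (>) (rev [a..<b :: nat])"
  by (simp add: sorted_wrt_rev)

lemma extremal_word_run: "run_max n (extremal_word n p q) = p"
proof (rule run_max_eqI[of 0])
  fix i j assume ij: "i < j" "j < n" "subseq [Suc i..<Suc j] (extremal_word n p q)"
  from subseq_interval_appendD[OF ij(3)[unfolded extremal_word_def] sorted_rev_upt ij(1)]
  have "j \<in> {1..<p + 1} \<or> j = Suc i"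
    using ij(1) by (cases "j = Suc i") auto
  then show "j - i \<le> p" using p by auto
qed (use p in \<open>auto simp: extremal_word_def subseq_drop_many\<close>)

lemma extremal_word_rev_run: "run_max n (rev (extremal_word n p q)) = q"
proof (rule run_max_eqI[of "n - q - 1"])
  have rev_eq: "rev (extremal_word n p q) = rev [1..<p + 1] @ [n - q + 1..<n]"
    by (simp add: extremal_word_def)
  have "[Suc (n - q - 1)..<Suc (n - q - 1 + q)] = [n - q] @ [n - q + 1..<n]"
    using q upt_conv_Cons[of "n - q" n] by (simp add: Suc_diff_Suc)
  \<comment> \<open>The letter \<open>n - q\<close> is absent from the segment \<open>n - 1\<close>,
    ..., \<open>n - q + 1\<close> and is borrowed from the segment 1, ..., \<open>p\<close>; it is
    available there because \<open>n \<le> p + q\<close>.\<close>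
  moreover have "subseq [n - q] (rev [1..<p + 1])" using p q pq by (auto simp: subseq_singleton_left)
  ultimately show "subseq [Suc (n - q - 1)..<Suc (n - q - 1 + q)] (rev (extremal_word n p q))"
    unfolding rev_eq by (metis list_emb_append_mono subseq_order.order_refl)
  fix i j assume ij: "i < j" "j < n" "subseq [Suc i..<Suc j] (rev (extremal_word n p q))"
  have *: "j = Suc i \<or> Suc (Suc i) \<in> set [Suc (Suc i)..<Suc j]" using ij(1) by auto
  from subseq_interval_appendD[OF ij(3)[unfolded rev_eq] sorted_rev_upt ij(1)]
  have "j = Suc i \<or> Suc (Suc i) \<in> set [n - q + 1..<n]"
  proof
    assume "set [Suc i..<Suc j] \<subseteq> set [n - q + 1..<n]"
    moreover have "Suc i \<in> set [Suc i..<Suc j]" using ij(1) by simp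
    ultimately have "Suc i \<in> set [n - q + 1..<n]" by blast
    then show ?thesis using ij by auto
  qed (use * in blast)
  then show "j - i \<le> q" using ij q by auto
qed (use q in auto)

end

text \<open>After a hop onto \<open>i\<close> the next hop would need the letter
  \<open>i + 1\<close>, which exceeds everything still to be read.\<close>

lemma upreach_decreasing_word:
  "increasing n k f \<Longrightarrow> sorted_wrt (>) w \<Longrightarrow> upreach n k w f h \<Longrightarrow> h s = f s \<or> (h s = Suc (f s) \<and> Suc (f s) \<in> set w)"
proof (induction w arbitrary: f)
  case (Cons i w)
  from Cons.prems(3) consider "upreach n k w f h"
    | t where "t < k" "Suc (f t) = i" "increasing n k (f(t := i))" "upreach n k w (f(t := i)) h"
    by auto
  then show ?case
  proof cases
    case 1
    then show ?thesis using Cons.IH[OF Cons.prems(1)] Cons.prems(2) by auto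
  next
    case 2
    then show ?thesis using Cons.IH[OF 2(3) _ 2(4)] Cons.prems(2) by (cases "s = t") auto
  qed
qed simp

text \<open>When the particle in front leaves site \<open>j\<close> by reading \<open>j + 1\<close>,
  the letter \<open>j\<close> does not return, so its former site stays out of reach. The clause
  that destinations are letters of the word carries the induction.\<close>

lemma upreach_increasing_word:
  "increasing n k f \<Longrightarrow> sorted_wrt (<) w \<Longrightarrow> upreach n k w f h \<Longrightarrow>
    (h s = f s \<or> (f s < h s \<and> h s \<in> set w)) \<and> (Suc s < k \<longrightarrow> h s < f (Suc s))"
proof (induction w arbitrary: f)
  case Nil
  then show ?case by (auto simp: increasing_mono)
next
  case (Cons i w)
  from Cons.prems(3) consider "upreach n k w f h"
    | t where "t < k" "Suc (f t) = i" "increasing n k (f(t := i))" "upreach n k w (f(t := i)) h"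
    by auto
  then show ?case
  proof cases
    case 1
    then show ?thesis using Cons.IH[OF Cons.prems(1) _ 1] Cons.prems(2) by auto
  next
    case 2
    have IH: "(h s = (f(t := i)) s \<or> ((f(t := i)) s < h s \<and> h s \<in> set w)) \<and> (Suc s < k \<longrightarrow> h s < (f(t := i)) (Suc s))"
      using Cons.IH[OF 2(3) _ 2(4)] Cons.prems(2) by simp
    \<comment> \<open>Particle \<open>s\<close> ends below \<open>i\<close>, whereas all remaining
      letters exceed \<open>i\<close>; hence it does not move any more.\<close>
    have "h s < f t" if "Suc s = t"
    proof -
      have "h s < i" using IH 2 that by simp
      then have "h s \<notin> set w" using Cons.prems(2) by auto
      then have "h s = f s" using IH that by simp
      then show ?thesis using increasing_mono[OF Cons.prems(1), of s t] that 2 by simp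
    qed
    then show ?thesis using IH 2(2) by (cases "s = t"; cases "Suc s = t") auto
  qed
qed

locale extremal_factorization = sym_factorization n "extremal_word n p q" as D
  for n p q :: nat and as :: "real list" and D :: "real mat" +
  assumes p: "1 \<le> p" "p < n" and q: "1 \<le> q" "q < n" and pq: "n \<le> p + q"
begin

text \<open>In the decreasing segment a particle hops at most once, and only onto a site above
  \<open>n - q\<close>. In the increasing segment it neither reaches the site held by the next
  particle at the start of that segment nor hops beyond \<open>p\<close>.\<close>

lemma upreach_extremal:
  assumes "increasing n k e" "upreach n k (extremal_word n p q) e h"
  shows "Suc s < k \<Longrightarrow> h s \<le> e (Suc s) \<and> (e (Suc s) < n - q \<longrightarrow> h s < e (Suc s))"
    and "s < k \<Longrightarrow> max (h s) (p - 1) \<le> Suc (max (e s) (p - 1))"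
proof -
  obtain g where g: "upreach n k (rev [n - q + 1..<n]) e g" "upreach n k [1..<p + 1] g h"
    using assms(2) unfolding extremal_word_def upreach_append_iff by blast
  have incg: "increasing n k g" using upreach_increasing[OF assms(1) g(1)] .
  have dec: "g s = e s \<or> (g s = Suc (e s) \<and> Suc (e s) \<in> {n - q + 1..<n})" for s
    using upreach_decreasing_word[OF assms(1) _ g(1), of s] by (simp add: sorted_wrt_rev)
  have inc: "(h s = g s \<or> (g s < h s \<and> h s \<in> {1..<p + 1})) \<and> (Suc s < k \<longrightarrow> h s < g (Suc s))" for s
    using upreach_increasing_word[OF incg _ g(2), of s] by simp
  show "h s \<le> e (Suc s) \<and> (e (Suc s) < n - q \<longrightarrow> h s < e (Suc s))" if "Suc s < k"
    using inc[of s] dec[of "Suc s"] that by auto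
  show "max (h s) (p - 1) \<le> Suc (max (e s) (p - 1))" if "s < k"
    using inc[of s] dec[of s] p by auto
qed

text \<open>A round takes particle \<open>s\<close> at most to the former site of particle
  \<open>s + 1\<close>, so \<open>m\<close> rounds take it at most to the initial site of particle
  \<open>s + m\<close>. Below \<open>n - q\<close> every round falls short by one more site, and
  these losses add up to \<open>m\<close>.\<close>

lemma power_nonzero_lowest:
  "increasing n k f \<Longrightarrow> increasing n k g \<Longrightarrow> minor (A ^\<^sub>m m) k f g \<noteq> 0 \<Longrightarrow> s + m < k \<Longrightarrow>
    g s \<le> f (s + m) \<and> (f (s + m) < n - q \<longrightarrow> g s + m \<le> f (s + m))"
proof (induction m arbitrary: f)
  case 0
  then show ?case using minor_one[of n k f g] by (auto simp: A_pow_0 simp del: pow_mat.simps split: if_splits)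
next
  case (Suc m)
  obtain e h where e: "increasing n k e" "\<And>s. e s \<le> f s" and up: "upreach n k (extremal_word n p q) e h"
    and h: "minor (A ^\<^sub>m m) k h g \<noteq> 0"
    using A_mult_nonzero[OF A_pow_carrier Suc.prems(1,2)] Suc.prems(3) A_pow_Suc by metis
  have "g s \<le> h (s + m) \<and> (h (s + m) < n - q \<longrightarrow> g s + m \<le> h (s + m))"
    using Suc.IH[OF upreach_increasing[OF e(1) up] Suc.prems(2) h] Suc.prems(4) by simp
  moreover have "h (s + m) \<le> e (Suc (s + m)) \<and> (e (Suc (s + m)) < n - q \<longrightarrow> h (s + m) < e (Suc (s + m)))"
    using upreach_extremal(1)[OF e(1) up, of "s + m"] Suc.prems(4) by simp
  moreover have "e (Suc (s + m)) \<le> f (s + Suc m)" using e(2)[of "s + Suc m"] by simp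
  ultimately show ?case by auto
qed

text \<open>Beyond site \<open>p - 1\<close> a particle gains at most one site per round; the
  maximum with \<open>p - 1\<close> hides the fast motion below.\<close>

lemma power_nonzero_highest:
  "increasing n k f \<Longrightarrow> increasing n k g \<Longrightarrow> minor (A ^\<^sub>m m) k f g \<noteq> 0 \<Longrightarrow> s < k \<Longrightarrow>
    max (g s) (p - 1) \<le> max (f s) (p - 1) + m"
proof (induction m arbitrary: f)
  case 0
  then show ?case using minor_one[of n k f g] by (auto simp: A_pow_0 simp del: pow_mat.simps split: if_splits)
next
  case (Suc m)
  obtain e h where e: "increasing n k e" "\<And>s. e s \<le> f s" and up: "upreach n k (extremal_word n p q) e h"
    and h: "minor (A ^\<^sub>m m) k h g \<noteq> 0"
    using A_mult_nonzero[OF A_pow_carrier Suc.prems(1,2)] Suc.prems(3) A_pow_Suc by metis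
  have "max (g s) (p - 1) \<le> max (h s) (p - 1) + m"
    using Suc.IH[OF upreach_increasing[OF e(1) up] Suc.prems(2) h] Suc.prems(4) by simp
  moreover have "max (h s) (p - 1) \<le> Suc (max (e s) (p - 1))"
    using upreach_extremal(2)[OF e(1) up Suc.prems(4)] .
  moreover have "e s \<le> f s" by (rule e(2))
  ultimately show ?case by linarith
qed

lemma minor_exponent_extremal:
  assumes n: "2 \<le> n" and k: "1 \<le> k" "k < n"
  shows "minor_exponent k A = exponent_bound n p q k"
proof (rule antisym)
  show "minor_exponent k A \<le> exponent_bound n p q k"
    using minor_exponent_le_bound[OF _ n k] extremal_word_letters[OF p q pq]
      extremal_word_run[OF p q pq] extremal_word_rev_run[OF p q pq] by simp
next
  have "oscillatory A" using A_oscillatory_of_letters extremal_word_letters[OF p q pq] n by simp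
  then obtain m0 where "1 \<le> m0" "totally_positive (A ^\<^sub>m m0)" by (auto simp: oscillatory_def)
  then have "1 \<le> m0 \<and> (\<forall>x\<in>minors k (A ^\<^sub>m m0). 0 < x)" using k by (auto simp: totally_positive_def)
  then have pos: "\<forall>x\<in>minors k (A ^\<^sub>m minor_exponent k A). 0 < x"
    unfolding minor_exponent_def by (rule LeastI2) simp
  define m where "m = minor_exponent k A"
  have inc: "increasing n k (\<lambda>s. s)" "increasing n k (\<lambda>s. n - k + s)"
    using increasing_id increasing_top k by auto
  have nz: "minor (A ^\<^sub>m m) k (\<lambda>s. s) (\<lambda>s. n - k + s) \<noteq> 0"
    using pos inc unfolding minors_pos_iff[OF A_pow_carrier] m_def by fastforce
  \<comment> \<open>If \<open>m < k\<close>, the lowest particle with target \<open>n - k\<close> is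
    limited by the initial site \<open>m\<close> of particle \<open>m\<close>. For
    \<open>m < n - q\<close> the accumulated losses would even give
    \<open>n - k + m \<le> m\<close>.\<close>
  have low: "n - k \<le> m \<and> n - q \<le> m" if "m < k"
    using power_nonzero_lowest[OF inc nz, of 0] that k by auto
  \<comment> \<open>The top particle has to travel from \<open>k - 1\<close> to
    \<open>n - 1\<close>.\<close>
  have high: "n - k \<le> m \<or> n - p \<le> m"
    using power_nonzero_highest[OF inc nz, of "k - 1"] k p by auto
  \<comment> \<open>If \<open>m < k\<close>, then \<open>m\<close> is at least the second maximum;
    if \<open>m\<close> is at least \<open>k\<close> and \<open>n - p\<close>, it is at least the
    first. In the remaining case \<open>m\<close> is at least \<open>k\<close> and
    \<open>n - k\<close> but below \<open>n - p\<close>; if also \<open>m < n - q\<close>, then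
    \<open>n \<le> 2 * m < 2 * n - p - q \<le> n\<close>, which is absurd.\<close>
  show "exponent_bound n p q k \<le> minor_exponent k A"
    unfolding m_def[symmetric] exponent_bound_def using low high pq k by linarith
qed

end

section \<open>Integer entries and determinant one\<close>

lemma upper_product_Ints:
  assumes "length as = length w" "set w \<subseteq> {1..<n}" "set as \<subseteq> \<int>" "r < n" "c < n"
  shows "upper_product n w as $$ (r, c) \<in> \<int>"
  using assms
proof (induction as w arbitrary: r rule: list_induct2)
  case (Cons a as i w)
  then have "upper_product n (i # w) (a # as) $$ (r, c) =
      upper_product n w as $$ (r, c) + (if r + 1 = i then a * upper_product n w as $$ (i, c) else 0)"
    by (simp add: upper_factor_mult_index del: index_mult_mat(1))
  then show ?case using Cons by auto
qed auto

lemma det_upper_product: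
  assumes "length as = length w" "set w \<subseteq> {1..<n}"
  shows "det (upper_product n w as) = 1"
  using assms
proof (induction as w rule: list_induct2)
  case (Cons a as i w)
  have "det (upper_factor n i a) = (\<Prod>j<n. upper_factor n i a $$ (j, j))"
    using det_upper_triangular[of "upper_factor n i a" n]
    by (auto simp: upper_triangular_def upper_factor_index prod_list_diag_prod atLeast0LessThan)
  also have "\<dots> = 1" by (rule prod.neutral) (auto simp: upper_factor_index)
  finally show ?case using Cons by (simp add: det_mult[of _ n])
qed simp

lemma pos_diagonal_one: "pos_diagonal n (1\<^sub>m n)"
  unfolding pos_diagonal_def diagonal_mat_def by simp

lemma det_sym_product_one:
  assumes "length as = length w" "set w \<subseteq> {1..<n}"
  shows "det (sym_product n w as (1\<^sub>m n)) = 1"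
proof -
  let ?U = "upper_product n w as"
  have U: "?U \<in> carrier_mat n n" using assms by simp
  then have "sym_product n w as (1\<^sub>m n) = transpose_mat ?U * ?U"
    unfolding sym_product_def by (simp add: right_mult_one_mat[of _ n n])
  then show ?thesis using U det_upper_product[OF assms] by (simp add: det_mult[of _ n] det_transpose[of _ n])
qed

theorem theorem4p4:
  fixes n p q :: nat and A :: "real mat"
  assumes "2 \<le> n"
    and "A \<in> carrier_mat n n"
    and "A\<^sup>T = A"
    and "oscillatory A"
    and "p = half_bandwidth A"
    and "q = half_bandwidth (inv_mat A)"
  shows "(\<forall>k. 1 \<le> k \<and> k < n \<longrightarrow> minor_exponent k A \<le> exponent_bound n p q k) \<and>
    (n \<le> p + q \<longrightarrow>
      (let w = extremal_word n p q in
        set w \<subseteq> {1..<n} \<and>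
        (\<forall>as D. pos_params w as \<and> pos_diagonal n D \<longrightarrow>
          (let B = sym_product n w as D in
            B \<in> carrier_mat n n \<and> B\<^sup>T = B \<and> oscillatory B \<and>
            half_bandwidth B = p \<and> half_bandwidth (inv_mat B) = q \<and>
            (\<forall>k. 1 \<le> k \<and> k < n \<longrightarrow> minor_exponent k B = exponent_bound n p q k))) \<and>
        length w = p + q - 1 \<and>
        p + q - 1 \<in> realizing_lengths n p q \<and>
        (\<forall>L\<in>realizing_lengths n p q. p + q - 1 \<le> L) \<and>
        (let B1 = sym_product n w (replicate (length w) 1) (1\<^sub>m n) in
          elements_mat B1 \<subseteq> \<int> \<and> det B1 = 1)))"
proof -
  \<comment> \<open>Through this factorization \<open>p\<close> and \<open>q\<close> become the
    longest runs of \<open>v\<close> and of its reversal, which also places both of them in the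
    range from 1 to \<open>n - 1\<close> assumed for the extremal word.\<close>
  obtain v bs C where v: "set v \<subseteq> {1..<n}" "pos_params v bs" "pos_diagonal n C"
    and A: "A = sym_product n v bs C"
    using sym_tn_factorizable[OF oscillatory_sym_tn[OF assms(2-4)]] unfolding factorizable_def by blast
  interpret A: sym_factorization n v bs C by standard fact+
  have n0: "0 < n" using assms(1) by simp
  have p_run: "p = run_max n v" and q_run: "q = run_max n (rev v)"
    using A.half_bandwidth_A[OF n0] A.half_bandwidth_inv_A[OF n0] assms(5,6) A by simp_all
  have letters: "{1..<n} \<subseteq> set v" using A.letters_of_oscillatory assms(4) A by simp
  have one: "1 \<in> set v" using letters assms(1) by auto
  have p: "1 \<le> p" "p < n" and q: "1 \<le> q" "q < n"
    using run_max_pos[OF assms(1)] run_max_less[OF n0] one p_run q_run by simp_all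
  have bound: "minor_exponent k A \<le> exponent_bound n p q k" if "1 \<le> k" "k < n" for k
    using A.minor_exponent_le_bound[OF letters assms(1) that] p_run q_run A by simp
  show ?thesis
  proof (intro conjI allI impI)
    assume pq: "n \<le> p + q"
    let ?w = "extremal_word n p q"
    have w: "set ?w = {1..<n}" "length ?w = p + q - 1"
      using extremal_word_letters[OF p q pq] extremal_word_length[OF p q pq] by auto
    have B: "sym_product n ?w as D \<in> carrier_mat n n \<and> transpose_mat (sym_product n ?w as D) = sym_product n ?w as D \<and>
        oscillatory (sym_product n ?w as D) \<and> half_bandwidth (sym_product n ?w as D) = p \<and>
        half_bandwidth (inv_mat (sym_product n ?w as D)) = q \<and>
        (\<forall>k. 1 \<le> k \<and> k < n \<longrightarrow> minor_exponent k (sym_product n ?w as D) = exponent_bound n p q k)"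
      if "pos_params ?w as" "pos_diagonal n D" for as D
    proof -
      interpret B: extremal_factorization n p q as D
        by unfold_locales (use that w p q pq in auto)
      show ?thesis
        using B.A_carrier B.A_pow_transpose[of 1] B.A_pow_1 B.A_oscillatory_of_letters w assms(1)
          B.half_bandwidth_A[OF n0] B.half_bandwidth_inv_A[OF n0] extremal_word_run[OF p q pq]
          extremal_word_rev_run[OF p q pq] B.minor_exponent_extremal[OF assms(1)] by simp
    qed
    let ?as = "replicate (length ?w) (1 :: real)"
    have ones: "pos_params ?w ?as" by (simp add: pos_params_def)
    have "p + q - 1 \<in> realizing_lengths n p q"
      unfolding realizing_lengths_def using B[OF ones pos_diagonal_one] w ones pos_diagonal_one
      by (intro CollectI exI[of _ ?w] exI[of _ ?as] exI[of _ "1\<^sub>m n"]) simp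
    moreover have "p + q - 1 \<le> L" if L: "L \<in> realizing_lengths n p q" for L
    proof -
      obtain u as D where u: "set u \<subseteq> {1..<n}" "pos_params u as" "pos_diagonal n D" "L = length u"
        "half_bandwidth (sym_product n u as D) = p" "half_bandwidth (inv_mat (sym_product n u as D)) = q"
        using L unfolding realizing_lengths_def by blast
      interpret u: sym_factorization n u as D by standard fact+
      show ?thesis
        using run_max_length[OF n0, of u] u.half_bandwidth_A[OF n0] u.half_bandwidth_inv_A[OF n0] u by simp
    qed
    moreover have "elements_mat (sym_product n ?w ?as (1\<^sub>m n)) \<subseteq> \<int>"
    proof
      fix x assume "x \<in> elements_mat (sym_product n ?w ?as (1\<^sub>m n))"
      interpret B: sym_factorization n ?w ?as "1\<^sub>m n"
        by unfold_locales (use ones pos_diagonal_one w in auto)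
      obtain i j where ij: "i < n" "j < n" and x: "x = sym_product n ?w ?as (1\<^sub>m n) $$ (i, j)"
        using \<open>x \<in> elements_mat _\<close> B.A_carrier by (auto dest!: elements_matD)
      show "x \<in> \<int>"
        unfolding x B.A_entry[OF ij]
        by (intro Ints_sum Ints_mult upper_product_Ints) (use w ij in auto)
    qed
    moreover have "det (sym_product n ?w ?as (1\<^sub>m n)) = 1"
      by (rule det_sym_product_one) (use w in auto)
    ultimately show "let w = extremal_word n p q in
        set w \<subseteq> {1..<n} \<and>
        (\<forall>as D. pos_params w as \<and> pos_diagonal n D \<longrightarrow>
          (let B = sym_product n w as D in
            B \<in> carrier_mat n n \<and> B\<^sup>T = B \<and> oscillatory B \<and>
            half_bandwidth B = p \<and> half_bandwidth (inv_mat B) = q \<and>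
            (\<forall>k. 1 \<le> k \<and> k < n \<longrightarrow> minor_exponent k B = exponent_bound n p q k))) \<and>
        length w = p + q - 1 \<and>
        p + q - 1 \<in> realizing_lengths n p q \<and>
        (\<forall>L\<in>realizing_lengths n p q. p + q - 1 \<le> L) \<and>
        (let B1 = sym_product n w (replicate (length w) 1) (1\<^sub>m n) in
          elements_mat B1 \<subseteq> \<int> \<and> det B1 = 1)"
      unfolding Let_def using B w by blast
  qed (use bound in auto)
qed

end
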